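(* For any $\beta>0$ and any positive integer $m$, the expected clustering coefficient of $G^n_{m,\beta}$ satisfies \[ \mathbb{E}[C(G^n_{m,\beta})]=\frac{3c_1\log n}{c_2\,n}+O(1/n)\qquad(n\to\infty), \] where \[ c_1=m(m-1)\frac{(1+\beta)^2}{\beta^2}+m(m-1)^2\frac{(1+\beta)^3}{\beta^2(2+\beta)},\qquad c_2=\frac{2+5\beta}{2\beta}m^2+\frac{2-\beta}{2\beta}m. \]
   Context: Fix a real $\beta>0$ and a positive integer $m$. The random tree process $(G^n_{1,\beta})_{n\ge1}$ is defined as follows. $G^1_{1,\beta}$ consists of a single vertex $v_1$ and no edges. Given $G^n_{1,\beta}$ with vertices $v_1,\dots,v_n$ and directed edges $e_2,\dots,e_n$ (where $e_i$ is the edge whose tail is $v_i$), $G^{n+1}_{1,\beta}$ is obtained by adding a vertex $v_{n+1}$ and a directed edge $e_{n+1}$ with tail $v_{n+1}$ and head a "target vertex" determined by a random variable $f_{n+1}$, independent of $f_2,\dots,f_n$, taking values in $\Omega_{n+1}=\{(i,v):1\le i\le n\}\cup\{(i,h),(i,t):2\le i\le n\}$ with $\Pr(f_{n+1}=(i,v))=\beta/((2+\beta)n-2)$ and $\Pr(f_{n+1}=(i,h))=\Pr(f_{n+1}=(i,t))=1/((2+\beta)n-2)$. If $f_{n+1}=(i,v)$ the target is $v_i$ (chosen "uniformly"); if $f_{n+1}=(i,h)$ the target is the head of $e_i$, and if $f_{n+1}=(i,t)$ the target is the tail $v_i$ of $e_i$ (chosen "preferentially", by copying the head half-edge, resp.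 tail half-edge, of $e_i$). Consequently the target is $v_i$ with probability $(d_n(v_i)+\beta)/((2+\beta)n-2)$, where $d_n(v)$ is the degree of $v$ in $G^n_{1,\beta}$. Each edge is regarded as two half-edges, one at each endpoint; the degree of a vertex is the number of half-edges at it (loops count twice). For $n\ge1$, $G^n_{m,\beta}$ is the undirected multigraph obtained from $G^{nm}_{1,\beta}$ by identifying, for each $j=1,\dots,n$, the vertices $v_{(j-1)m+1},\dots,v_{jm}$ into a single vertex $w_j$, keeping all edges (so loops and multiple edges may occur). A triangle in a multigraph is a set of three edges joining three distinct vertices pairwise; triangles are counted with multiplicity, i.e. the number of triangles on $w_a,w_b,w_c$ is the number of such sets of three edges. The clustering coefficient of a multigraph $G$ is \[ C(G)=\frac{3\times(\text{number of triangles in }G)}{\sum_{v\in V(G)}\binom{d(v)}{2}}, \] (taken to be $0$ if the denominator is $0$). *)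

theory Defs
  imports "HOL-Probability.Probability" "HOL-Library.Landau_Symbols"
begin

datatype choice = Vx nat | Hd nat | Tl nat

text \<open>A tree G^n_{1,beta} is encoded by the list hs of heads, hs ! (i-2) = index of the
 head of edge e_i (i = 2..n); vertices are v_1..v_n, so n = length hs + 1.\<close>

definition choice_weight :: "real \<Rightarrow> nat \<Rightarrow> choice \<Rightarrow> real" where
  "choice_weight \<beta> n c = (case c of
     Vx i \<Rightarrow> if 1 \<le> i \<and> i \<le> n then \<beta> / ((2 + \<beta>) * real n - 2) else 0
   | Hd i \<Rightarrow> if 2 \<le> i \<and> i \<le> n then 1 / ((2 + \<beta>) * real n - 2) else 0
   | Tl i \<Rightarrow> if 2 \<le> i \<and> i \<le> n then 1 / ((2 + \<beta>) * real n - 2) else 0)"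

definition choice_pmf :: "real \<Rightarrow> nat \<Rightarrow> choice pmf" where
  "choice_pmf \<beta> n = embed_pmf (choice_weight \<beta> n)"

definition target :: "nat list \<Rightarrow> choice \<Rightarrow> nat" where
  "target hs c = (case c of Vx i \<Rightarrow> i | Hd i \<Rightarrow> hs ! (i - 2) | Tl i \<Rightarrow> i)"

fun tree_pmf :: "real \<Rightarrow> nat \<Rightarrow> nat list pmf" where
  "tree_pmf \<beta> 0 = return_pmf []"
| "tree_pmf \<beta> (Suc 0) = return_pmf []"
| "tree_pmf \<beta> (Suc (Suc n)) =
     bind_pmf (tree_pmf \<beta> (Suc n))
       (\<lambda>hs. map_pmf (\<lambda>c. hs @ [target hs c]) (choice_pmf \<beta> (Suc n)))"

text \<open>Vertex v_k of G^{nm}_{1,beta} is merged into w_{grp m k}.\<close>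
definition grp :: "nat \<Rightarrow> nat \<Rightarrow> nat" where
  "grp m k = (k - 1) div m + 1"

definition endpts :: "nat \<Rightarrow> nat list \<Rightarrow> nat \<Rightarrow> nat set" where
  "endpts m hs k = {grp m k, grp m (hs ! (k - 2))}"

text \<open>Number of triangles of G^n_{m,beta}, counted with multiplicity: sets of three edges
 joining three distinct vertices pairwise.\<close>
definition triangles :: "nat \<Rightarrow> nat \<Rightarrow> nat list \<Rightarrow> nat" where
  "triangles m n hs = card {S. S \<subseteq> {2..n*m} \<and> card S = 3 \<and>
     (\<exists>x y z. x \<noteq> y \<and> y \<noteq> z \<and> x \<noteq> z \<and>
        endpts m hs ` S = {{x,y},{y,z},{x,z}})}"

text \<open>Degree of w_j: number of half-edges at w_j (loops count twice).\<close>
definition deg :: "nat \<Rightarrow> nat \<Rightarrow> nat list \<Rightarrow> nat \<Rightarrow> nat" where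
  "deg m n hs j = card {k \<in> {2..n*m}. grp m k = j} + card {k \<in> {2..n*m}. grp m (hs ! (k - 2)) = j}"

definition clustering :: "nat \<Rightarrow> nat \<Rightarrow> nat list \<Rightarrow> real" where
  "clustering m n hs =
     (let D = (\<Sum>j\<in>{1..n}. real (deg m n hs j choose 2))
      in if D = 0 then 0 else 3 * real (triangles m n hs) / D)"

definition exp_clustering :: "real \<Rightarrow> nat \<Rightarrow> nat \<Rightarrow> real" where
  "exp_clustering \<beta> m n = measure_pmf.expectation (tree_pmf \<beta> (n * m)) (clustering m n)"

end

theory Submission
  imports Defs
begin

text \<open>Give each merged vertex the weight w = degree + $\beta$m; the next head falls into it with
  probability proportional to w. For merged vertices that are complete, the rising factorials of w
  and the products of two weights are eigenfunctions of the one-step operator. Over the m steps that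
  create the (g+1)-st merged vertex, the sum V of w(w+1), the sum R of the products of weights along
  the non-loop edges and the number T of triangles therefore drift, with $\theta = 1/(2+\beta)$, by
  \[ \Delta V \approx \frac{2\theta}{g} V + \mu, \quad
     \Delta R \approx \frac{2\theta}{g} R + \frac{m(1+\beta)\theta}{g} V, \quad
     \Delta T \approx \frac{(m-1)\theta^2}{m} \frac{R}{g^2}, \]
  the last because a new triangle consists of two edges of the new vertex and an old edge joining
  their heads. As $2\theta < 1$, the means of V and R are linear in g up to $O(g^{1/2+\theta})$, so
  that of T is $c_1 \log g + O(1)$. The denominator of the clustering coefficient is at least n - 2
  and differs from $c_2 n$ by half of Y = V - $\lambda$n plus a constant; replacing it by $c_2 n$
  costs E(T(1+|Y|))/n^2 up to a constant factor, and this is O(1/n) since the high moments of Y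
  are small.\<close>

section \<open>Real recursions and inequalities\<close>

text \<open>A rising factorial w(w+1)...(w+p-1) is reproduced by a step because w times its
  increment is p times itself. This fails while tails can still be added to the vertex, so time
  advances in blocks of m edges. The mean of \<open>V 2\<close> satisfies x(g+1) = (1 + 2 theta/g)
  x(g) + const up to small errors; homogeneous solutions grow like g^(2 theta), slower than the
  linear particular solution exactly because beta > 0. The exponent 1/2 + theta, between 2 theta and
  1, serves as the error order. The mean of \<open>V 3\<close> need not be linear, since 3 theta may
  exceed 1 when beta < 1; there the order g^(1 + theta) suffices. The last obstacle is that the
  triangle count T and the denominator are dependent, while only the mean of T is estimated. Below a
  level |Y| = n^(1-d) that mean, which is O(n^d), is enough; above it T is at most (nm)^3, and a
  sufficiently high even moment of Y pays for this polynomial factor.\<close>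

lemma powr_Suc_lower:
  fixes b :: real
  assumes "b \<ge> 0" "g \<ge> (1::nat)"
  shows "real g powr b * (1 + b / real g - b / (real g)\<^sup>2) \<le> real (Suc g) powr b"
proof -
  define t where "t = 1 / real g"
  have t: "0 \<le> t" "t \<le> 1" using assms by (auto simp: t_def)
  \<comment> \<open>From ln (1 + t) >= t - t^2 and exp x >= 1 + x. The loss is only of order 1/g^2,
    below the gap (b - a)/g that \<open>recursion_powr_bound\<close> exploits.\<close>
  have "1 + b * (t - t\<^sup>2) \<le> 1 + b * ln (1 + t)"
    using ln_one_plus_pos_lower_bound[of t] t assms by (simp add: mult_left_mono)
  also have "\<dots> \<le> exp (b * ln (1 + t))" by simp
  also have "\<dots> = (1 + t) powr b" using t by (simp add: powr_def)
  finally have "1 + b * (t - t\<^sup>2) \<le> (1 + t) powr b" .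
  hence "real g powr b * (1 + b * (t - t\<^sup>2)) \<le> real g powr b * (1 + t) powr b"
    by (rule mult_left_mono) auto
  also have "\<dots> = (real g * (1 + t)) powr b" using t assms by (simp add: powr_mult)
  also have "real g * (1 + t) = real (Suc g)" using assms by (simp add: t_def field_simps)
  finally show ?thesis by (simp add: t_def field_simps power2_eq_square)
qed

text \<open>\<open>K * real g powr b\<close> is a supersolution: its relative growth b/g exceeds
  a/g, and the surplus K(b - a)/g pays for the terms of order 1/g^2 and for the forcing once g and K
  are large.\<close>

lemma recursion_powr_bound:
  fixes x :: "nat \<Rightarrow> real" and a b C :: real
  assumes ab: "a < b" and b: "b \<ge> 0" and C: "C \<ge> 0"
    and rec: "\<And>g. g \<ge> 1 \<Longrightarrow> x (Suc g) \<le> (1 + a / real g + C / (real g)\<^sup>2) * x g + C * real g powr (b - 1)"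
    and pos: "\<And>g. g \<ge> 1 \<Longrightarrow> x g \<ge> 0"
  shows "\<exists>K\<ge>0. \<forall>g\<ge>1. x g \<le> K * real g powr b"
proof -
  \<comment> \<open>Past \<open>g0\<close> half of the surplus covers the second-order terms. The
    summand \<open>\<bar>a\<bar> + 1\<close> keeps the factor of \<open>x g\<close> nonnegative, so
    that the induction hypothesis can be multiplied by it.\<close>
  obtain g0 :: nat where g0: "real g0 \<ge> 2 * (C + b) / (b - a) + \<bar>a\<bar> + 1" using real_arch_simple by blast
  \<comment> \<open>The first summand makes the other half of the surplus cover the forcing; the
    finite sum bounds \<open>x g / real g powr b\<close> on the initial segment.\<close>
  define K where "K = 2 * C / (b - a) + (\<Sum>g\<in>{1..g0}. x g / real g powr b)"
  have S0: "(\<Sum>g\<in>{1..g0}. x g / real g powr b) \<ge> 0" by (intro sum_nonneg) (auto simp: pos)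
  have K0: "K \<ge> 0" unfolding K_def using S0 ab C by simp
  have KC: "K * (b - a) \<ge> 2 * C"
  proof -
    have "(\<Sum>g\<in>{1..g0}. x g / real g powr b) * (b - a) \<ge> 0" using S0 ab by (intro mult_nonneg_nonneg) auto
    thus ?thesis unfolding K_def using ab by (simp add: distrib_right)
  qed
  have g00: "g0 \<ge> 1"
  proof -
    have "2 * (C + b) / (b - a) \<ge> 0" using ab b C by simp
    thus ?thesis using g0 by linarith
  qed
  have "x g \<le> K * real g powr b" if "g \<ge> 1" for g
    using that
  proof (induction g rule: nat_induct_at_least)
    case base
    have "x 1 / real 1 powr b \<le> (\<Sum>g\<in>{1..g0}. x g / real g powr b)"
      by (rule member_le_sum) (use g00 in \<open>auto simp: pos\<close>)
    also have "\<dots> \<le> K" unfolding K_def using ab C by simp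
    finally show ?case by simp
  next
    case (Suc g)
    show ?case
    proof (cases "Suc g \<le> g0")
      case True
      have "x (Suc g) / real (Suc g) powr b \<le> (\<Sum>g\<in>{1..g0}. x g / real g powr b)"
        by (rule member_le_sum[of "Suc g" _ "\<lambda>g. x g / real g powr b"]) (use True in \<open>auto simp: pos\<close>)
      also have "\<dots> \<le> K" unfolding K_def using ab C by simp
      finally show ?thesis by (simp add: divide_le_eq)
    next
      case False
      hence gg: "real g \<ge> real g0" by simp
      define t where "t = real g"
      have t1: "t \<ge> 1" using gg g00 by (simp add: t_def)
      have ta: "t \<ge> \<bar>a\<bar> + 1"
      proof -
        have "2 * (C + b) / (b - a) \<ge> 0" using ab b C by simp
        thus ?thesis using g0 gg unfolding t_def by linarith
      qed
      have fac: "1 + a / t + C / t\<^sup>2 \<ge> 0"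
      proof -
        have "a / t \<ge> -1" using ta t1 by (simp add: field_simps)
        moreover have "C / t\<^sup>2 \<ge> 0" using C by simp
        ultimately show ?thesis by linarith
      qed
      have tb: "t * (b - a) \<ge> 2 * (C + b)"
      proof -
        have "t \<ge> 2 * (C + b) / (b - a)" using g0 gg unfolding t_def by linarith
        thus ?thesis using ab by (simp add: field_simps)
      qed
      have key: "(1 + a / t + C / t\<^sup>2) * K + C / t \<le> K * (1 + b / t - b / t\<^sup>2)"
      proof -
        have "K * (2 * (C + b)) \<le> K * (t * (b - a))" using tb K0 by (rule mult_left_mono)
        moreover have "2 * C * t \<le> K * (b - a) * t" using KC t1 by (intro mult_right_mono) auto
        ultimately have "C * t + K * (C + b) \<le> K * (b - a) * t" by (simp add: algebra_simps)
        hence "(C * t + K * (C + b)) / t\<^sup>2 \<le> (K * (b - a) * t) / t\<^sup>2" by (rule divide_right_mono) simp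
        moreover have "(C * t + K * (C + b)) / t\<^sup>2 = C / t + K * C / t\<^sup>2 + K * b / t\<^sup>2"
          using t1 by (simp add: power2_eq_square add_divide_distrib distrib_left)
        moreover have "(K * (b - a) * t) / t\<^sup>2 = K * b / t - K * a / t"
          using t1 by (simp add: power2_eq_square diff_divide_distrib algebra_simps)
        ultimately show ?thesis by (simp add: algebra_simps)
      qed
      have "x (Suc g) \<le> (1 + a / t + C / t\<^sup>2) * x g + C * t powr (b - 1)"
        using rec[of g] Suc.hyps by (simp add: t_def)
      also have "\<dots> \<le> (1 + a / t + C / t\<^sup>2) * (K * t powr b) + C * t powr (b - 1)"
        using Suc.IH fac by (simp add: t_def mult_left_mono)
      also have "t powr (b - 1) = t powr b / t" using t1 by (simp add: powr_diff)
      also have "(1 + a / t + C / t\<^sup>2) * (K * t powr b) + C * (t powr b / t)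
          = t powr b * ((1 + a / t + C / t\<^sup>2) * K + C / t)" by (simp add: algebra_simps)
      also have "\<dots> \<le> t powr b * (K * (1 + b / t - b / t\<^sup>2))" using key by (rule mult_left_mono) simp
      also have "\<dots> = K * (t powr b * (1 + b / t - b / t\<^sup>2))" by simp
      also have "\<dots> \<le> K * real (Suc g) powr b"
        using powr_Suc_lower[OF b Suc.hyps] K0 by (simp add: t_def mult_left_mono)
      finally show ?thesis .
    qed
  qed
  thus ?thesis using K0 by blast
qed

lemma harm_ln_bounded:
  assumes "g \<ge> (1::nat)"
  shows "\<bar>(\<Sum>i=1..<g. 1 / real i) - ln (real g)\<bar> \<le> 1"
  using assms
proof (induction g rule: nat_induct_at_least)
  case base thus ?case by simp
next
  case (Suc g)
  \<comment> \<open>The extra \<open>- 1 / real g\<close> closes the induction: adding 1/g restores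
    1 + ln g, and ln (g+1) - ln g >= 1/(g+1) recovers the form at g + 1.\<close>
  have up: "(\<Sum>i=1..<g. 1 / real i) \<le> 1 + ln (real g) - 1 / real g" if "g \<ge> 1" for g
    using that
  proof (induction g rule: nat_induct_at_least)
    case base thus ?case by simp
  next
    case (Suc g)
    have "ln (real g / real (Suc g)) \<le> real g / real (Suc g) - 1"
      using Suc by (intro ln_le_minus_one) auto
    hence "1 / real (Suc g) \<le> ln (real (Suc g)) - ln (real g)"
      using Suc by (simp add: ln_div field_simps)
    thus ?case using Suc by (simp add: sum.atLeastLessThan_Suc)
  qed
  have lo: "ln (real g) \<le> (\<Sum>i=1..<g. 1 / real i)" if "g \<ge> 1" for g
    using that
  proof (induction g rule: nat_induct_at_least)
    case base thus ?case by simp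
  next
    case (Suc g)
    have "ln (real (Suc g) / real g) \<le> real (Suc g) / real g - 1"
      using Suc by (intro ln_le_minus_one) auto
    hence "ln (real (Suc g)) - ln (real g) \<le> 1 / real g"
      using Suc by (simp add: ln_div field_simps)
    thus ?case using Suc by (simp add: sum.atLeastLessThan_Suc)
  qed
  have "0 \<le> 1 / real (Suc g)" by simp
  thus ?case using up[of "Suc g"] lo[of "Suc g"] unfolding abs_le_iff by linarith
qed

text \<open>Telescoping: the terms c/i add up to c ln g within |c|, and the errors are summable
  because b - 2 < -1.\<close>

lemma recursion_ln_bound:
  fixes x :: "nat \<Rightarrow> real"
  assumes b: "b < 1" and C: "C \<ge> 0"
    and rec: "\<And>g. g \<ge> 1 \<Longrightarrow> \<bar>x (Suc g) - x g - c / real g\<bar> \<le> C * real g powr (b - 2)"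
  shows "\<exists>K\<ge>0. \<forall>g\<ge>1. \<bar>x g - c * ln (real g)\<bar> \<le> K"
proof -
  have "summable (\<lambda>g. real g powr (b - 2))" using b by (subst summable_real_powr_iff) auto
  then obtain M where M: "\<And>g. (\<Sum>i<g. real i powr (b - 2)) \<le> M"
    by (metis powr_ge_zero sum_le_suminf finite_lessThan)
  have tele: "\<bar>x g - x 1 - c * (\<Sum>i=1..<g. 1 / real i)\<bar> \<le> C * (\<Sum>i=1..<g. real i powr (b - 2))" if "g \<ge> 1" for g
    using that
  proof (induction g rule: nat_induct_at_least)
    case base thus ?case by simp
  next
    case (Suc g)
    show ?case using Suc rec[of g] by (simp add: sum.atLeastLessThan_Suc distrib_left)
  qed
  have "\<bar>x g - c * ln (real g)\<bar> \<le> C * M + \<bar>x 1\<bar> + \<bar>c\<bar>" if g: "g \<ge> 1" for g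
  proof -
    have "(\<Sum>i=1..<g. real i powr (b - 2)) \<le> (\<Sum>i<g. real i powr (b - 2))"
      by (rule sum_mono2) auto
    hence "C * (\<Sum>i=1..<g. real i powr (b - 2)) \<le> C * M" using M[of g] C by (intro mult_left_mono) auto
    hence 1: "\<bar>x g - x 1 - c * (\<Sum>i=1..<g. 1 / real i)\<bar> \<le> C * M" using tele[OF g] by linarith
    have "\<bar>c\<bar> * \<bar>(\<Sum>i=1..<g. 1 / real i) - ln (real g)\<bar> \<le> \<bar>c\<bar> * 1"
      using harm_ln_bounded[OF g] by (intro mult_left_mono) auto
    hence "\<bar>c * (\<Sum>i=1..<g. 1 / real i) - c * ln (real g)\<bar> \<le> \<bar>c\<bar>"
      by (simp add: abs_mult flip: right_diff_distrib)
    thus ?thesis using 1 by linarith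
  qed
  moreover have "C * M + \<bar>x 1\<bar> + \<bar>c\<bar> \<ge> 0"
  proof -
    have "M \<ge> 0" using M[of 0] by simp
    thus ?thesis using C by simp
  qed
  ultimately show ?thesis by blast
qed

section \<open>Polynomial and Young-type inequalities\<close>

lemma one_plus_power_le_quadratic:
  fixes T :: real
  assumes "T \<ge> 0"
  shows "\<exists>A\<ge>0. \<forall>t\<in>{0..T}. (1 + t) ^ m \<le> 1 + real m * t + A * t\<^sup>2"
proof (induction m)
  case 0
  show ?case by (rule exI[of _ 0]) auto
next
  case (Suc m)
  then obtain A where A: "A \<ge> 0" "\<And>t. t \<in> {0..T} \<Longrightarrow> (1 + t) ^ m \<le> 1 + real m * t + A * t\<^sup>2" by auto
  have "(1 + t) ^ Suc m \<le> 1 + real (Suc m) * t + (real m + A + A * T) * t\<^sup>2" if t: "t \<in> {0..T}" for t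
  proof -
    have "(1 + t) ^ Suc m \<le> (1 + t) * (1 + real m * t + A * t\<^sup>2)"
      using A(2)[OF t] t by (simp add: mult_left_mono)
    also have "\<dots> = 1 + real (Suc m) * t + (real m + A) * t\<^sup>2 + A * (t * t\<^sup>2)"
      by (simp add: algebra_simps power2_eq_square)
    \<comment> \<open>The cubic term becomes quadratic by t <= T; this is why the range of t must be
      bounded.\<close>
    also have "A * (t * t\<^sup>2) \<le> A * (T * t\<^sup>2)" using t A by (intro mult_left_mono mult_right_mono) auto
    finally show ?thesis by (simp add: algebra_simps)
  qed
  thus ?case using A assms by (intro exI[of _ "real m + A + A * T"]) auto
qed

text \<open>The terms of order 0 and 1 in z stay exact because they carry the drift. For j >= 2 the
  monomial y^(2k-j) z^j is dominated by y^(2k-2) z^2 when |z| <= |y| and by z^(2k) otherwise, and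
  the binomial coefficients sum to 4^k.\<close>

lemma even_power_add_le:
  fixes y z :: real
  assumes k: "k \<ge> 1"
  shows "(y + z) ^ (2 * k) \<le> y ^ (2 * k) + 2 * real k * y ^ (2 * k - 1) * z
    + 4 ^ k * (y ^ (2 * k - 2) * z\<^sup>2 + z ^ (2 * k))"
proof -
  have nn: "0 \<le> y ^ (2 * k - 2) * z\<^sup>2 + z ^ (2 * k)"
  proof -
    have "2 * k - 2 = 2 * (k - 1)" by simp
    thus ?thesis by (simp add: power_mult)
  qed
  have each: "y ^ (2 * k - j) * z ^ j \<le> y ^ (2 * k - 2) * z\<^sup>2 + z ^ (2 * k)" if j: "j \<in> {2..2*k}" for j
  proof -
    define a where "a = \<bar>y\<bar>"
    define c where "c = \<bar>z\<bar>"
    have ac: "a \<ge> 0" "c \<ge> 0" by (auto simp: a_def c_def)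
    have even: "y ^ (2 * k - 2) = a ^ (2 * k - 2)" "z\<^sup>2 = c\<^sup>2" "z ^ (2 * k) = c ^ (2 * k)"
    proof -
      have "2 * k - 2 = 2 * (k - 1)" by simp
      thus "y ^ (2 * k - 2) = a ^ (2 * k - 2)" by (simp add: a_def power_mult)
    qed (auto simp: c_def power_mult)
    have "y ^ (2 * k - j) * z ^ j \<le> \<bar>y ^ (2 * k - j) * z ^ j\<bar>" by simp
    also have "\<dots> = a ^ (2 * k - j) * c ^ j" by (simp add: abs_mult power_abs a_def c_def)
    also have "\<dots> \<le> a ^ (2 * k - 2) * c\<^sup>2 + c ^ (2 * k)"
    proof (cases "c \<le> a")
      case True
      have "a ^ (2 * k - j) * c ^ j = a ^ (2 * k - j) * (c ^ (j - 2) * c\<^sup>2)"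
        using j by (metis power_add le_add_diff_inverse2 atLeastAtMost_iff)
      also have "\<dots> \<le> a ^ (2 * k - j) * (a ^ (j - 2) * c\<^sup>2)"
        using True ac by (intro mult_left_mono mult_right_mono power_mono) auto
      also have "\<dots> = a ^ (2 * k - 2) * c\<^sup>2" using j by (simp flip: power_add mult.assoc)
      finally show ?thesis using ac by (simp add: add_increasing2)
    next
      case False
      have "a ^ (2 * k - j) * c ^ j \<le> c ^ (2 * k - j) * c ^ j"
        using False ac by (intro mult_right_mono power_mono) auto
      also have "\<dots> = c ^ (2 * k)" using j by (simp flip: power_add)
      finally show ?thesis using ac by (simp add: add_increasing)
    qed
    finally show ?thesis by (simp add: even)
  qed
  have "(y + z) ^ (2 * k) = (\<Sum>j\<le>2*k. real (2 * k choose j) * (y ^ (2 * k - j) * z ^ j))"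
    by (subst add.commute, subst binomial_ring) (simp add: mult_ac)
  also have "{..2*k} = insert 0 (insert 1 {2..2*k})" using k by auto
  also have "(\<Sum>j\<in>insert 0 (insert 1 {2..2*k}). real (2 * k choose j) * (y ^ (2 * k - j) * z ^ j))
     = y ^ (2 * k) + 2 * real k * y ^ (2 * k - 1) * z + (\<Sum>j\<in>{2..2*k}. real (2 * k choose j) * (y ^ (2 * k - j) * z ^ j))"
    by (simp add: mult_ac)
  also have "(\<Sum>j\<in>{2..2*k}. real (2 * k choose j) * (y ^ (2 * k - j) * z ^ j))
     \<le> (\<Sum>j\<in>{2..2*k}. real (2 * k choose j) * (y ^ (2 * k - 2) * z\<^sup>2 + z ^ (2 * k)))"
    by (intro sum_mono mult_left_mono each) auto
  also have "\<dots> \<le> (\<Sum>j\<le>2*k. real (2 * k choose j) * (y ^ (2 * k - 2) * z\<^sup>2 + z ^ (2 * k)))"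
    by (rule sum_mono2) (use nn in auto)
  also have "\<dots> = 4 ^ k * (y ^ (2 * k - 2) * z\<^sup>2 + z ^ (2 * k))"
  proof -
    have "(\<Sum>j\<le>2*k. real (2 * k choose j)) = 4 ^ k"
      by (simp flip: of_nat_sum add: choose_row_sum power_mult)
    thus ?thesis by (simp flip: sum_distrib_right)
  qed
  finally show ?thesis by simp
qed

text \<open>Compare z^2 with e y^2/t: the smaller one is replaced by the larger. With t = g the
  first term adds only e/g to the growth rate of y^(2k), with e at disposal, and the second costs a
  factor t^(k-1).\<close>

lemma young_square:
  fixes y z e t :: real
  assumes "e > 0" "t > 0" "k \<ge> 1"
  shows "y ^ (2 * k - 2) * z\<^sup>2 \<le> e * y ^ (2 * k) / t + (t / e) ^ (k - 1) * z ^ (2 * k)"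
proof -
  have "a ^ (k - 1) * a = a ^ k" for a :: real using assms(3) by (intro power_minus_mult) simp
  moreover have "y ^ (2 * k - 2) = (y\<^sup>2) ^ (k - 1)" "y ^ (2 * k) = (y\<^sup>2) ^ k" "z ^ (2 * k) = (z\<^sup>2) ^ k"
    by (simp_all flip: power_mult add: diff_mult_distrib2)
  ultimately have pow: "y ^ (2 * k - 2) = (y\<^sup>2) ^ (k - 1)" "y ^ (2 * k) = (y\<^sup>2) ^ k" "z ^ (2 * k) = (z\<^sup>2) ^ k"
    "\<And>a::real. a ^ (k - 1) * a = a ^ k" by blast+
  show ?thesis
  proof (cases "z\<^sup>2 \<le> e * y\<^sup>2 / t")
    case True
    have "y ^ (2 * k - 2) * z\<^sup>2 \<le> (y\<^sup>2) ^ (k - 1) * (e * y\<^sup>2 / t)"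
      unfolding pow using True by (intro mult_left_mono) auto
    also have "\<dots> = e * ((y\<^sup>2) ^ (k - 1) * y\<^sup>2) / t" by simp
    also have "\<dots> = e * y ^ (2 * k) / t" unfolding pow ..
    finally show ?thesis using assms by (simp add: pow(3) add_increasing2)
  next
    case False
    hence "y\<^sup>2 \<le> t / e * z\<^sup>2" using assms by (simp add: field_simps)
    hence "(y\<^sup>2) ^ (k - 1) \<le> (t / e * z\<^sup>2) ^ (k - 1)" by (intro power_mono) auto
    hence "(y\<^sup>2) ^ (k - 1) * z\<^sup>2 \<le> (t / e * z\<^sup>2) ^ (k - 1) * z\<^sup>2" by (intro mult_right_mono) auto
    also have "\<dots> = (t / e) ^ (k - 1) * ((z\<^sup>2) ^ (k - 1) * z\<^sup>2)" by (simp only: power_mult_distrib mult.assoc)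
    also have "\<dots> = (t / e) ^ (k - 1) * z ^ (2 * k)" unfolding pow ..
    finally show ?thesis using assms by (simp add: pow(1,2) add_increasing)
  qed
qed

text \<open>If |y| >= 2D, one factor |y| absorbs D; otherwise |y| is bounded. This disposes of the
  odd power produced by the O(1/g) bias of the increments.\<close>

lemma young_odd:
  fixes y D :: real
  assumes "D \<ge> 0" "k \<ge> 1"
  shows "D * \<bar>y\<bar> ^ (2 * k - 1) \<le> y ^ (2 * k) / 2 + D * (2 * D) ^ (2 * k - 1)"
proof -
  have pow: "y ^ (2 * k) = \<bar>y\<bar> * \<bar>y\<bar> ^ (2 * k - 1)"
    using power_minus_mult[of "2 * k" "\<bar>y\<bar>"] assms by (simp add: power_even_abs mult.commute)
  show ?thesis
  proof (cases "\<bar>y\<bar> \<ge> 2 * D")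
    case True
    hence "(2 * D) * \<bar>y\<bar> ^ (2 * k - 1) \<le> \<bar>y\<bar> * \<bar>y\<bar> ^ (2 * k - 1)" by (intro mult_right_mono) auto
    thus ?thesis using assms by (simp add: pow add_increasing2)
  next
    case False
    hence "D * \<bar>y\<bar> ^ (2 * k - 1) \<le> D * (2 * D) ^ (2 * k - 1)"
      using assms by (intro mult_left_mono power_mono) auto
    thus ?thesis by (simp add: pow add_increasing)
  qed
qed

lemma power_sum_le:
  fixes a :: "nat \<Rightarrow> real"
  assumes "\<And>i. i < n \<Longrightarrow> a i \<ge> 0" "n \<ge> 1"
  shows "(\<Sum>i<n. a i) ^ p \<le> real n ^ p * (\<Sum>i<n. a i ^ p)"
proof -
  define M where "M = Max (a ` {..<n})"
  have fin: "finite (a ` {..<n})" "a ` {..<n} \<noteq> {}" using assms(2) by (auto simp: lessThan_empty_iff)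
  have "M \<in> a ` {..<n}" unfolding M_def using fin by (rule Max_in)
  then obtain j where j: "j < n" "M = a j" by auto
  have "(\<Sum>i<n. a i) \<le> (\<Sum>i<n. M)" using fin by (intro sum_mono) (auto simp: M_def)
  hence "(\<Sum>i<n. a i) ^ p \<le> (real n * M) ^ p" using assms by (intro power_mono sum_nonneg) auto
  also have "\<dots> = real n ^ p * a j ^ p" by (simp add: power_mult_distrib j)
  also have "a j ^ p \<le> (\<Sum>i<n. a i ^ p)" by (rule member_le_sum) (use j assms in auto)
  finally show ?thesis by (simp add: mult_left_mono)
qed

section \<open>The process of merged vertices\<close>

text \<open>A state is the list of merged vertices containing the successive heads. It determines the
  degrees and the triangles, and its transition probabilities are proportional to the total weight
  of a merged vertex, where each vertex of the tree has weight $\beta$ plus its degree.\<close>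

lemma grp_1 [simp]: "grp m (Suc 0) = 1"
  by (simp add: grp_def)

lemma grp_mono: "a \<le> b \<Longrightarrow> grp m a \<le> grp m b"
  by (simp add: grp_def div_le_mono diff_le_mono)

lemma grp_pos [simp]: "grp m a \<ge> Suc 0"
  by (simp add: grp_def)

lemma grp_le_iff: "m > 0 \<Longrightarrow> k \<ge> 1 \<Longrightarrow> grp m k \<le> g \<longleftrightarrow> k \<le> g * m"
  by (cases g) (auto simp: grp_def div_less_iff_less_mult less_Suc_eq_le[symmetric] simp flip: less_eq_Suc_le)

lemma grp_block: "k < m \<Longrightarrow> grp m (g * m + k + 1) = Suc g"
  by (simp add: grp_def)

locale merged_tree =
  fixes \<beta> :: real and m :: nat
  assumes beta_pos: "\<beta> > 0" and m_pos: "m > 0"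
begin

section \<open>Weights and the transition operator\<close>

definition nu :: "nat \<Rightarrow> real" where
  "nu N = (2 + \<beta>) * real N - 2"

text \<open>Entry k of the list is the group of the head of e_(k+2). The tail v_(k+2) adds 1 + beta
  to its own group and the head half-edge adds 1; v_1, which is the tail of no edge, adds only
  beta.\<close>

definition gw :: "nat list \<Rightarrow> nat \<Rightarrow> real" where
  "gw gs x = \<beta> * of_bool (x = 1)
     + (\<Sum>k<length gs. of_bool (gs ! k = x) + (1 + \<beta>) * of_bool (grp m (k + 2) = x))"

definition valid :: "nat list \<Rightarrow> bool" where
  "valid gs \<longleftrightarrow> (\<forall>k<length gs. 1 \<le> gs ! k \<and> gs ! k \<le> grp m (k + 1))"

text \<open>The conditional mean of f after one more edge, as an operator on functions of the state;
  expectations of the process are its iterates at the empty list.\<close>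

definition step :: "(nat list \<Rightarrow> real) \<Rightarrow> nat list \<Rightarrow> real" where
  "step f gs = (\<Sum>x=1..grp m (Suc (length gs)). gw gs x * f (gs @ [x])) / nu (Suc (length gs))"

lemma nu_pos: "N \<ge> 1 \<Longrightarrow> nu N > 0"
proof -
  assume "N \<ge> 1"
  hence "(2 + \<beta>) * 1 \<le> (2 + \<beta>) * real N" using beta_pos by (intro mult_left_mono) auto
  hence "2 + \<beta> \<le> (2 + \<beta>) * real N" by (simp only: mult_1_right)
  thus ?thesis using beta_pos unfolding nu_def by linarith
qed

lemma nu_mono: "N \<le> N' \<Longrightarrow> nu N \<le> nu N'"
  using beta_pos by (simp add: nu_def mult_left_mono)

lemma gw_snoc: "gw (gs @ [u]) x = gw gs x + of_bool (u = x) + (1 + \<beta>) * of_bool (grp m (length gs + 2) = x)"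
  by (simp add: gw_def nth_append)

lemma gw_nonneg: "gw gs x \<ge> 0"
  using beta_pos unfolding gw_def by (intro add_nonneg_nonneg sum_nonneg mult_nonneg_nonneg) auto

lemma valid_Nil [simp]: "valid []"
  by (simp add: valid_def)

lemma valid_snoc: "valid (gs @ [u]) \<longleftrightarrow> valid gs \<and> 1 \<le> u \<and> u \<le> grp m (Suc (length gs))"
  by (auto simp: valid_def nth_append less_Suc_eq)

text \<open>Exchange of summation: a sum weighted by groups becomes a sum over tree vertices and
  head half-edges, the form in which the random choice is specified. F = 1 gives the
  normalisation.\<close>

lemma gw_weighted_sum:
  assumes "valid gs"
  shows "(\<Sum>x=1..grp m (Suc (length gs)). gw gs x * F x)
    = \<beta> * F 1 + (\<Sum>k<length gs. F (gs ! k) + (1 + \<beta>) * F (grp m (k + 2)))"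
proof -
  let ?J = "{1..grp m (Suc (length gs))}"
  have pick: "(\<Sum>x\<in>?J. of_bool (a = x) * F x) = F a" if "a \<in> ?J" for a
  proof -
    have "(\<Sum>x\<in>?J. of_bool (a = x) * F x) = (\<Sum>x\<in>?J. if a = x then F x else 0)"
      by (rule sum.cong) auto
    thus ?thesis using that by simp
  qed
  have in1: "gs ! k \<in> ?J" if "k < length gs" for k
    using assms that grp_mono[of "k + 1" "Suc (length gs)" m] by (auto simp: valid_def intro: order.trans)
  have in2: "grp m (k + 2) \<in> ?J" if "k < length gs" for k
    using that grp_mono[of "k + 2" "Suc (length gs)" m] by auto
  have "(\<Sum>x\<in>?J. gw gs x * F x) = (\<Sum>x\<in>?J. \<beta> * (of_bool (1 = x) * F x))
     + (\<Sum>x\<in>?J. \<Sum>k<length gs. of_bool (gs ! k = x) * F x + (1 + \<beta>) * (of_bool (grp m (k + 2) = x) * F x))"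
    unfolding sum.distrib[symmetric]
  proof (rule sum.cong)
    fix x
    show "gw gs x * F x = \<beta> * (of_bool (1 = x) * F x) + (\<Sum>k<length gs. of_bool (gs ! k = x) * F x
        + (1 + \<beta>) * (of_bool (grp m (k + 2) = x) * F x))"
      unfolding gw_def distrib_right sum_distrib_right by (auto intro!: sum.cong)
  qed simp
  also have "(\<Sum>x\<in>?J. \<beta> * (of_bool (1 = x) * F x)) = \<beta> * F 1"
    using pick[of 1] by (simp flip: sum_distrib_left)
  also have "(\<Sum>x\<in>?J. \<Sum>k<length gs. of_bool (gs ! k = x) * F x + (1 + \<beta>) * (of_bool (grp m (k + 2) = x) * F x))
     = (\<Sum>k<length gs. \<Sum>x\<in>?J. of_bool (gs ! k = x) * F x + (1 + \<beta>) * (of_bool (grp m (k + 2) = x) * F x))"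
    by (rule sum.swap)
  also have "\<dots> = (\<Sum>k<length gs. F (gs ! k) + (1 + \<beta>) * F (grp m (k + 2)))"
    by (intro sum.cong refl) (use in1 in2 in \<open>simp add: sum.distrib pick flip: sum_distrib_left\<close>)
  finally show ?thesis .
qed

lemma gw_total:
  assumes "valid gs"
  shows "(\<Sum>x=1..grp m (Suc (length gs)). gw gs x) = nu (Suc (length gs))"
  using gw_weighted_sum[OF assms, of "\<lambda>_. 1"] by (simp add: nu_def algebra_simps)

lemma step_const: "valid gs \<Longrightarrow> step (\<lambda>_. c) gs = c"
  using gw_total[of gs] nu_pos[of "Suc (length gs)"] by (simp add: step_def flip: sum_distrib_right)

lemma step_add: "step (\<lambda>gs. f gs + h gs) gs = step f gs + step h gs"
  by (simp add: step_def algebra_simps sum.distrib add_divide_distrib)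

lemma step_cmult: "step (\<lambda>gs. c * f gs) gs = c * step f gs"
  by (simp add: step_def algebra_simps sum_distrib_left)

lemma step_mono:
  assumes "valid gs" "\<And>u. valid (gs @ [u]) \<Longrightarrow> f (gs @ [u]) \<le> h (gs @ [u])"
  shows "step f gs \<le> step h gs"
  unfolding step_def
  using assms nu_pos[of "Suc (length gs)"]
  by (intro divide_right_mono sum_mono mult_left_mono gw_nonneg) (auto simp: valid_snoc)

section \<open>Iterates of the transition operator\<close>

abbreviation iter :: "nat \<Rightarrow> (nat list \<Rightarrow> real) \<Rightarrow> nat list \<Rightarrow> real" where
  "iter k \<equiv> step ^^ k"

lemma iter_mono:
  assumes "valid gs" "\<And>us. length us = k \<Longrightarrow> valid (gs @ us) \<Longrightarrow> f (gs @ us) \<le> h (gs @ us)"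
  shows "iter k f gs \<le> iter k h gs"
  using assms
proof (induction k arbitrary: gs)
  case 0
  thus ?case using "0.prems"(2)[of "[]"] by simp
next
  case (Suc k)
  have "step (iter k f) gs \<le> step (iter k h) gs"
  proof (rule step_mono)
    fix u assume v: "valid (gs @ [u])"
    show "iter k f (gs @ [u]) \<le> iter k h (gs @ [u])"
      by (rule Suc.IH[OF v]) (use Suc.prems(2)[of "u # _"] in auto)
  qed fact
  thus ?case by simp
qed

lemma iter_cong:
  assumes "valid gs" "\<And>us. length us = k \<Longrightarrow> valid (gs @ us) \<Longrightarrow> f (gs @ us) = h (gs @ us)"
  shows "iter k f gs = iter k h gs"
  by (rule antisym; rule iter_mono) (use assms in auto)

lemma iter_add: "iter k (\<lambda>gs. f gs + h gs) gs = iter k f gs + iter k h gs"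
proof (induction k arbitrary: f h)
  case (Suc k)
  have "step (\<lambda>gs. f gs + h gs) = (\<lambda>gs. step f gs + step h gs)" by (rule ext) (rule step_add)
  thus ?case using Suc by (simp del: funpow.simps add: funpow_Suc_right)
qed simp

lemma iter_cmult: "iter k (\<lambda>gs. c * f gs) gs = c * iter k f gs"
proof (induction k arbitrary: f)
  case (Suc k)
  have "step (\<lambda>gs. c * f gs) = (\<lambda>gs. c * step f gs)" by (rule ext) (rule step_cmult)
  thus ?case using Suc by (simp del: funpow.simps add: funpow_Suc_right)
qed simp

lemma iter_diff: "iter k (\<lambda>gs. f gs - h gs) gs = iter k f gs - iter k h gs"
  using iter_add[of k f "\<lambda>gs. (-1) * h gs" gs] iter_cmult[of k "-1" h gs] by simp

lemma iter_const: "valid gs \<Longrightarrow> iter k (\<lambda>_. c) gs = c"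
proof (induction k arbitrary: gs)
  case (Suc k)
  have "step (iter k (\<lambda>_. c)) gs = step (\<lambda>_. c) gs"
    by (rule antisym; rule step_mono) (use Suc in auto)
  thus ?case using Suc.prems step_const by simp
qed simp

lemma iter_sum: "valid gs \<Longrightarrow> iter k (\<lambda>gs. \<Sum>i\<in>I. f i gs) gs = (\<Sum>i\<in>I. iter k (f i) gs)"
proof (induction I rule: infinite_finite_induct)
  case (insert i I)
  thus ?case using iter_add[of k "f i" "\<lambda>gs. \<Sum>i\<in>I. f i gs" gs] by simp
qed (auto simp: iter_const)

lemma iter_abs_le:
  assumes "valid gs" "\<And>us. length us = k \<Longrightarrow> valid (gs @ us) \<Longrightarrow> \<bar>f (gs @ us)\<bar> \<le> h (gs @ us)"
  shows "\<bar>iter k f gs\<bar> \<le> iter k h gs"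
proof -
  have "iter k f gs \<le> iter k h gs" by (rule iter_mono[OF assms(1)]) (use assms(2) in \<open>force simp: abs_le_iff\<close>)
  moreover have "iter k (\<lambda>gs. (-1) * f gs) gs \<le> iter k h gs"
    by (rule iter_mono[OF assms(1)]) (use assms(2) in \<open>force simp: abs_le_iff\<close>)
  ultimately show ?thesis unfolding iter_cmult by linarith
qed

text \<open>In the next two lemmas the potential F may inspect the length of the list, so that it
  can interpolate between a function of the initial state and a function of the final state.\<close>

lemma iter_le_power:
  assumes "valid gs" "q \<ge> 0"
    and "\<And>us. length us < k \<Longrightarrow> valid (gs @ us) \<Longrightarrow> step F (gs @ us) \<le> q * F (gs @ us)"
  shows "iter k F gs \<le> q ^ k * F gs"
  using assms(3)
proof (induction k)
  case (Suc k)
  have "iter (Suc k) F gs = iter k (step F) gs" by (simp del: funpow.simps add: funpow_Suc_right)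
  also have "\<dots> \<le> iter k (\<lambda>gs. q * F gs) gs" by (rule iter_mono) (use assms Suc.prems in auto)
  also have "\<dots> = q * iter k F gs" by (rule iter_cmult)
  also have "\<dots> \<le> q * (q ^ k * F gs)" using assms(2) Suc by (intro mult_left_mono) auto
  finally show ?case by simp
qed simp

lemma iter_ge_power:
  assumes "valid gs" "q \<ge> 0"
    and "\<And>us. length us < k \<Longrightarrow> valid (gs @ us) \<Longrightarrow> step F (gs @ us) \<ge> q * F (gs @ us)"
  shows "iter k F gs \<ge> q ^ k * F gs"
  using assms(3)
proof (induction k)
  case (Suc k)
  have "q * (q ^ k * F gs) \<le> q * iter k F gs" using assms(2) Suc by (intro mult_left_mono) auto
  also have "\<dots> = iter k (\<lambda>gs. q * F gs) gs" by (rule iter_cmult[symmetric])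
  also have "\<dots> \<le> iter k (step F) gs" by (rule iter_mono) (use assms Suc.prems in auto)
  also have "\<dots> = iter (Suc k) F gs" by (simp del: funpow.simps add: funpow_Suc_right)
  finally show ?case by simp
qed simp

subsection \<open>Expectations of the tree process\<close>

text \<open>The bound is k + 1 because entry k is the head chosen by v_(k+2).\<close>

definition tree_valid :: "nat list \<Rightarrow> bool" where
  "tree_valid hs \<longleftrightarrow> (\<forall>k<length hs. 1 \<le> hs ! k \<and> hs ! k \<le> k + 1)"

lemma choice_sum:
  assumes "n \<ge> 1"
  shows "(\<Sum>c\<in>Vx ` {1..n} \<union> (Hd ` {2..n} \<union> Tl ` {2..n}). choice_weight \<beta> n c * F c)
    = ((\<Sum>i=1..n. \<beta> * F (Vx i)) + (\<Sum>i=2..n. F (Hd i) + F (Tl i))) / nu n"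
proof -
  have inj: "inj_on Vx A" "inj_on Hd A" "inj_on Tl A" for A by (auto simp: inj_on_def)
  show ?thesis
    by (subst sum.union_disjoint, simp, simp, force, subst sum.union_disjoint, simp, simp, force)
      (simp add: sum.reindex inj choice_weight_def nu_def sum.distrib add_divide_distrib sum_divide_distrib)
qed

lemma choice_weight_eq_0: "c \<notin> Vx ` {1..n} \<union> (Hd ` {2..n} \<union> Tl ` {2..n}) \<Longrightarrow> choice_weight \<beta> n c = 0"
  by (cases c) (auto simp: choice_weight_def)

lemma choice_weight_nonneg: "n \<ge> 1 \<Longrightarrow> choice_weight \<beta> n c \<ge> 0"
  using nu_pos[of n] beta_pos by (cases c) (auto simp: choice_weight_def nu_def)

lemma pmf_choice_pmf:
  assumes n: "n \<ge> 1"
  shows "pmf (choice_pmf \<beta> n) = choice_weight \<beta> n"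
proof -
  let ?A = "Vx ` {1..n} \<union> (Hd ` {2..n} \<union> Tl ` {2..n})"
  have "(\<integral>\<^sup>+ c. ennreal (choice_weight \<beta> n c) \<partial>count_space UNIV) = (\<Sum>c\<in>?A. ennreal (choice_weight \<beta> n c))"
    by (rule nn_integral_count_space') (use choice_weight_eq_0 in \<open>auto intro: ennreal_0\<close>)
  also have "\<dots> = ennreal (\<Sum>c\<in>?A. choice_weight \<beta> n c * 1)"
    by (subst sum_ennreal) (use choice_weight_nonneg[OF n] in auto)
  also have "(\<Sum>c\<in>?A. choice_weight \<beta> n c * 1) = 1"
    unfolding choice_sum[OF n] using n nu_pos[OF n] by (simp add: nu_def of_nat_diff algebra_simps)
  finally show ?thesis unfolding choice_pmf_def
    by (intro ext pmf_embed_pmf) (use choice_weight_nonneg[OF n] in auto)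
qed

lemma set_choice_pmf:
  assumes "n \<ge> 1"
  shows "set_pmf (choice_pmf \<beta> n) \<subseteq> Vx ` {1..n} \<union> (Hd ` {2..n} \<union> Tl ` {2..n})"
  using choice_weight_eq_0[of _ n] by (auto simp: set_pmf_eq pmf_choice_pmf[OF assms])

text \<open>\<open>Vx i\<close> and \<open>Tl i\<close> both lead to v_i and together give it 1 +
  beta for i >= 2, while v_1 gets beta; with the copied heads this is exactly \<open>gw\<close>
  after merging. Hence the merged list is itself a Markov chain.\<close>

lemma expectation_choice:
  assumes v: "tree_valid hs" and n: "length hs = n"
  shows "measure_pmf.expectation (choice_pmf \<beta> (Suc n)) (\<lambda>c. f (map (grp m) (hs @ [target hs c])))
    = step f (map (grp m) hs)"
proof -
  let ?A = "Vx ` {1..Suc n} \<union> (Hd ` {2..Suc n} \<union> Tl ` {2..Suc n})"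
  let ?g = "map (grp m) hs"
  have [simp]: "Suc (Suc (a - 2)) = a" if "2 \<le> a" for a using that by simp
  have vg: "valid ?g" using v grp_mono unfolding valid_def tree_valid_def by auto
  define F where "F x = f (?g @ [x])" for x
  have "measure_pmf.expectation (choice_pmf \<beta> (Suc n)) (\<lambda>c. f (map (grp m) (hs @ [target hs c])))
     = (\<Sum>c\<in>?A. F (grp m (target hs c)) * pmf (choice_pmf \<beta> (Suc n)) c)"
    using set_choice_pmf[of "Suc n"] by (subst integral_measure_pmf_real[of ?A]) (auto simp: F_def)
  also have "\<dots> = (\<Sum>c\<in>?A. choice_weight \<beta> (Suc n) c * F (grp m (target hs c)))"
    by (simp add: pmf_choice_pmf mult.commute)
  also have "\<dots> = ((\<Sum>i=1..Suc n. \<beta> * F (grp m i)) + (\<Sum>i=2..Suc n. F (grp m (hs ! (i - 2))) + F (grp m i))) / nu (Suc n)"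
    by (subst choice_sum) (auto simp: target_def)
  also have "(\<Sum>i=1..Suc n. \<beta> * F (grp m i)) = \<beta> * F 1 + (\<Sum>k<n. \<beta> * F (grp m (k + 2)))"
  proof -
    have "(\<Sum>i=2..Suc n. \<beta> * F (grp m i)) = (\<Sum>k<n. \<beta> * F (grp m (k + 2)))"
      by (intro sum.reindex_bij_witness[of _ "\<lambda>k. k + 2" "\<lambda>k. k - 2"]) auto
    thus ?thesis by (subst sum.atLeast_Suc_atMost) (simp_all add: numeral_2_eq_2)
  qed
  also have "(\<Sum>i=2..Suc n. F (grp m (hs ! (i - 2))) + F (grp m i)) = (\<Sum>k<n. F (grp m (hs ! k)) + F (grp m (k + 2)))"
    by (intro sum.reindex_bij_witness[of _ "\<lambda>k. k + 2" "\<lambda>k. k - 2"]) auto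
  also have "\<beta> * F 1 + (\<Sum>k<n. \<beta> * F (grp m (k + 2))) + (\<Sum>k<n. F (grp m (hs ! k)) + F (grp m (k + 2)))
    = (\<Sum>x=1..grp m (Suc (length ?g)). gw ?g x * F x)"
    by (subst gw_weighted_sum[OF vg]) (simp add: n sum.distrib algebra_simps sum_distrib_left)
  finally show ?thesis by (simp add: step_def F_def n)
qed

lemma set_tree_pmf: "hs \<in> set_pmf (tree_pmf \<beta> (Suc N)) \<Longrightarrow> length hs = N \<and> tree_valid hs"
proof (induction N arbitrary: hs)
  case 0
  thus ?case by (simp add: tree_valid_def)
next
  case (Suc N)
  then obtain hs' c where h: "hs' \<in> set_pmf (tree_pmf \<beta> (Suc N))" "c \<in> set_pmf (choice_pmf \<beta> (Suc N))"
    "hs = hs' @ [target hs' c]" by auto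
  have IH: "length hs' = N" "tree_valid hs'" using Suc.IH[OF h(1)] by auto
  have "1 \<le> target hs' c \<and> target hs' c \<le> N + 1"
  proof -
    have "hs' ! (i - 2) \<ge> 1 \<and> hs' ! (i - 2) \<le> N + 1" if "i \<in> {2..Suc N}" for i
    proof -
      have "i - 2 < length hs'" using that IH by auto
      hence "hs' ! (i - 2) \<ge> 1 \<and> hs' ! (i - 2) \<le> (i - 2) + 1" using IH(2) unfolding tree_valid_def by blast
      thus ?thesis using that by auto
    qed
    thus ?thesis using h(2) set_choice_pmf[of "Suc N"] by (force simp: target_def)
  qed
  thus ?case using IH by (auto simp: h(3) tree_valid_def nth_append less_Suc_eq)
qed

lemma finite_set_tree_pmf: "finite (set_pmf (tree_pmf \<beta> (Suc N)))"
proof (induction N)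
  case (Suc N)
  have "finite (set_pmf (choice_pmf \<beta> (Suc N)))"
    using set_choice_pmf[of "Suc N"] by (rule finite_subset) auto
  thus ?case using Suc by auto
qed simp

text \<open>The last edge is averaged out first, which turns f into \<open>step f\<close>; finite
  support makes the expectation of the bind a finite sum.\<close>

lemma expectation_tree:
  "measure_pmf.expectation (tree_pmf \<beta> (Suc N)) (\<lambda>hs. f (map (grp m) hs)) = iter N f []"
proof (induction N arbitrary: f)
  case (Suc N)
  let ?A = "set_pmf (tree_pmf \<beta> (Suc N))"
  have fc: "finite (set_pmf (choice_pmf \<beta> (Suc N)))"
    using set_choice_pmf[of "Suc N"] by (rule finite_subset) auto
  have "measure_pmf.expectation (tree_pmf \<beta> (Suc (Suc N))) (\<lambda>hs. f (map (grp m) hs))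
    = (\<Sum>hs\<in>?A. pmf (tree_pmf \<beta> (Suc N)) hs *\<^sub>R measure_pmf.expectation
         (map_pmf (\<lambda>c. hs @ [target hs c]) (choice_pmf \<beta> (Suc N))) (\<lambda>hs. f (map (grp m) hs)))"
    unfolding tree_pmf.simps by (rule pmf_expectation_bind) (use finite_set_tree_pmf fc in auto)
  also have "\<dots> = (\<Sum>hs\<in>?A. step f (map (grp m) hs) * pmf (tree_pmf \<beta> (Suc N)) hs)"
  proof (rule sum.cong)
    fix hs assume "hs \<in> ?A"
    from set_tree_pmf[OF this] show "pmf (tree_pmf \<beta> (Suc N)) hs *\<^sub>R measure_pmf.expectation
         (map_pmf (\<lambda>c. hs @ [target hs c]) (choice_pmf \<beta> (Suc N))) (\<lambda>hs. f (map (grp m) hs))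
       = step f (map (grp m) hs) * pmf (tree_pmf \<beta> (Suc N)) hs"
      using expectation_choice[of hs N f] by (simp add: integral_map_pmf)
  qed simp
  also have "\<dots> = measure_pmf.expectation (tree_pmf \<beta> (Suc N)) (\<lambda>hs. step f (map (grp m) hs))"
    by (rule integral_measure_pmf_real[symmetric]) (use finite_set_tree_pmf in auto)
  also have "\<dots> = iter (Suc N) f []" unfolding Suc by (simp del: funpow.simps add: funpow_Suc_right)
  finally show ?case .
qed simp

section \<open>One step and one block of m steps\<close>

text \<open>Serves any quantity that reacts only to the new head being x or y. If x = y, both
  corrections are added.\<close>

lemma step_affine:
  assumes "valid gs" "x \<in> {1..grp m (Suc (length gs))}" "y \<in> {1..grp m (Suc (length gs))}"
    and f: "\<And>u. valid (gs @ [u]) \<Longrightarrow> f (gs @ [u]) = A + of_bool (u = x) * B + of_bool (u = y) * B'"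
  shows "step f gs = A + (gw gs x * B + gw gs y * B') / nu (Suc (length gs))"
proof -
  let ?J = "{1..grp m (Suc (length gs))}"
  let ?v = "nu (Suc (length gs))"
  have v: "?v > 0" by (rule nu_pos) simp
  have pick: "(\<Sum>u\<in>?J. gw gs u * (of_bool (u = z) * c)) = gw gs z * c" if "z \<in> ?J" for z c
  proof -
    have "(\<Sum>u\<in>?J. gw gs u * (of_bool (u = z) * c)) = (\<Sum>u\<in>?J. if u = z then gw gs u * c else 0)"
      by (rule sum.cong) auto
    thus ?thesis using that by simp
  qed
  have "(\<Sum>u\<in>?J. gw gs u * f (gs @ [u]))
     = (\<Sum>u\<in>?J. gw gs u * A + gw gs u * (of_bool (u = x) * B) + gw gs u * (of_bool (u = y) * B'))"
    by (rule sum.cong) (use assms(1) in \<open>auto simp: f valid_snoc distrib_left\<close>)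
  also have "\<dots> = ?v * A + gw gs x * B + gw gs y * B'"
    using gw_total[OF assms(1)] by (simp only: sum.distrib pick assms(2,3)) (simp flip: sum_distrib_right)
  finally show ?thesis using v by (simp add: step_def add_divide_distrib)
qed

text \<open>A list of length l describes l + 1 tree vertices, so
  \<open>x * m \<le> Suc (length gs)\<close> says that all m vertices of group x are
  present.\<close>

lemma complete_in_range:
  assumes "1 \<le> x" "x * m \<le> Suc (length gs)"
  shows "x \<in> {1..grp m (Suc (length gs))}"
proof -
  have "\<not> grp m (Suc (length gs)) \<le> x - 1 \<or> x = 0"
    using assms m_pos by (cases x) (auto simp: grp_le_iff)
  thus ?thesis using assms by auto
qed

text \<open>The tail of the next edge has index at least x m + 1 and so lies in a later group; only
  a hit can change the weight.\<close>

lemma gw_snoc_complete: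
  assumes "x * m \<le> Suc (length gs)"
  shows "gw (gs @ [u]) x = gw gs x + of_bool (u = x)"
proof -
  have "\<not> grp m (length gs + 2) \<le> x" using assms m_pos by (subst grp_le_iff) auto
  thus ?thesis by (auto simp: gw_snoc)
qed

lemma step_pochhammer:
  assumes "valid gs" "1 \<le> x" "x * m \<le> Suc (length gs)"
  shows "step (\<lambda>gs. pochhammer (gw gs x) p) gs = (1 + real p / nu (Suc (length gs))) * pochhammer (gw gs x) p"
proof -
  let ?w = "gw gs x"
  have x: "x \<in> {1..grp m (Suc (length gs))}" using complete_in_range assms by simp
  have "step (\<lambda>gs. pochhammer (gw gs x) p) gs = pochhammer ?w p
     + (?w * (pochhammer (?w + 1) p - pochhammer ?w p) + ?w * 0) / nu (Suc (length gs))"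
    by (rule step_affine[OF assms(1) x x]) (simp add: gw_snoc_complete assms)
  \<comment> \<open>Writing (w)_p for the rising factorial, w (w+1)_p = (w)_(p+1) = (w)_p
    (w+p).\<close>
  also have "?w * (pochhammer (?w + 1) p - pochhammer ?w p) = real p * pochhammer ?w p"
    using pochhammer_rec[of ?w p] pochhammer_rec'[of ?w p] by (simp add: algebra_simps)
  finally show ?thesis by (simp add: algebra_simps)
qed

lemma step_gw_prod:
  assumes "valid gs" "1 \<le> x" "x * m \<le> Suc (length gs)" "1 \<le> y" "y * m \<le> Suc (length gs)" "x \<noteq> y"
  shows "step (\<lambda>gs. gw gs x * gw gs y) gs = (1 + 2 / nu (Suc (length gs))) * (gw gs x * gw gs y)"
proof -
  \<comment> \<open>Since x and y differ, one head raises at most one of the factors, so no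
    second-order term appears.\<close>
  have "step (\<lambda>gs. gw gs x * gw gs y) gs
    = gw gs x * gw gs y + (gw gs x * gw gs y + gw gs y * gw gs x) / nu (Suc (length gs))"
    by (rule step_affine[OF assms(1) complete_in_range complete_in_range])
      (use assms in \<open>auto simp: gw_snoc_complete algebra_simps\<close>)
  thus ?thesis by (simp add: algebra_simps)
qed

lemma step_indicator:
  assumes "valid gs" "1 \<le> x" "x * m \<le> Suc (length gs)"
    and f: "\<And>u. valid (gs @ [u]) \<Longrightarrow> f (gs @ [u]) = of_bool (u = x) * B"
  shows "step f gs = gw gs x * B / nu (Suc (length gs))"
  using step_affine[OF assms(1) complete_in_range[OF assms(2,3)] complete_in_range[OF assms(2,3)], of f 0 B 0] f
  by simp

lemma gw_append:
  "gw (gs @ us) x = gw gs x + (\<Sum>i<length us. of_bool (us ! i = x) + (1 + \<beta>) * of_bool (grp m (length gs + i + 2) = x))"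
proof (induction us rule: rev_induct)
  case (snoc u us)
  have "gw (gs @ us @ [u]) x = gw (gs @ us) x + of_bool (u = x) + (1 + \<beta>) * of_bool (grp m (length (gs @ us) + 2) = x)"
    using gw_snoc[of "gs @ us" u x] by simp
  thus ?case using snoc by (simp add: nth_append)
qed simp

lemma pochhammer_nonneg': "x \<ge> 0 \<Longrightarrow> pochhammer (x::real) p \<ge> 0"
  by (simp add: pochhammer_prod prod_nonneg)

section \<open>One block: hitting events while merged vertex g+1 is built\<close>

context
  fixes hs :: "nat list" and g :: nat
  assumes hs: "valid hs" and g: "g \<ge> 1" and len: "length hs = g * m - 1"
begin

text \<open>The state describes g m tree vertices but g m - 1 edges, since v_1 has none; the
  subtraction does not truncate.\<close>

lemma Suc_len: "Suc (length hs) = g * m"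
  using g m_pos len by simp

text \<open>Replacing the varying normaliser by its values at the two ends of the block makes all
  one-step factors uniform and costs a relative error of order 1/g only.\<close>

lemma nu_block:
  assumes "length us < m"
  shows "nu (g * m) \<le> nu (Suc (length (hs @ us)))" "nu (Suc (length (hs @ us))) \<le> nu (g * m + m)"
    "nu (Suc (length (hs @ us))) > 0" "nu (g * m) > 0" "nu (g * m + m) > 0"
  using Suc_len assms g m_pos by (auto intro!: nu_mono nu_pos)

lemma complete_block:
  assumes "1 \<le> x" "x \<le> g"
  shows "x * m \<le> Suc (length (hs @ us))"
proof -
  have "x * m \<le> g * m" using assms by simp
  thus ?thesis using Suc_len unfolding length_append by linarith
qed

lemma step_pochhammer_block:
  assumes "1 \<le> x" "x \<le> g" "valid (hs @ us)"
  shows "step (\<lambda>gs. pochhammer (gw gs x) p) (hs @ us)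
    = (1 + real p / nu (Suc (length hs + length us))) * pochhammer (gw (hs @ us) x) p"
  using step_pochhammer[OF assms(3,1) complete_block[OF assms(1,2)]] by simp

lemma step_gw_prod_block:
  assumes "1 \<le> x" "x \<le> g" "1 \<le> y" "y \<le> g" "x \<noteq> y" "valid (hs @ us)"
  shows "step (\<lambda>gs. gw gs x * gw gs y) (hs @ us)
    = (1 + 2 / nu (Suc (length hs + length us))) * (gw (hs @ us) x * gw (hs @ us) y)"
  using step_gw_prod[OF assms(6,1) complete_block[OF assms(1,2)] assms(3) complete_block[OF assms(3,4)] assms(5)]
  by simp

lemma gw_snoc_block:
  assumes "1 \<le> x" "x \<le> g"
  shows "gw (hs @ us @ [u]) x = gw (hs @ us) x + of_bool (u = x)"
  using gw_snoc_complete[OF complete_block[OF assms], of us u] by simp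

lemma gw_block_old:
  assumes "1 \<le> x" "x \<le> g" "length us \<le> m"
  shows "gw (hs @ us) x = gw hs x + (\<Sum>i<length us. of_bool (us ! i = x))"
proof -
  have "grp m (length hs + i + 2) \<noteq> x" if "i < length us" for i
    using grp_block[of i m g] that assms Suc_len by (simp flip: add_Suc)
  thus ?thesis by (simp add: gw_append)
qed

lemma valid_block_old:
  assumes "k < length hs"
  shows "1 \<le> hs ! k" "hs ! k \<le> g" "grp m (k + 2) \<le> g"
proof -
  have "grp m (k + 1) \<le> g" using assms Suc_len m_pos by (subst grp_le_iff) auto
  thus "1 \<le> hs ! k" "hs ! k \<le> g" using hs assms unfolding valid_def by (auto intro: order.trans)
  show "grp m (k + 2) \<le> g" using assms Suc_len m_pos by (subst grp_le_iff) auto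
qed

lemma gw_block_new:
  assumes "length us \<le> m"
  shows "gw (hs @ us) (Suc g) = (1 + \<beta>) * real (length us) + (\<Sum>i<length us. of_bool (us ! i = Suc g))"
proof -
  have "gw hs (Suc g) = 0" using g valid_block_old by (fastforce simp: gw_def intro!: sum.neutral)
  moreover have "grp m (length hs + i + 2) = Suc g" if "i < length us" for i
    using grp_block[of i m g] that assms Suc_len by (simp flip: add_Suc)
  ultimately show ?thesis by (simp add: gw_append sum.distrib)
qed

lemma gw_block_new_le:
  assumes "length us \<le> m"
  shows "gw (hs @ us) (Suc g) \<le> (2 + \<beta>) * real m"
proof -
  have "(\<Sum>i<length us. of_bool (us ! i = Suc g)) \<le> (\<Sum>i<length us. 1::real)" by (rule sum_mono) auto
  hence "gw (hs @ us) (Suc g) \<le> (2 + \<beta>) * real (length us)"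
    unfolding gw_block_new[OF assms] by (simp add: algebra_simps)
  also have "\<dots> \<le> (2 + \<beta>) * real m" using assms beta_pos by (intro mult_left_mono) auto
  finally show ?thesis .
qed

lemma valid_block_le:
  assumes "valid (hs @ us)" "length us \<le> m" "i < length us"
  shows "1 \<le> us ! i" "us ! i \<le> Suc g"
proof -
  have "(hs @ us) ! (length hs + i) = us ! i" by simp
  hence "1 \<le> us ! i \<and> us ! i \<le> grp m (length hs + i + 1)"
    using assms unfolding valid_def by (metis add_less_cancel_left length_append)
  moreover have "grp m (length hs + i + 1) \<le> Suc g" using assms Suc_len m_pos by (subst grp_le_iff) auto
  ultimately show "1 \<le> us ! i" "us ! i \<le> Suc g" by auto
qed

lemma iter_pochhammer:
  assumes "1 \<le> x" "x \<le> g"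
  shows "iter m (\<lambda>gs. pochhammer (gw gs x) p) hs \<le> (1 + real p / nu (g * m)) ^ m * pochhammer (gw hs x) p" (is ?A)
    and "(1 + real p / nu (g * m + m)) ^ m * pochhammer (gw hs x) p \<le> iter m (\<lambda>gs. pochhammer (gw gs x) p) hs" (is ?B)
proof -
  have v: "nu (g * m) > 0" "nu (g * m + m) > 0" using nu_block[of "[]"] m_pos by auto
  show ?A
    by (rule iter_le_power[OF hs])
       (use v nu_block[unfolded length_append] assms in \<open>auto simp: step_pochhammer_block
         intro!: mult_right_mono divide_left_mono pochhammer_nonneg' gw_nonneg\<close>)
  show ?B
    by (rule iter_ge_power[OF hs])
       (use v nu_block[unfolded length_append] assms in \<open>auto simp: step_pochhammer_block
         intro!: mult_right_mono divide_left_mono pochhammer_nonneg' gw_nonneg\<close>)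
qed

lemma iter_gw_prod:
  assumes "1 \<le> x" "x \<le> g" "1 \<le> y" "y \<le> g" "x \<noteq> y"
  shows "iter m (\<lambda>gs. gw gs x * gw gs y) hs \<le> (1 + 2 / nu (g * m)) ^ m * (gw hs x * gw hs y)" (is ?A)
    and "(1 + 2 / nu (g * m + m)) ^ m * (gw hs x * gw hs y) \<le> iter m (\<lambda>gs. gw gs x * gw gs y) hs" (is ?B)
proof -
  have v: "nu (g * m) > 0" "nu (g * m + m) > 0" using nu_block[of "[]"] m_pos by auto
  show ?A
    by (rule iter_le_power[OF hs])
       (use v nu_block[unfolded length_append] assms in \<open>auto simp: step_gw_prod_block
         intro!: mult_right_mono divide_left_mono mult_nonneg_nonneg gw_nonneg\<close>)
  show ?B
    by (rule iter_ge_power[OF hs])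
       (use v nu_block[unfolded length_append] assms in \<open>auto simp: step_gw_prod_block
         intro!: mult_right_mono divide_left_mono mult_nonneg_nonneg gw_nonneg\<close>)
qed

text \<open>A hit of x has probability w/nu and replaces w by w + 1, so the hit indicator times
  (w+1)_p has mean (w)_(p+1)/nu: the event costs a factor of order 1/g and raises the order of the
  rising factorial by one.\<close>

lemma iter_hit_pochhammer:
  fixes p :: nat
  defines "f i x \<equiv> (\<lambda>gs. of_bool (gs ! (length hs + i) = x) * pochhammer (gw gs x) p)"
  assumes x: "1 \<le> x" "x \<le> g" and i: "i < m"
  shows "iter m (f i x) hs \<le> (1 + real (Suc p) / nu (g * m)) ^ m * (pochhammer (gw hs x) (Suc p) / nu (g * m))" (is ?A)
    and "pochhammer (gw hs x) (Suc p) / nu (g * m + m) \<le> iter m (f i x) hs" (is ?B)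
proof -
  define J where "J = length hs + i"
  \<comment> \<open>Until step i is made the potential is the predicted mean with c in place of the
    normaliser, afterwards the actual quantity. The hitting step multiplies it by c/nu, which is at
    most 1 for c = nu(gm) and at least 1 for c = nu(gm+m).\<close>
  define F where "F c gs = (if length gs \<le> J then pochhammer (gw gs x) (Suc p) / c else f i x gs)" for c gs
  have v: "nu (g * m) > 0" "nu (g * m + m) > 0" using nu_block[of "[]"] m_pos by auto
  have fin: "iter m (F c) hs = iter m (f i x) hs" for c
    by (rule iter_cong[OF hs]) (use i in \<open>auto simp: F_def J_def\<close>)
  have start: "F c hs = pochhammer (gw hs x) (Suc p) / c" for c by (simp add: F_def J_def)
  have stepF: "step (F c) (hs @ us) =
      (if length us < i then 1 + real (Suc p) / nu (Suc (length (hs @ us)))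
       else if length us = i then c / nu (Suc (length (hs @ us)))
       else 1 + real p / nu (Suc (length (hs @ us)))) * F c (hs @ us)"
    if us: "length us < m" "valid (hs @ us)" and c: "c > 0" for us c
  proof -
    let ?gs = "hs @ us"
    consider "length us < i" | "length us = i" | "length us > i" by linarith
    thus ?thesis
    proof cases
      case 1
      have "step (F c) ?gs = step (\<lambda>gs. (1 / c) * pochhammer (gw gs x) (Suc p)) ?gs"
        by (rule antisym; rule step_mono) (use us 1 in \<open>auto simp: F_def J_def\<close>)
      thus ?thesis using 1 us x by (simp only: step_cmult step_pochhammer_block) (simp add: F_def J_def)
    next
      case 2
      have "step (F c) ?gs = gw ?gs x * pochhammer (gw ?gs x + 1) p / nu (Suc (length ?gs))"
        by (rule step_indicator) (use us 2 x complete_block[of x us] in \<open>auto simp: F_def J_def f_def nth_append gw_snoc_block\<close>)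
      thus ?thesis using 2 c by (simp add: F_def J_def pochhammer_rec)
    next
      case 3
      have "step (F c) ?gs = step (\<lambda>gs. of_bool (?gs ! J = x) * pochhammer (gw gs x) p) ?gs"
        by (rule antisym; rule step_mono) (use us 3 in \<open>auto simp: F_def J_def f_def nth_append\<close>)
      also have "\<dots> = (1 + real p / nu (Suc (length ?gs))) * F c ?gs"
        using 3 us x by (simp only: step_cmult step_pochhammer_block) (simp add: F_def J_def f_def)
      finally show ?thesis using 3 by simp
    qed
  qed
  have F0: "F c gs \<ge> 0" if "c > 0" for c gs
    using that by (auto simp: F_def f_def pochhammer_nonneg' gw_nonneg)
  have "iter m (F (nu (g * m))) hs \<le> (1 + real (Suc p) / nu (g * m)) ^ m * F (nu (g * m)) hs"
  proof (rule iter_le_power[OF hs])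
    fix us assume us: "length us < m" "valid (hs @ us)"
    let ?v = "nu (Suc (length (hs @ us)))"
    have vv: "nu (g * m) \<le> ?v" "?v > 0" using nu_block[OF us(1)] by auto
    have "real (Suc p) / ?v \<le> real (Suc p) / nu (g * m)" using vv v by (intro divide_left_mono) auto
    moreover have "nu (g * m) / ?v \<le> 1" using vv by simp
    moreover have "real p / ?v \<le> real (Suc p) / ?v" using vv by (intro divide_right_mono) auto
    moreover have "real (Suc p) / nu (g * m) \<ge> 0" using v by simp
    ultimately show "step (F (nu (g * m))) (hs @ us) \<le> (1 + real (Suc p) / nu (g * m)) * F (nu (g * m)) (hs @ us)"
      unfolding stepF[OF us v(1)] by (intro mult_right_mono F0 v) (auto simp del: of_nat_Suc)
  qed (use v in auto)
  thus ?A by (simp add: fin start)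
  \<comment> \<open>With this c every one-step factor is at least 1, so the lower bound can ignore
    the growth altogether.\<close>
  have "iter m (F (nu (g * m + m))) hs \<ge> 1 ^ m * F (nu (g * m + m)) hs"
  proof (rule iter_ge_power[OF hs])
    fix us assume us: "length us < m" "valid (hs @ us)"
    let ?v = "nu (Suc (length (hs @ us)))"
    have vv: "nu (g * m + m) \<ge> ?v" "?v > 0" using nu_block[OF us(1)] by auto
    have "real (Suc p) / ?v \<ge> 0" "nu (g * m + m) / ?v \<ge> 1" "real p / ?v \<ge> 0" using vv by auto
    thus "step (F (nu (g * m + m))) (hs @ us) \<ge> 1 * F (nu (g * m + m)) (hs @ us)"
      unfolding stepF[OF us v(2)] by (intro mult_right_mono F0 v) (auto simp del: of_nat_Suc)
  qed (use v in auto)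
  thus ?B by (simp add: fin start)
qed

text \<open>The probability that edges i < j of the block point to two given old vertices, that is,
  that they close an old edge between x and y to a triangle. Each hit contributes a factor
  w/nu.\<close>

lemma iter_hit_pair:
  defines "f i j x y \<equiv> (\<lambda>gs. of_bool (gs ! (length hs + i) = x) * of_bool (gs ! (length hs + j) = y) :: real)"
  assumes x: "1 \<le> x" "x \<le> g" and y: "1 \<le> y" "y \<le> g" and xy: "x \<noteq> y" and ij: "i < j" "j < m"
  shows "iter m (f i j x y) hs \<le> (1 + 2 / nu (g * m)) ^ m * (gw hs x * gw hs y / (nu (g * m))\<^sup>2)" (is ?A)
    and "gw hs x * gw hs y / (nu (g * m + m))\<^sup>2 \<le> iter m (f i j x y) hs" (is ?B)
proof -
  define I where "I = length hs + i"
  define J where "J = length hs + j"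
  \<comment> \<open>Three phases: both hits pending, only the hit of y pending, both decided. Each
    hitting step exchanges a factor w/c for an indicator.\<close>
  define F where "F c gs = (if length gs \<le> I then gw gs x * gw gs y / c\<^sup>2 else
     if length gs \<le> J then of_bool (gs ! I = x) * gw gs y / c else f i j x y gs)" for c gs
  have v: "nu (g * m) > 0" "nu (g * m + m) > 0" using nu_block[of "[]"] m_pos by auto
  have fin: "iter m (F c) hs = iter m (f i j x y) hs" for c
    by (rule iter_cong[OF hs]) (use ij in \<open>auto simp: F_def I_def J_def\<close>)
  have start: "F c hs = gw hs x * gw hs y / c\<^sup>2" for c by (simp add: F_def I_def)
  have stepF: "step (F c) (hs @ us) =
      (if length us < i then 1 + 2 / nu (Suc (length (hs @ us)))
       else if length us = i then c / nu (Suc (length (hs @ us)))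
       else if length us < j then 1 + 1 / nu (Suc (length (hs @ us)))
       else if length us = j then c / nu (Suc (length (hs @ us)))
       else 1) * F c (hs @ us)"
    if us: "length us < m" "valid (hs @ us)" and c: "c > 0" for us c
  proof -
    let ?gs = "hs @ us"
    consider "length us < i" | "length us = i" | "i < length us" "length us < j" | "length us = j" | "length us > j"
      by linarith
    thus ?thesis
    proof cases
      case 1
      have "step (F c) ?gs = step (\<lambda>gs. (1 / c\<^sup>2) * (gw gs x * gw gs y)) ?gs"
        by (rule antisym; rule step_mono) (use us 1 in \<open>auto simp: F_def I_def\<close>)
      thus ?thesis using 1 step_gw_prod_block[OF x y xy us(2)] by (simp add: step_cmult[of "1 / c\<^sup>2", simplified] F_def I_def)
    next
      case 2
      have "step (F c) ?gs = gw ?gs x * (gw ?gs y / c) / nu (Suc (length ?gs))"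
        by (rule step_indicator)
          (use us 2 ij x y xy complete_block[of x us] complete_block[of y us] in
            \<open>auto simp: F_def I_def J_def f_def nth_append gw_snoc_block\<close>)
      thus ?thesis using 2 c by (simp add: F_def I_def power2_eq_square)
    next
      case 3
      have "step (F c) ?gs = step (\<lambda>gs. (of_bool (?gs ! I = x) / c) * pochhammer (gw gs y) 1) ?gs"
        by (rule antisym; rule step_mono) (use us 3 in \<open>auto simp: F_def I_def J_def f_def nth_append\<close>)
      also have "\<dots> = (1 + 1 / nu (Suc (length ?gs))) * F c ?gs"
        using 3 us x y by (simp only: step_cmult step_pochhammer_block) (simp add: F_def I_def J_def)
      finally show ?thesis using 3 by simp
    next
      case 4
      have "step (F c) ?gs = gw ?gs y * of_bool (?gs ! I = x) / nu (Suc (length ?gs))"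
        by (rule step_indicator)
          (use us 4 ij x y complete_block[of y us] in \<open>auto simp: F_def I_def J_def f_def nth_append\<close>)
      thus ?thesis using 4 ij c by (simp add: F_def I_def J_def)
    next
      case 5
      have "step (F c) ?gs = step (\<lambda>_. F c ?gs) ?gs"
        by (rule antisym; rule step_mono) (use us 5 ij in \<open>auto simp: F_def I_def J_def f_def nth_append\<close>)
      thus ?thesis using 5 ij us step_const[of ?gs] by simp
    qed
  qed
  have F0: "F c gs \<ge> 0" if "c > 0" for c gs
    using that by (auto simp: F_def f_def gw_nonneg)
  have "iter m (F (nu (g * m))) hs \<le> (1 + 2 / nu (g * m)) ^ m * F (nu (g * m)) hs"
  proof (rule iter_le_power[OF hs])
    fix us assume us: "length us < m" "valid (hs @ us)"
    let ?v = "nu (Suc (length (hs @ us)))"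
    have vv: "nu (g * m) \<le> ?v" "?v > 0" using nu_block[OF us(1)] by auto
    have "2 / ?v \<le> 2 / nu (g * m)" using vv v by (intro divide_left_mono) auto
    moreover have "nu (g * m) / ?v \<le> 1" using vv by simp
    moreover have "1 / ?v \<le> 2 / ?v" using vv by (intro divide_right_mono) auto
    moreover have "2 / nu (g * m) \<ge> 0" using v by simp
    ultimately show "step (F (nu (g * m))) (hs @ us) \<le> (1 + 2 / nu (g * m)) * F (nu (g * m)) (hs @ us)"
      unfolding stepF[OF us v(1)] by (intro mult_right_mono F0 v) auto
  qed (use v in auto)
  thus ?A by (simp add: fin start)
  have "iter m (F (nu (g * m + m))) hs \<ge> 1 ^ m * F (nu (g * m + m)) hs"
  proof (rule iter_ge_power[OF hs])
    fix us assume us: "length us < m" "valid (hs @ us)"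
    let ?v = "nu (Suc (length (hs @ us)))"
    have vv: "nu (g * m + m) \<ge> ?v" "?v > 0" using nu_block[OF us(1)] by auto
    have "2 / ?v \<ge> 0" "nu (g * m + m) / ?v \<ge> 1" "1 / ?v \<ge> 0" using vv by auto
    thus "step (F (nu (g * m + m))) (hs @ us) \<ge> 1 * F (nu (g * m + m)) (hs @ us)"
      unfolding stepF[OF us v(2)]
      by (intro mult_right_mono F0 v) auto
  qed (use v in auto)
  thus ?B by (simp add: fin start)
qed

text \<open>A loop at the vertex under construction is rare: its weight never exceeds (2 + beta) m,
  while the normaliser is of order g.\<close>

lemma iter_hit_new:
  assumes i: "i < m"
  shows "iter m (\<lambda>gs. of_bool (gs ! (length hs + i) = Suc g)) hs \<le> (2 + \<beta>) * real m / nu (g * m)"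
proof -
  define J where "J = length hs + i"
  define F where "F gs = (if length gs \<le> J then (2 + \<beta>) * real m / nu (g * m) else of_bool (gs ! J = Suc g))" for gs
  have v: "nu (g * m) > 0" using nu_block[of "[]"] m_pos by auto
  have "iter m F hs \<le> 1 ^ m * F hs"
  proof (rule iter_le_power[OF hs])
    fix us assume us: "length us < m" "valid (hs @ us)"
    let ?gs = "hs @ us"
    let ?v = "nu (Suc (length ?gs))"
    consider "length us = i" | "length us \<noteq> i" by blast
    thus "step F ?gs \<le> 1 * F ?gs"
    proof cases
      case 1
      have vv: "nu (g * m) \<le> ?v" "?v > 0" using nu_block[OF us(1)] by auto
      show ?thesis
      proof (cases "Suc g \<le> grp m (Suc (length ?gs))")
        case True
        have "step F ?gs = 0 + (gw ?gs (Suc g) * 1 + gw ?gs (Suc g) * 0) / ?v"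
          by (rule step_affine) (use us 1 True in \<open>auto simp: F_def J_def nth_append\<close>)
        also have "\<dots> \<le> (2 + \<beta>) * real m / ?v"
          using gw_block_new_le[of us] us vv by (auto intro!: divide_right_mono)
        also have "\<dots> \<le> (2 + \<beta>) * real m / nu (g * m)"
          using vv v beta_pos by (intro divide_left_mono) auto
        finally show ?thesis using 1 by (simp add: F_def J_def)
      next
        \<comment> \<open>This occurs for the first edge of the block only: its head is among the
          first g m tree vertices, hence not in group g + 1.\<close>
        case False
        have "step F ?gs \<le> step (\<lambda>_. 0) ?gs"
          by (rule step_mono) (use us 1 False in \<open>auto simp: F_def J_def nth_append valid_snoc[of "hs @ us", simplified]\<close>)
        also have "\<dots> = 0" using us by (rule_tac step_const)
        also have "0 \<le> (2 + \<beta>) * real m / nu (g * m)" using v beta_pos by simp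
        finally show ?thesis using 1 by (simp add: F_def J_def)
      qed
    next
      case 2
      have "step F ?gs \<le> step (\<lambda>_. F ?gs) ?gs"
        by (rule step_mono) (use us 2 in \<open>auto simp: F_def J_def nth_append\<close>)
      thus ?thesis using us step_const[of ?gs] by simp
    qed
  qed auto
  moreover have "iter m F hs = iter m (\<lambda>gs. of_bool (gs ! (length hs + i) = Suc g)) hs"
    by (rule iter_cong[OF hs]) (use i in \<open>auto simp: F_def J_def\<close>)
  ultimately show ?thesis by (simp add: F_def J_def)
qed

end

section \<open>Drift of power sums and edge sums over one block\<close>

definition theta :: real where
  "theta = 1 / (2 + \<beta>)"

definition complete :: "nat \<Rightarrow> nat list \<Rightarrow> bool" where
  "complete g hs \<longleftrightarrow> valid hs \<and> g \<ge> 1 \<and> length hs = g * m - 1"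

lemma theta_pos: "theta > 0" and theta_less: "2 * theta < 1"
  using beta_pos by (auto simp: theta_def field_simps)

lemma nu_ge:
  assumes "g \<ge> 1"
  shows "nu (g * m) \<ge> \<beta> * real g * real m" "nu (g * m) > 0"
proof -
  have "1 \<le> g * m" using assms m_pos by simp
  hence "1 \<le> real (g * m)" by linarith
  thus "nu (g * m) \<ge> \<beta> * real g * real m" by (simp add: nu_def algebra_simps)
  show "nu (g * m) > 0" using assms m_pos by (intro nu_pos) simp
qed

text \<open>Bootstrapping: nu theta = m g - 2 theta expresses 1/nu through itself with a coefficient
  of order 1/g, so the crude bound 1/(beta g) inserted on the right yields an error of order
  1/g^2.\<close>

lemma inverse_nu_le:
  assumes "g \<ge> 1"
  shows "1 / nu (g * m) \<le> theta / (real m * real g) + (2 * theta / \<beta>) / (real g)\<^sup>2"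
    and "1 / nu (g * m) \<le> (1 / \<beta>) / real g"
proof -
  let ?v = "nu (g * m)"
  have v: "?v \<ge> \<beta> * real g * real m" "?v > 0" using nu_ge[OF assms] by auto
  have gm: "real g > 0" "real m \<ge> 1" using assms m_pos by auto
  have bg: "\<beta> * real g * 1 \<le> \<beta> * real g * real m" using beta_pos gm by (intro mult_left_mono) auto
  show 2: "1 / ?v \<le> (1 / \<beta>) / real g"
  proof -
    have "\<beta> * real g \<le> ?v" using bg v(1) by linarith
    thus ?thesis using v beta_pos gm by (simp add: field_simps)
  qed
  have "?v * theta = real m * real g - 2 * theta"
    using beta_pos by (simp add: nu_def theta_def field_simps)
  hence "1 / ?v = theta / (real m * real g) + (2 * theta) / (real m * real g) * (1 / ?v)"
    using v gm by (simp add: field_simps)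
  also have "(2 * theta) / (real m * real g) * (1 / ?v) \<le> (2 * theta) / real g * ((1 / \<beta>) / real g)"
    using 2 gm theta_pos v by (intro mult_mono divide_left_mono) (auto simp: mult_le_cancel_right1)
  finally show "1 / ?v \<le> theta / (real m * real g) + (2 * theta / \<beta>) / (real g)\<^sup>2"
    by (simp add: power2_eq_square mult_ac)
qed

text \<open>Without the -2 in \<open>nu\<close> the inverse is theta/(m (g+1)), and 1/(g+1) >= 1/g -
  1/g^2.\<close>

lemma inverse_nu_ge:
  assumes "g \<ge> 1"
  shows "1 / nu (g * m + m) \<ge> theta / (real m * real g) - theta / (real g)\<^sup>2"
proof -
  have gm: "real g > 0" "real m \<ge> 1" using assms m_pos by auto
  have v: "nu (g * m + m) > 0" using assms m_pos by (intro nu_pos) simp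
  have "theta / (real m * real g) - theta / (real g)\<^sup>2 \<le> theta / (real m * real g) - theta / (real m * (real g)\<^sup>2)"
    using gm theta_pos by (intro diff_left_mono divide_left_mono) (auto simp: mult_le_cancel_right1)
  also have "\<dots> = theta / real m * (1 / real g - 1 / (real g)\<^sup>2)"
    by (simp add: right_diff_distrib)
  also have "\<dots> \<le> theta / real m * (1 / (real g + 1))"
  proof (intro mult_left_mono)
    have "(real g - 1) * (real g + 1) \<le> (real g)\<^sup>2" by (simp add: algebra_simps power2_eq_square)
    hence "(real g - 1) / (real g)\<^sup>2 \<le> 1 / (real g + 1)" using gm by (simp add: field_simps)
    thus "1 / real g - 1 / (real g)\<^sup>2 \<le> 1 / (real g + 1)"
      using gm by (simp add: power2_eq_square diff_divide_distrib)
  qed (use theta_pos in auto)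
  also have "\<dots> = 1 / ((2 + \<beta>) * real (g * m + m))"
    by (simp add: theta_def algebra_simps)
  also have "\<dots> \<le> 1 / nu (g * m + m)"
    using v by (intro divide_left_mono) (auto simp: nu_def intro!: mult_pos_pos)
  finally show ?thesis .
qed

text \<open>Each of the m factors contributes p theta/(m g) to first order, so m cancels in the
  growth over a block.\<close>

lemma growth_upper:
  "\<exists>C\<ge>0. \<forall>g\<ge>1. (1 + real p / nu (g * m)) ^ m \<le> 1 + real p * theta / real g + C / (real g)\<^sup>2"
proof -
  obtain A where A: "A \<ge> 0" "\<And>t. t \<in> {0..real p / \<beta>} \<Longrightarrow> (1 + t) ^ m \<le> 1 + real m * t + A * t\<^sup>2"
    using one_plus_power_le_quadratic[of "real p / \<beta>" m] beta_pos by auto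
  define C where "C = real m * real p * (2 * theta / \<beta>) + A * (real p / \<beta>)\<^sup>2"
  have "(1 + real p / nu (g * m)) ^ m \<le> 1 + real p * theta / real g + C / (real g)\<^sup>2" if g: "g \<ge> 1" for g
  proof -
    define t where "t = real p / nu (g * m)"
    have v: "nu (g * m) > 0" using nu_ge g by auto
    have t0: "t \<ge> 0" using v by (simp add: t_def)
    have t1: "t \<le> real p / \<beta> / real g"
      using mult_left_mono[OF inverse_nu_le(2)[OF g], of "real p"] by (simp add: t_def)
    have "real p / \<beta> / real g \<le> real p / \<beta> / 1" using g beta_pos by (intro divide_left_mono) auto
    hence "(1 + t) ^ m \<le> 1 + real m * t + A * t\<^sup>2" using A(2)[of t] t0 t1 by simp
    also have "real m * t = real m * real p * (1 / nu (g * m))" by (simp add: t_def)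
    also have "\<dots> \<le> real m * real p * (theta / (real m * real g) + (2 * theta / \<beta>) / (real g)\<^sup>2)"
      by (rule mult_left_mono[OF inverse_nu_le(1)[OF g]]) auto
    also have "\<dots> = real p * theta / real g + real m * real p * (2 * theta / \<beta>) / (real g)\<^sup>2"
      using m_pos g by (simp add: field_simps)
    also have "A * t\<^sup>2 \<le> A * (real p / \<beta> / real g)\<^sup>2"
      using t0 t1 A by (intro mult_left_mono power_mono) auto
    also have "\<dots> = A * (real p / \<beta>)\<^sup>2 / (real g)\<^sup>2" by (simp add: power_divide power_mult_distrib)
    finally show ?thesis by (simp add: t_def C_def add_divide_distrib)
  qed
  moreover have "C \<ge> 0" using A beta_pos theta_pos by (simp add: C_def)
  ultimately show ?thesis by blast
qed

lemma growth_lower: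
  assumes "g \<ge> 1"
  shows "(1 + real p / nu (g * m + m)) ^ m \<ge> 1 + real p * theta / real g - real m * real p * theta / (real g)\<^sup>2"
proof -
  have v: "nu (g * m + m) > 0" using assms m_pos by (intro nu_pos) simp
  have "1 + real p * theta / real g - real m * real p * theta / (real g)\<^sup>2
      = 1 + real m * (real p * (theta / (real m * real g) - theta / (real g)\<^sup>2))"
    using m_pos by (simp add: field_simps)
  also have "\<dots> \<le> 1 + real m * (real p * (1 / nu (g * m + m)))"
    by (intro add_left_mono mult_left_mono inverse_nu_ge assms) auto
  also have "\<dots> = 1 + real m * (real p / nu (g * m + m))" by simp
  also have "\<dots> \<le> (1 + real p / nu (g * m + m)) ^ m"
    using v by (intro Bernoulli_inequality) (smt (verit) divide_nonneg_pos of_nat_0_le_iff)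
  finally show ?thesis .
qed

lemma growth_over_nu:
  "\<exists>C\<ge>0. \<forall>g\<ge>1. (1 + real p / nu (g * m)) ^ m * (1 / nu (g * m)) \<le> theta / (real m * real g) + C / (real g)\<^sup>2"
proof -
  obtain C where C: "C \<ge> 0" "\<And>g. g \<ge> 1 \<Longrightarrow> (1 + real p / nu (g * m)) ^ m \<le> 1 + real p * theta / real g + C / (real g)\<^sup>2"
    using growth_upper by blast
  define K where "K = 2 * theta / \<beta> + (real p * theta + C) / \<beta>"
  have "(1 + real p / nu (g * m)) ^ m * (1 / nu (g * m)) \<le> theta / (real m * real g) + K / (real g)\<^sup>2" if g: "g \<ge> 1" for g
  proof -
    have v: "nu (g * m) > 0" using nu_ge g by auto
    have "C / (real g)\<^sup>2 \<le> C / real g" using g C by (intro divide_left_mono) (auto simp: power2_eq_square)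
    hence "(1 + real p / nu (g * m)) ^ m \<le> 1 + (real p * theta + C) / real g"
      using C(2)[OF g] by (simp add: add_divide_distrib)
    hence "(1 + real p / nu (g * m)) ^ m * (1 / nu (g * m)) \<le> (1 + (real p * theta + C) / real g) * (1 / nu (g * m))"
      using v by (intro mult_right_mono) auto
    also have "\<dots> = 1 / nu (g * m) + (real p * theta + C) / real g * (1 / nu (g * m))" by (simp add: algebra_simps)
    also have "\<dots> \<le> (theta / (real m * real g) + (2 * theta / \<beta>) / (real g)\<^sup>2)
        + (real p * theta + C) / real g * ((1 / \<beta>) / real g)"
      using C theta_pos by (intro add_mono mult_left_mono inverse_nu_le g) auto
    also have "\<dots> = theta / (real m * real g) + K / (real g)\<^sup>2"
      by (simp add: K_def power2_eq_square add_divide_distrib mult_ac)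
    finally show ?thesis .
  qed
  moreover have "K \<ge> 0" using C beta_pos theta_pos by (simp add: K_def)
  ultimately show ?thesis by blast
qed

lemma growth_over_nu_square:
  "\<exists>C\<ge>0. \<forall>g\<ge>1. (1 + 2 / nu (g * m)) ^ m / (nu (g * m))\<^sup>2 \<le> theta\<^sup>2 / (real m * real g)\<^sup>2 + C / real g ^ 3
     \<and> theta\<^sup>2 / (real m * real g)\<^sup>2 - C / real g ^ 3 \<le> 1 / (nu (g * m + m))\<^sup>2"
proof -
  obtain C where C: "C \<ge> 0" "\<And>g. g \<ge> 1 \<Longrightarrow> (1 + 2 / nu (g * m)) ^ m * (1 / nu (g * m)) \<le> theta / (real m * real g) + C / (real g)\<^sup>2"
    using growth_over_nu[of 2] by auto
  define K where "K = C / \<beta> + theta * (2 * theta / \<beta>) + 2 * theta * theta"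
  have K0: "K \<ge> 0" "C / \<beta> \<ge> 0" "theta * (2 * theta / \<beta>) \<ge> 0" "2 * theta * theta \<ge> 0"
    using C beta_pos theta_pos by (auto simp: K_def)
  have "(1 + 2 / nu (g * m)) ^ m / (nu (g * m))\<^sup>2 \<le> theta\<^sup>2 / (real m * real g)\<^sup>2 + K / real g ^ 3
     \<and> theta\<^sup>2 / (real m * real g)\<^sup>2 - K / real g ^ 3 \<le> 1 / (nu (g * m + m))\<^sup>2" if g: "g \<ge> 1" for g
  proof
    have v: "nu (g * m) > 0" "nu (g * m + m) > 0" using nu_ge g m_pos by (auto intro!: nu_pos)
    have g0: "real g > 0" "real m \<ge> 1" using g m_pos by auto
    have mg: "theta / (real m * real g) \<le> theta / real g"
      using g0 theta_pos by (intro divide_left_mono) (auto simp: mult_le_cancel_right1)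
    have "(1 + 2 / nu (g * m)) ^ m / (nu (g * m))\<^sup>2
       = ((1 + 2 / nu (g * m)) ^ m * (1 / nu (g * m))) * (1 / nu (g * m))"
      by (simp add: power2_eq_square)
    also have "\<dots> \<le> (theta / (real m * real g) + C / (real g)\<^sup>2) * (1 / nu (g * m))"
      using v by (intro mult_right_mono C g) auto
    also have "\<dots> = theta / (real m * real g) * (1 / nu (g * m)) + C / (real g)\<^sup>2 * (1 / nu (g * m))"
      by (simp add: algebra_simps)
    also have "\<dots> \<le> theta / (real m * real g) * (theta / (real m * real g) + (2 * theta / \<beta>) / (real g)\<^sup>2)
       + C / (real g)\<^sup>2 * ((1 / \<beta>) / real g)"
      using C theta_pos g0 by (intro add_mono mult_left_mono inverse_nu_le g) auto
    also have "\<dots> = theta\<^sup>2 / (real m * real g)\<^sup>2 + theta / (real m * real g) * ((2 * theta / \<beta>) / (real g)\<^sup>2)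
       + (C / \<beta>) / real g ^ 3"
      by (simp add: power2_eq_square power3_eq_cube distrib_left)
    finally have 1: "(1 + 2 / nu (g * m)) ^ m / (nu (g * m))\<^sup>2 \<le> theta\<^sup>2 / (real m * real g)\<^sup>2
       + theta / (real m * real g) * ((2 * theta / \<beta>) / (real g)\<^sup>2) + (C / \<beta>) / real g ^ 3" .
    have "theta / (real m * real g) * ((2 * theta / \<beta>) / (real g)\<^sup>2) \<le> theta / real g * ((2 * theta / \<beta>) / (real g)\<^sup>2)"
      using mg theta_pos beta_pos by (intro mult_right_mono) auto
    also have "\<dots> = (theta * (2 * theta / \<beta>)) / real g ^ 3" by (simp add: power2_eq_square power3_eq_cube)
    finally have 2: "theta / (real m * real g) * ((2 * theta / \<beta>) / (real g)\<^sup>2) \<le> (theta * (2 * theta / \<beta>)) / real g ^ 3" .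
    have "(theta * (2 * theta / \<beta>)) / real g ^ 3 + (C / \<beta>) / real g ^ 3 = (theta * (2 * theta / \<beta>) + C / \<beta>) / real g ^ 3"
      by (simp add: add_divide_distrib)
    also have "\<dots> \<le> K / real g ^ 3"
      using K0 g0 by (intro divide_right_mono) (auto simp: K_def)
    finally show "(1 + 2 / nu (g * m)) ^ m / (nu (g * m))\<^sup>2 \<le> theta\<^sup>2 / (real m * real g)\<^sup>2 + K / real g ^ 3"
      using 1 2 by linarith
    define a where "a = theta / (real m * real g)"
    define e where "e = theta / (real g)\<^sup>2"
    have ae: "a \<ge> 0" "e \<ge> 0" using theta_pos by (auto simp: a_def e_def)
    have w: "1 / nu (g * m + m) \<ge> a - e" "1 / nu (g * m + m) \<ge> 0"
      using inverse_nu_ge[OF g] v by (auto simp: a_def e_def)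
    have "a\<^sup>2 - 2 * a * e \<le> (1 / nu (g * m + m))\<^sup>2"
    \<comment> \<open>Squaring the bound a - e is legitimate only when it is nonnegative; otherwise
      the left side of the claim is nonpositive.\<close>
    proof (cases "a \<ge> e")
      case True
      have "a\<^sup>2 - 2 * a * e \<le> (a - e)\<^sup>2" by (simp add: power2_diff)
      also have "\<dots> \<le> (1 / nu (g * m + m))\<^sup>2" using True w by (intro power_mono) auto
      finally show ?thesis .
    next
      case False
      hence "a * a \<le> a * e" using ae by (intro mult_left_mono) auto
      hence "a\<^sup>2 - 2 * a * e \<le> 0" using mult_nonneg_nonneg[OF ae] by (simp add: power2_eq_square)
      thus ?thesis by (rule order.trans) simp
    qed
    moreover have "2 * a * e \<le> 2 * (theta / real g) * e" using mg ae by (intro mult_right_mono mult_left_mono) (auto simp: a_def)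
    moreover have "2 * (theta / real g) * e = (2 * theta * theta) / real g ^ 3"
      by (simp add: e_def power2_eq_square power3_eq_cube)
    moreover have "(2 * theta * theta) / real g ^ 3 \<le> K / real g ^ 3"
      using K0 g0 by (intro divide_right_mono) (auto simp: K_def)
    ultimately show "theta\<^sup>2 / (real m * real g)\<^sup>2 - K / real g ^ 3 \<le> 1 / (nu (g * m + m))\<^sup>2"
      by (simp add: a_def power_divide)
  qed
  thus ?thesis using K0 by blast
qed

subsection \<open>Power sums of weights\<close>

definition V :: "nat \<Rightarrow> nat \<Rightarrow> nat list \<Rightarrow> real" where
  "V p g gs = (\<Sum>x=1..g. pochhammer (gw gs x) p)"

text \<open>Number of loops at the vertex created in the block; the index is offset by the g m - 1
  edges already present.\<close>

definition new_hits :: "nat \<Rightarrow> nat list \<Rightarrow> real" where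
  "new_hits g gs = (\<Sum>i<m. of_bool (gs ! (g * m - 1 + i) = Suc g))"

text \<open>The value of w(w+1) for a newly completed vertex without loops: m tails, each worth 1 +
  beta.\<close>

definition mu :: real where
  "mu = pochhammer (real m * (1 + \<beta>)) 2"

lemma V_nonneg: "V p g gs \<ge> 0"
  unfolding V_def by (intro sum_nonneg pochhammer_nonneg' gw_nonneg)

lemma pochhammer_mono: "0 \<le> x \<Longrightarrow> x \<le> y \<Longrightarrow> pochhammer (x::real) p \<le> pochhammer y p"
  unfolding pochhammer_prod by (rule prod_mono) auto

lemma new_hits_bounds: "0 \<le> new_hits g gs" "new_hits g gs \<le> real m"
proof -
  show "0 \<le> new_hits g gs" unfolding new_hits_def by (intro sum_nonneg) auto
  have "new_hits g gs \<le> (\<Sum>i<m. 1)" unfolding new_hits_def by (intro sum_mono) auto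
  thus "new_hits g gs \<le> real m" by simp
qed

lemma gw_new_eq:
  assumes "complete g hs" "length us = m"
  shows "gw (hs @ us) (Suc g) = real m * (1 + \<beta>) + new_hits g (hs @ us)"
proof -
  have "(hs @ us) ! (g * m - 1 + i) = us ! i" for i
    using assms(1) nth_append_length_plus[of hs us i] by (simp add: complete_def del: One_nat_def)
  thus ?thesis using gw_block_new[of hs g us] assms by (simp add: complete_def new_hits_def del: One_nat_def)
qed

lemma iter_new_hits:
  "\<exists>C\<ge>0. \<forall>g hs. complete g hs \<longrightarrow> iter m (new_hits g) hs \<le> C / real g"
proof -
  define C where "C = real m * ((2 + \<beta>) * real m * (1 / \<beta>))"
  have "iter m (new_hits g) hs \<le> C / real g" if c: "complete g hs" for g hs
  proof -
    have c': "valid hs" "g \<ge> 1" "length hs = g * m - 1" using c by (auto simp: complete_def)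
    have "iter m (new_hits g) hs = (\<Sum>i<m. iter m (\<lambda>gs. of_bool (gs ! (g * m - 1 + i) = Suc g)) hs)"
      unfolding new_hits_def by (rule iter_sum[OF c'(1)])
    also have "\<dots> \<le> (\<Sum>i<m. (2 + \<beta>) * real m * (1 / nu (g * m)))"
      using iter_hit_new[OF c'] c' by (intro sum_mono) simp
    also have "\<dots> \<le> (\<Sum>i<m. (2 + \<beta>) * real m * ((1 / \<beta>) / real g))"
      using beta_pos by (intro sum_mono mult_left_mono inverse_nu_le c') auto
    finally show ?thesis by (simp add: C_def)
  qed
  moreover have "C \<ge> 0" using beta_pos by (simp add: C_def)
  ultimately show ?thesis by blast
qed

lemma iter_V_split:
  assumes "complete g hs"
  shows "iter m (V p (Suc g)) hs = (\<Sum>x=1..g. iter m (\<lambda>gs. pochhammer (gw gs x) p) hs)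
    + iter m (\<lambda>gs. pochhammer (gw gs (Suc g)) p) hs"
proof -
  have "V p (Suc g) = (\<lambda>gs. (\<Sum>x=1..g. pochhammer (gw gs x) p) + pochhammer (gw gs (Suc g)) p)"
    by (rule ext) (simp add: V_def)
  thus ?thesis using assms by (simp add: iter_add iter_sum complete_def)
qed

lemma V_drift_upper:
  "\<exists>C\<ge>0. \<forall>g hs. complete g hs \<longrightarrow>
     iter m (V p (Suc g)) hs \<le> (1 + real p * theta / real g + C / (real g)\<^sup>2) * V p g hs + C"
proof -
  obtain C where C: "C \<ge> 0" "\<And>g. g \<ge> 1 \<Longrightarrow> (1 + real p / nu (g * m)) ^ m \<le> 1 + real p * theta / real g + C / (real g)\<^sup>2"
    using growth_upper by blast
  define D where "D = pochhammer ((2 + \<beta>) * real m) p"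
  have D: "D \<ge> 0" unfolding D_def using beta_pos by (intro pochhammer_nonneg') auto
  have "iter m (V p (Suc g)) hs \<le> (1 + real p * theta / real g + (C + D) / (real g)\<^sup>2) * V p g hs + (C + D)"
    if c: "complete g hs" for g hs
  proof -
    have c': "valid hs" "g \<ge> 1" "length hs = g * m - 1" using c by (auto simp: complete_def)
    let ?q = "(1 + real p / nu (g * m)) ^ m"
    have "(\<Sum>x=1..g. iter m (\<lambda>gs. pochhammer (gw gs x) p) hs) \<le> (\<Sum>x=1..g. ?q * pochhammer (gw hs x) p)"
      by (intro sum_mono iter_pochhammer(1)[OF c']) auto
    also have "\<dots> = ?q * V p g hs" by (simp add: V_def sum_distrib_left)
    also have "\<dots> \<le> (1 + real p * theta / real g + C / (real g)\<^sup>2) * V p g hs"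
      by (intro mult_right_mono C c' V_nonneg)
    also have "\<dots> \<le> (1 + real p * theta / real g + (C + D) / (real g)\<^sup>2) * V p g hs"
      using D by (intro mult_right_mono add_left_mono divide_right_mono V_nonneg) auto
    finally have 1: "(\<Sum>x=1..g. iter m (\<lambda>gs. pochhammer (gw gs x) p) hs)
       \<le> (1 + real p * theta / real g + (C + D) / (real g)\<^sup>2) * V p g hs" .
    have "iter m (\<lambda>gs. pochhammer (gw gs (Suc g)) p) hs \<le> iter m (\<lambda>_. D) hs"
      unfolding D_def by (intro iter_mono c' pochhammer_mono gw_nonneg gw_block_new_le[OF c']) auto
    also have "\<dots> = D" by (rule iter_const[OF c'(1)])
    finally show ?thesis using 1 C(1) by (simp add: iter_V_split[OF c])
  qed
  thus ?thesis using C(1) D by (intro exI[of _ "C + D"]) auto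
qed

text \<open>With H loops the new weight is m(1 + beta) + H, so the deviation from \<open>mu\<close>
  is at most a constant times H, and the mean number of loops is O(1/g).\<close>

lemma iter_new_weight:
  "\<exists>C\<ge>0. \<forall>g hs. complete g hs \<longrightarrow>
     \<bar>iter m (\<lambda>gs. pochhammer (gw gs (Suc g)) 2) hs - mu\<bar> \<le> C / real g"
proof -
  obtain C where C: "C \<ge> 0" "\<And>g hs. complete g hs \<Longrightarrow> iter m (new_hits g) hs \<le> C / real g"
    using iter_new_hits by blast
  define A where "A = real m * (1 + \<beta>)"
  define K where "K = 2 * A + 1 + real m"
  have A: "A \<ge> 0" using beta_pos by (simp add: A_def)
  have "\<bar>iter m (\<lambda>gs. pochhammer (gw gs (Suc g)) 2) hs - mu\<bar> \<le> (K * C) / real g"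
    if c: "complete g hs" for g hs
  proof -
    have v: "valid hs" using c by (simp add: complete_def)
    have "\<bar>iter m (\<lambda>gs. pochhammer (gw gs (Suc g)) 2 - mu) hs\<bar> \<le> iter m (\<lambda>gs. K * new_hits g gs) hs"
    proof (rule iter_abs_le[OF v])
      fix us :: "nat list" assume us: "length us = m"
      define H where "H = new_hits g (hs @ us)"
      have H: "0 \<le> H" "H \<le> real m" unfolding H_def by (rule new_hits_bounds)+
      have "pochhammer (gw (hs @ us) (Suc g)) 2 - mu = (2 * A + 1 + H) * H"
        unfolding gw_new_eq[OF c us] mu_def H_def[symmetric] A_def[symmetric]
        by (simp add: pochhammer_Suc numeral_2_eq_2 algebra_simps)
      moreover have "0 \<le> (2 * A + 1 + H) * H" "(2 * A + 1 + H) * H \<le> K * H"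
        using H A by (auto simp: K_def intro!: mult_right_mono mult_nonneg_nonneg)
      ultimately show "\<bar>pochhammer (gw (hs @ us) (Suc g)) 2 - mu\<bar> \<le> K * new_hits g (hs @ us)"
        unfolding H_def by linarith
    qed
    also have "\<dots> = K * iter m (new_hits g) hs" by (rule iter_cmult)
    also have "\<dots> \<le> K * (C / real g)" using A by (intro mult_left_mono C c) (auto simp: K_def)
    finally show ?thesis by (simp add: iter_diff iter_const[OF v])
  qed
  moreover have "K * C \<ge> 0" using A C by (simp add: K_def)
  ultimately show ?thesis by blast
qed

lemma sandwich_abs:
  fixes a b c e f :: real
  assumes "a \<le> b" "b \<le> c" "e - f \<le> a" "c \<le> e + f"
  shows "\<bar>b - e\<bar> \<le> f"
  using assms by linarith

text \<open>The two growth factors of a block agree up to 1/g^2, which makes the drift two-sided.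
  For other p the one-sided \<open>V_drift_upper\<close> suffices.\<close>

lemma V2_drift:
  "\<exists>C\<ge>0. \<forall>g hs. complete g hs \<longrightarrow>
     \<bar>iter m (V 2 (Suc g)) hs - (1 + 2 * theta / real g) * V 2 g hs - mu\<bar> \<le> C * (V 2 g hs / (real g)\<^sup>2 + 1 / real g)"
proof -
  obtain C1 where C1: "C1 \<ge> 0" "\<And>g. g \<ge> 1 \<Longrightarrow> (1 + 2 / nu (g * m)) ^ m \<le> 1 + 2 * theta / real g + C1 / (real g)\<^sup>2"
    using growth_upper[of 2] by auto
  obtain C2 where C2: "C2 \<ge> 0" "\<And>g hs. complete g hs \<Longrightarrow>
     \<bar>iter m (\<lambda>gs. pochhammer (gw gs (Suc g)) 2) hs - mu\<bar> \<le> C2 / real g" using iter_new_weight by blast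
  define C where "C = C1 + 2 * real m * theta + C2"
  have "\<bar>iter m (V 2 (Suc g)) hs - (1 + 2 * theta / real g) * V 2 g hs - mu\<bar> \<le> C * (V 2 g hs / (real g)\<^sup>2 + 1 / real g)"
    if c: "complete g hs" for g hs
  proof -
    have c': "valid hs" "g \<ge> 1" "length hs = g * m - 1" using c by (auto simp: complete_def)
    let ?S = "\<Sum>x=1..g. iter m (\<lambda>gs. pochhammer (gw gs x) 2) hs"
    have "?S \<le> (\<Sum>x=1..g. (1 + 2 / nu (g * m)) ^ m * pochhammer (gw hs x) 2)"
      using iter_pochhammer(1)[OF c', of _ 2] by (intro sum_mono) auto
    also have "\<dots> = (1 + 2 / nu (g * m)) ^ m * V 2 g hs" by (simp add: V_def sum_distrib_left)
    also have "\<dots> \<le> (1 + 2 * theta / real g + C1 / (real g)\<^sup>2) * V 2 g hs"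
      by (intro mult_right_mono C1 c' V_nonneg)
    finally have up: "?S \<le> (1 + 2 * theta / real g + C1 / (real g)\<^sup>2) * V 2 g hs" .
    have "(1 + 2 * theta / real g - real m * 2 * theta / (real g)\<^sup>2) * V 2 g hs \<le> (1 + 2 / nu (g * m + m)) ^ m * V 2 g hs"
      using growth_lower[OF c'(2), of 2] by (intro mult_right_mono V_nonneg) simp
    also have "\<dots> = (\<Sum>x=1..g. (1 + 2 / nu (g * m + m)) ^ m * pochhammer (gw hs x) 2)" by (simp add: V_def sum_distrib_left)
    also have "\<dots> \<le> ?S"
      using iter_pochhammer(2)[OF c', of _ 2] by (intro sum_mono) auto
    finally have lo: "(1 + 2 * theta / real g - real m * 2 * theta / (real g)\<^sup>2) * V 2 g hs \<le> ?S" .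
    have V0: "V 2 g hs / (real g)\<^sup>2 \<ge> 0" by (simp add: V_nonneg)
    have "\<bar>?S - (1 + 2 * theta / real g) * V 2 g hs\<bar> \<le> (C1 + 2 * real m * theta) * (V 2 g hs / (real g)\<^sup>2)"
    proof (rule sandwich_abs[OF lo up])
      have "C1 * (V 2 g hs / (real g)\<^sup>2) \<ge> 0" "(2 * real m * theta) * (V 2 g hs / (real g)\<^sup>2) \<ge> 0"
        using V0 C1 theta_pos by (intro mult_nonneg_nonneg; simp)+
      thus "(1 + 2 * theta / real g) * V 2 g hs - (C1 + 2 * real m * theta) * (V 2 g hs / (real g)\<^sup>2)
         \<le> (1 + 2 * theta / real g - real m * 2 * theta / (real g)\<^sup>2) * V 2 g hs"
       and "(1 + 2 * theta / real g + C1 / (real g)\<^sup>2) * V 2 g hs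
         \<le> (1 + 2 * theta / real g) * V 2 g hs + (C1 + 2 * real m * theta) * (V 2 g hs / (real g)\<^sup>2)"
        by (simp_all add: algebra_simps add_divide_distrib)
    qed
    also have "\<dots> \<le> C * (V 2 g hs / (real g)\<^sup>2)" using V0 C2 by (intro mult_right_mono) (auto simp: C_def)
    finally have "\<bar>?S - (1 + 2 * theta / real g) * V 2 g hs\<bar> \<le> C * (V 2 g hs / (real g)\<^sup>2)" .
    moreover have "\<bar>iter m (\<lambda>gs. pochhammer (gw gs (Suc g)) 2) hs - mu\<bar> \<le> C * (1 / real g)"
    proof -
      have "C2 * (1 / real g) \<le> C * (1 / real g)"
        using C1 theta_pos by (intro mult_right_mono) (auto simp: C_def)
      thus ?thesis using C2(2)[OF c] by simp
    qed
    ultimately show ?thesis unfolding iter_V_split[OF c] distrib_left by linarith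
  qed
  moreover have "C \<ge> 0" using C1 C2 theta_pos by (simp add: C_def)
  ultimately show ?thesis by blast
qed

section \<open>Drift of the number of triangles\<close>

definition ends :: "nat list \<Rightarrow> nat \<Rightarrow> nat set" where
  "ends gs k = {grp m k, gs ! (k - 2)}"

definition is_tri :: "nat list \<Rightarrow> nat set \<Rightarrow> bool" where
  "is_tri gs S \<longleftrightarrow> card S = 3 \<and>
     (\<exists>x y z. x \<noteq> y \<and> y \<noteq> z \<and> x \<noteq> z \<and> ends gs ` S = {{x,y},{y,z},{x,z}})"

definition tri_set :: "nat \<Rightarrow> nat list \<Rightarrow> nat set set" where
  "tri_set g gs = {S. S \<subseteq> {2..g*m} \<and> is_tri gs S}"

abbreviation tri :: "nat \<Rightarrow> nat list \<Rightarrow> nat" where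
  "tri g gs \<equiv> card (tri_set g gs)"

lemma mem_tri_set: "S \<in> tri_set g gs \<longleftrightarrow> S \<subseteq> {2..g*m} \<and> is_tri gs S"
  by (simp add: tri_set_def)

lemma finite_tri_set: "finite (tri_set g gs)"
  by (rule finite_subset[of _ "Pow {2..g*m}"]) (simp_all add: tri_set_def Collect_mono_iff Pow_def)

text \<open>Loops are left out because the corners of a triangle are distinct. Divided by nu^2, the
  product of the end weights is the rate at which two new edges close edge k to a triangle.\<close>

definition R :: "nat \<Rightarrow> nat list \<Rightarrow> real" where
  "R g gs = (\<Sum>k<g*m-1. of_bool (gs ! k \<noteq> grp m (k + 2)) * (gw gs (gs ! k) * gw gs (grp m (k + 2))))"

lemma ends_old:
  assumes "complete g hs" "k \<in> {2..g*m}"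
  shows "ends (hs @ us) k = {grp m k, hs ! (k - 2)}" "ends hs k \<subseteq> {1..g}"
proof -
  have c': "valid hs" "g \<ge> 1" "length hs = g * m - 1" using assms by (auto simp: complete_def)
  have k: "k - 2 < length hs" "k - 2 + 2 = k" using assms(2) c'(3) by auto
  show "ends (hs @ us) k = {grp m k, hs ! (k - 2)}" using k by (simp add: ends_def nth_append)
  show "ends hs k \<subseteq> {1..g}" using valid_block_old[OF c' k(1)] k(2) by (auto simp: ends_def)
qed

lemma ends_append:
  assumes "complete g hs" "S \<subseteq> {2..g*m}"
  shows "ends (hs @ us) ` S = ends hs ` S"
proof (rule image_cong)
  fix k assume "k \<in> S"
  hence k: "k \<in> {2..g*m}" using assms(2) by blast
  show "ends (hs @ us) k = ends hs k"
    using ends_old(1)[OF assms(1) k, of us] ends_old(1)[OF assms(1) k, of "[]"] by (simp only: append_Nil2)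
qed simp

lemma ends_new:
  assumes "complete g hs" "i < m"
  shows "ends (hs @ us) (g * m + 1 + i) = {Suc g, us ! i}"
proof -
  have "g * m + 1 + i - 2 = length hs + i" using assms m_pos by (auto simp: complete_def)
  moreover have "grp m (g * m + 1 + i) = Suc g" using grp_block[OF assms(2), of g] by (simp add: add_ac)
  ultimately show ?thesis unfolding ends_def by (simp add: nth_append del: One_nat_def)
qed

text \<open>Every new edge ends in g + 1 and no old edge does. Hence a triangle that was not there
  before has g + 1 as a corner, its opposite side is old and the other two sides are new; i < j
  lists each pair of new edges once.\<close>

lemma tri_new:
  assumes c: "complete g hs" and us: "length us = m"
  shows "tri_set (Suc g) (hs @ us) - tri_set g hs
    = (\<lambda>(k, j, i). {k, g * m + 1 + i, g * m + 1 + j}) `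
       (SIGMA k:{2..g*m}. SIGMA j:{..<m}. {i\<in>{..<j}. grp m k \<noteq> hs ! (k - 2) \<and> {us ! i, us ! j} = {grp m k, hs ! (k - 2)}})"
proof (intro Set.equalityI subsetI)
  let ?X = "tri_set (Suc g) (hs @ us)" and ?Y = "tri_set g hs"
  let ?h = "\<lambda>(k, j, i). {k, g * m + 1 + i, g * m + 1 + j}"
  let ?Q = "SIGMA k:{2..g*m}. SIGMA j:{..<m}. {i\<in>{..<j}. grp m k \<noteq> hs ! (k - 2) \<and> {us ! i, us ! j} = {grp m k, hs ! (k - 2)}}"
  have old: "Suc g \<notin> ends (hs @ us) k" if "k \<in> {2..g*m}" for k
  proof -
    have "ends (hs @ us) k = ends hs k"
      using ends_old(1)[OF c that, of us] ends_old(1)[OF c that, of "[]"] by (simp only: append_Nil2)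
    thus ?thesis using ends_old(2)[OF c that] by fastforce
  qed
  {
    fix S assume "S \<in> ?h ` ?Q"
    then obtain k i j where kij: "k \<in> {2..g*m}" "j < m" "i < j" "grp m k \<noteq> hs ! (k - 2)"
      "{us ! i, us ! j} = {grp m k, hs ! (k - 2)}" and S: "S = {k, g * m + 1 + i, g * m + 1 + j}" by auto
    have sub: "S \<subseteq> {2..Suc g * m}" "\<not> S \<subseteq> {2..g * m}" using kij c m_pos by (auto simp: S complete_def)
    have "card S = 3" using kij by (simp add: S)
    moreover have "ends (hs @ us) ` S = {{us ! i, us ! j}, {us ! j, Suc g}, {us ! i, Suc g}}"
      using ends_old(1)[OF c kij(1), of us] ends_new[OF c, of i us] ends_new[OF c, of j us] kij by (auto simp: S)
    moreover have "us ! i \<noteq> us ! j" "us ! j \<noteq> Suc g" "us ! i \<noteq> Suc g"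
    proof -
      have "Suc g \<notin> {us ! i, us ! j}" using old[OF kij(1)] unfolding kij(5) ends_old(1)[OF c kij(1), of us] .
      thus "us ! j \<noteq> Suc g" "us ! i \<noteq> Suc g" by auto
      show "us ! i \<noteq> us ! j" using kij(4,5) unfolding doubleton_eq_iff by metis
    qed
    ultimately have t: "is_tri (hs @ us) S" unfolding is_tri_def
      by (intro conjI exI[of _ "us ! i"] exI[of _ "us ! j"] exI[of _ "Suc g"])
    show "S \<in> ?X - ?Y" unfolding Diff_iff mem_tri_set
      by (intro conjI sub(1) t notI) (drule conjunct1, erule notE[OF sub(2)])
  }
  {
    fix S assume SX: "S \<in> ?X - ?Y"
    have S: "S \<subseteq> {2..Suc g * m}" and t: "is_tri (hs @ us) S" and n0: "\<not> (S \<subseteq> {2..g*m} \<and> is_tri hs S)"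
      using SX unfolding Diff_iff mem_tri_set by (simp_all only: simp_thms)
    have S3: "card S = 3" using t unfolding is_tri_def by (rule conjunct1)
    obtain x y z where xyz: "x \<noteq> y" "y \<noteq> z" "x \<noteq> z" "ends (hs @ us) ` S = {{x,y},{y,z},{x,z}}"
      using t unfolding is_tri_def by (elim conjE exE) (rule that)
    \<comment> \<open>Appending heads does not change the ends of old edges, so a triangle of old
      edges only would have been counted already.\<close>
    have "\<not> S \<subseteq> {2..g*m}"
    proof
      assume s: "S \<subseteq> {2..g*m}"
      have "ends (hs @ us) ` S = ends hs ` S"
        using ends_append[OF c s] .
      hence "ends hs ` S = {{x,y},{y,z},{x,z}}" using xyz(4) by simp
      hence "is_tri hs S" unfolding is_tri_def using S3 xyz(1-3)
        by (intro conjI exI[of _ x] exI[of _ y] exI[of _ z])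
      thus False using n0 s by blast
    qed
    then obtain s where s: "s \<in> S" "s \<notin> {2..g*m}" by blast
    have new: "\<exists>i<m. s = g * m + 1 + i" if "s \<in> S" "s \<notin> {2..g*m}" for s
    proof -
      have "s > g * m" "s \<le> g * m + m" using that S by auto
      thus ?thesis by (intro exI[of _ "s - (g * m + 1)"]) auto
    qed
    obtain i0 where "i0 < m" "s = g * m + 1 + i0" using new[OF s] by blast
    hence "Suc g \<in> ends (hs @ us) s" using ends_new[OF c] by simp
    hence "Suc g \<in> {x, y, z}" using xyz(4) s(1) by blast
    \<comment> \<open>Relabel the corners so that a and b are the two other than g + 1.\<close>
    then obtain a b where ab: "a \<noteq> b" "a \<noteq> Suc g" "b \<noteq> Suc g" "ends (hs @ us) ` S = {{a,b},{Suc g,a},{Suc g,b}}"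
    proof -
      consider "x = Suc g" | "y = Suc g" | "z = Suc g" using \<open>Suc g \<in> {x, y, z}\<close> by blast
      thus ?thesis
      proof cases
        case 1
        have "ends (hs @ us) ` S = {{y,z},{Suc g,y},{Suc g,z}}" unfolding xyz(4) 1 by blast
        thus ?thesis using that[of y z] xyz 1 by blast
      next
        case 2
        have "ends (hs @ us) ` S = {{x,z},{Suc g,x},{Suc g,z}}" unfolding xyz(4) 2 by blast
        thus ?thesis using that[of x z] xyz 2 by blast
      next
        case 3
        have "ends (hs @ us) ` S = {{x,y},{Suc g,x},{Suc g,y}}" unfolding xyz(4) 3 by blast
        thus ?thesis using that[of x y] xyz 3 by blast
      qed
    qed
    have in_im: "{a,b} \<in> ends (hs @ us) ` S" "{Suc g,a} \<in> ends (hs @ us) ` S" "{Suc g,b} \<in> ends (hs @ us) ` S"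
      unfolding ab(4) by simp_all
    obtain k where k: "{a, b} = ends (hs @ us) k" "k \<in> S" by (rule imageE[OF in_im(1)])
    obtain s where s: "{Suc g, a} = ends (hs @ us) s" "s \<in> S" by (rule imageE[OF in_im(2)])
    obtain t where t: "{Suc g, b} = ends (hs @ us) t" "t \<in> S" by (rule imageE[OF in_im(3)])
    note kst = k(2) k(1)[symmetric] s(2) s(1)[symmetric] t(2) t(1)[symmetric]
    have dist: "k \<noteq> s" "k \<noteq> t" "s \<noteq> t" using kst(2,4,6) ab(1-3) by (metis doubleton_eq_iff)+
    \<comment> \<open>The three sides found are distinct elements of a three-element set and
      therefore exhaust it.\<close>
    have "finite S" using S3 card_ge_0_finite[of S] by simp
    moreover have "{k, s, t} \<subseteq> S" using kst(1,3,5) by simp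
    moreover have "card {k, s, t} = card S" using dist S3 by simp
    ultimately have Seq: "S = {k, s, t}" using card_subset_eq by metis
    have k: "k \<in> {2..g*m}"
    proof (rule ccontr)
      assume "k \<notin> {2..g*m}"
      then obtain i where i: "i < m" "k = g * m + 1 + i" using new[OF kst(1)] by blast
      have "Suc g \<in> {Suc g, us ! i}" by simp
      also have "\<dots> = {a, b}" using ends_new[OF c i(1), of us] kst(2) unfolding i(2) by simp
      finally have "Suc g \<in> {a, b}" .
      thus False using ab(2,3) by simp
    qed
    have "s \<notin> {2..g*m}" using old[of s] unfolding kst(4) by blast
    then obtain i where i: "i < m" "s = g * m + 1 + i" using new[OF kst(3)] by blast
    have "t \<notin> {2..g*m}" using old[of t] unfolding kst(6) by blast
    then obtain j where j: "j < m" "t = g * m + 1 + j" using new[OF kst(5)] by blast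
    note ij = i j
    have uij: "us ! i = a" "us ! j = b"
      using ends_new[OF c i(1), of us] ends_new[OF c j(1), of us] kst(4,6) ab(2,3)
      unfolding i(2) j(2) by (simp_all add: doubleton_eq_iff)
    have kab: "{grp m k, hs ! (k - 2)} = {a, b}" using ends_old(1)[OF c k, of us] kst(2) by simp
    hence ne: "grp m k \<noteq> hs ! (k - 2)" using ab(1) by (auto simp: doubleton_eq_iff)
    have "i \<noteq> j" using uij ab(1) by blast
    show "S \<in> ?h ` ?Q"
    proof (cases "i < j")
      case True
      have "S = ?h (k, j, i)" using Seq ij(2,4) by simp
      moreover have "(k, j, i) \<in> ?Q" using True k ij(1,3) ne kab uij by simp
      ultimately show ?thesis by (rule image_eqI)
    next
      case False
      have "S = ?h (k, i, j)" using Seq ij(2,4) by (simp add: insert_commute)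
      moreover have "(k, i, j) \<in> ?Q"
        using False \<open>i \<noteq> j\<close> k ij(1,3) ne kab uij by (simp add: insert_commute)
      ultimately show ?thesis by (rule image_eqI)
    qed
  }
qed

text \<open>As the ends of a non-loop edge differ, the set equation in \<open>tri_new\<close> splits
  into two exclusive ordered events, each of the form treated in
  \<open>iter_hit_pair\<close>.\<close>

lemma tri_Suc:
  assumes c: "complete g hs" and us: "length us = m"
  shows "real (tri (Suc g) (hs @ us)) = real (tri g hs) +
    (\<Sum>k<g*m-1. of_bool (hs ! k \<noteq> grp m (k + 2)) * (\<Sum>j<m. \<Sum>i<j.
       of_bool (us ! i = hs ! k) * of_bool (us ! j = grp m (k + 2)) +
       of_bool (us ! i = grp m (k + 2)) * of_bool (us ! j = hs ! k)))"
proof -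
  let ?X = "tri_set (Suc g) (hs @ us)" and ?Y = "tri_set g hs"
  let ?h = "\<lambda>(k, j, i). {k, g * m + 1 + i, g * m + 1 + j}"
  let ?D = "\<lambda>k j. {i\<in>{..<j}. grp m k \<noteq> hs ! (k - 2) \<and> {us ! i, us ! j} = {grp m k, hs ! (k - 2)}}"
  let ?Q = "SIGMA k:{2..g*m}. SIGMA j:{..<m}. ?D k j"
  have [simp]: "Suc (Suc (a - 2)) = a" if "2 \<le> a" for a using that by simp
  have "?Y \<subseteq> ?X"
  proof
    fix S assume S: "S \<in> ?Y"
    have "ends (hs @ us) ` S = ends hs ` S"
      by (rule ends_append[OF c]) (use S in \<open>simp only: mem_tri_set\<close>)
    hence "is_tri (hs @ us) S" using S unfolding mem_tri_set is_tri_def by (simp only: simp_thms)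
    thus "S \<in> ?X" using S by (auto simp: mem_tri_set)
  qed
  moreover have "finite ?X" by (rule finite_tri_set)
  ultimately have "card ?X = card ?Y + card (?X - ?Y)"
    by (metis card_Diff_subset card_mono finite_subset le_add_diff_inverse)
  also have "card (?X - ?Y) = card ?Q"
  proof -
    \<comment> \<open>Old indices are at most g m and new ones exceed it, and i < j orders the new
      ones; so the set determines all three indices.\<close>
    have "inj_on ?h ?Q"
    proof (rule inj_onI; clarsimp)
      fix k j i k' j' i'
      assume a: "k \<le> g * m" "i < j" "k' \<le> g * m" "i' < j'"
        "{k, Suc (g * m + i), Suc (g * m + j)} = {k', Suc (g * m + i'), Suc (g * m + j')}"
      hence "k \<in> {k', Suc (g * m + i'), Suc (g * m + j')}" "Suc (g * m + i) \<in> {k', Suc (g * m + i'), Suc (g * m + j')}"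
        "Suc (g * m + j) \<in> {k', Suc (g * m + i'), Suc (g * m + j')}"
        "Suc (g * m + i') \<in> {k, Suc (g * m + i), Suc (g * m + j)}" by blast+
      thus "k = k' \<and> j = j' \<and> i = i'" using a(1-4) by auto
    qed
    thus ?thesis unfolding tri_new[OF c us] by (rule card_image)
  qed
  also have "card ?Q = (\<Sum>k\<in>{2..g*m}. \<Sum>j<m. card (?D k j))"
    by (subst card_SigmaI; simp)+
  finally have "real (tri (Suc g) (hs @ us)) = real (tri g hs) + (\<Sum>k\<in>{2..g*m}. \<Sum>j<m. real (card (?D k j)))"
    by simp
  also have "(\<Sum>k\<in>{2..g*m}. \<Sum>j<m. real (card (?D k j))) = (\<Sum>k<g*m-1. \<Sum>j<m. real (card (?D (k + 2) j)))"
    by (rule sum.reindex_bij_witness[of _ "\<lambda>k. k + 2" "\<lambda>k. k - 2"]) (auto simp del: One_nat_def)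
  also have "\<dots> = (\<Sum>k<g*m-1. of_bool (hs ! k \<noteq> grp m (k + 2)) * (\<Sum>j<m. \<Sum>i<j.
       of_bool (us ! i = hs ! k) * of_bool (us ! j = grp m (k + 2)) +
       of_bool (us ! i = grp m (k + 2)) * of_bool (us ! j = hs ! k)))"
  proof (rule sum.cong[OF refl])
    fix k assume "k \<in> {..<g*m-1}"
    show "(\<Sum>j<m. real (card (?D (k + 2) j))) = of_bool (hs ! k \<noteq> grp m (k + 2)) * (\<Sum>j<m. \<Sum>i<j.
       of_bool (us ! i = hs ! k) * of_bool (us ! j = grp m (k + 2)) +
       of_bool (us ! i = grp m (k + 2)) * of_bool (us ! j = hs ! k))"
    proof (cases "hs ! k = grp m (k + 2)")
      case True
      thus ?thesis by simp
    next
      case False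
      have "real (card (?D (k + 2) j)) = (\<Sum>i<j. of_bool (us ! i = hs ! k) * of_bool (us ! j = grp m (k + 2)) +
       of_bool (us ! i = grp m (k + 2)) * of_bool (us ! j = hs ! k))" for j
      proof -
        have "real (card (?D (k + 2) j)) = (\<Sum>i\<in>?D (k + 2) j. 1)" by simp
        also have "\<dots> = (\<Sum>i<j. if {us ! i, us ! j} = {grp m (k + 2), hs ! k} then 1 else 0)"
          using False by (subst sum.inter_filter[symmetric]) auto
        also have "\<dots> = (\<Sum>i<j. of_bool (us ! i = hs ! k) * of_bool (us ! j = grp m (k + 2)) +
           of_bool (us ! i = grp m (k + 2)) * of_bool (us ! j = hs ! k))"
          using False by (intro sum.cong refl) (auto simp: doubleton_eq_iff)
        finally show ?thesis .
      qed
      thus ?thesis using False by simp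
    qed
  qed
  finally show ?thesis .
qed

lemma R_nonneg: "R g gs \<ge> 0"
  unfolding R_def by (intro sum_nonneg mult_nonneg_nonneg gw_nonneg) auto

lemma tri_drift:
  "\<exists>C\<ge>0. \<forall>g hs. complete g hs \<longrightarrow>
     \<bar>iter m (\<lambda>gs. real (tri (Suc g) gs)) hs - real (tri g hs) - (real m - 1) * theta\<^sup>2 / real m * R g hs / (real g)\<^sup>2\<bar>
       \<le> C * R g hs / real g ^ 3"
proof -
  obtain C where C0: "C \<ge> 0" and C': "\<forall>g\<ge>1. (1 + 2 / nu (g * m)) ^ m / (nu (g * m))\<^sup>2 \<le> theta\<^sup>2 / (real m * real g)\<^sup>2 + C / real g ^ 3
     \<and> theta\<^sup>2 / (real m * real g)\<^sup>2 - C / real g ^ 3 \<le> 1 / (nu (g * m + m))\<^sup>2"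
    using growth_over_nu_square by (elim exE conjE) (rule that)
  have C2: "(1 + 2 / nu (g * m)) ^ m / (nu (g * m))\<^sup>2 \<le> theta\<^sup>2 / (real m * real g)\<^sup>2 + C / real g ^ 3" if "g \<ge> 1" for g
    using C' that by simp
  have C3: "theta\<^sup>2 / (real m * real g)\<^sup>2 - C / real g ^ 3 \<le> 1 / (nu (g * m + m))\<^sup>2" if "g \<ge> 1" for g
    using C' that by simp
  \<comment> \<open>There are m(m-1)/2 pairs i < j, each in two orders. Then K theta^2/(m g)^2 =
    (m-1) theta^2/(m g^2), the rate in the statement.\<close>
  define K where "K = real m * (real m - 1)"
  have m1: "real m \<ge> 1" using m_pos by simp
  have K: "K \<ge> 0" using m1 by (simp add: K_def)
  have "\<bar>iter m (\<lambda>gs. real (tri (Suc g) gs)) hs - real (tri g hs) - (real m - 1) * theta\<^sup>2 / real m * R g hs / (real g)\<^sup>2\<bar>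
       \<le> (K * C) * R g hs / real g ^ 3" if c: "complete g hs" for g hs
  proof -
    have c': "valid hs" "g \<ge> 1" "length hs = g * m - 1" using c by (auto simp: complete_def)
    define a where "a k = hs ! k" for k
    define b where "b k = grp m (k + 2)" for k
    define f :: "nat \<Rightarrow> nat \<Rightarrow> nat \<Rightarrow> nat \<Rightarrow> nat list \<Rightarrow> real" where "f = (\<lambda>i j x y gs. of_bool (gs ! (length hs + i) = x) * of_bool (gs ! (length hs + j) = y))"
    \<comment> \<open>A monotone functional of the pair probabilities r, to be evaluated at the true
      probabilities and at their two bounds; for r a multiple of the weight product it reduces to
      \<open>R\<close>.\<close>
    let ?P = "\<lambda>r. (\<Sum>k<g*m-1. of_bool (a k \<noteq> b k) * (\<Sum>j<m. \<Sum>i<j. r i j (a k) (b k) + r i j (b k) (a k)))"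
    have "iter m (\<lambda>gs. real (tri (Suc g) gs)) hs = iter m (\<lambda>gs. real (tri g hs) + ?P (\<lambda>i j x y. f i j x y gs)) hs"
      by (rule iter_cong[OF c'(1)]) (simp add: tri_Suc[OF c] f_def a_def b_def del: One_nat_def)
    also have "\<dots> = real (tri g hs) + ?P (\<lambda>i j x y. iter m (f i j x y) hs)"
      by (simp only: iter_add iter_sum[OF c'(1)] iter_const[OF c'(1)] iter_cmult)
    finally have eq: "iter m (\<lambda>gs. real (tri (Suc g) gs)) hs - real (tri g hs) = ?P (\<lambda>i j x y. iter m (f i j x y) hs)" by simp
    have mono: "?P r \<le> ?P r'" if "\<And>k i j. k < g*m-1 \<Longrightarrow> i < j \<Longrightarrow> j < m \<Longrightarrow> a k \<noteq> b k \<Longrightarrow>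
        r i j (a k) (b k) \<le> r' i j (a k) (b k) \<and> r i j (b k) (a k) \<le> r' i j (b k) (a k)" for r r' :: "nat \<Rightarrow> nat \<Rightarrow> nat \<Rightarrow> nat \<Rightarrow> real"
    proof (rule sum_mono)
      fix k assume k: "k \<in> {..<g*m-1}"
      show "of_bool (a k \<noteq> b k) * (\<Sum>j<m. \<Sum>i<j. r i j (a k) (b k) + r i j (b k) (a k))
        \<le> of_bool (a k \<noteq> b k) * (\<Sum>j<m. \<Sum>i<j. r' i j (a k) (b k) + r' i j (b k) (a k))"
        using that k by (cases "a k = b k") (auto intro!: sum_mono add_mono)
    qed
    have const: "?P (\<lambda>i j x y. gw hs x * gw hs y * q) = K * R g hs * q" for q
    proof -
      have "(\<Sum>j<m. \<Sum>i<j. w) = K / 2 * w" for w :: real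
      proof -
        have "(\<Sum>j<n. \<Sum>i<j. w) = real n * (real n - 1) / 2 * w" for n
          by (induction n) (auto simp: algebra_simps add_divide_distrib)
        thus ?thesis by (simp add: K_def)
      qed
      hence "?P (\<lambda>i j x y. gw hs x * gw hs y * q)
         = (\<Sum>k<g*m-1. of_bool (a k \<noteq> b k) * (K / 2 * (gw hs (a k) * gw hs (b k) * q + gw hs (b k) * gw hs (a k) * q)))"
        by (simp only:)
      also have "\<dots> = (\<Sum>k<g*m-1. (of_bool (a k \<noteq> b k) * (gw hs (a k) * gw hs (b k))) * (K * q))"
        by (intro sum.cong refl) (simp add: algebra_simps)
      finally show ?thesis by (simp add: R_def a_def b_def flip: sum_distrib_right)
    qed
    have rng: "1 \<le> a k" "a k \<le> g" "1 \<le> b k" "b k \<le> g" if "k < g*m-1" for k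
      using valid_block_old[OF c', of k] that c'(3) by (auto simp: a_def b_def)
    have up: "?P (\<lambda>i j x y. iter m (f i j x y) hs) \<le> ?P (\<lambda>i j x y. gw hs x * gw hs y * ((1 + 2 / nu (g * m)) ^ m / (nu (g * m))\<^sup>2))"
    proof (rule mono)
      fix k i j assume "k < g*m-1" "i < j" "j < m" "a k \<noteq> b k"
      thus "iter m (f i j (a k) (b k)) hs \<le> gw hs (a k) * gw hs (b k) * ((1 + 2 / nu (g * m)) ^ m / (nu (g * m))\<^sup>2)
        \<and> iter m (f i j (b k) (a k)) hs \<le> gw hs (b k) * gw hs (a k) * ((1 + 2 / nu (g * m)) ^ m / (nu (g * m))\<^sup>2)"
        using iter_hit_pair(1)[OF c' rng(1,2) rng(3,4), of k k i j] iter_hit_pair(1)[OF c' rng(3,4) rng(1,2), of k k i j]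
        by (simp add: f_def mult_ac)
    qed
    have lo: "?P (\<lambda>i j x y. gw hs x * gw hs y * (1 / (nu (g * m + m))\<^sup>2)) \<le> ?P (\<lambda>i j x y. iter m (f i j x y) hs)"
    proof (rule mono)
      fix k i j assume "k < g*m-1" "i < j" "j < m" "a k \<noteq> b k"
      thus "gw hs (a k) * gw hs (b k) * (1 / (nu (g * m + m))\<^sup>2) \<le> iter m (f i j (a k) (b k)) hs
        \<and> gw hs (b k) * gw hs (a k) * (1 / (nu (g * m + m))\<^sup>2) \<le> iter m (f i j (b k) (a k)) hs"
        using iter_hit_pair(2)[OF c' rng(1,2) rng(3,4), of k k i j] iter_hit_pair(2)[OF c' rng(3,4) rng(1,2), of k k i j]
        by (simp add: f_def mult_ac)
    qed
    have KR: "K * R g hs \<ge> 0" using K R_nonneg by simp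
    have "\<bar>iter m (\<lambda>gs. real (tri (Suc g) gs)) hs - real (tri g hs) - K * R g hs * (theta\<^sup>2 / (real m * real g)\<^sup>2)\<bar>
        \<le> K * R g hs * (C / real g ^ 3)"
      unfolding eq using lo up unfolding const
    proof (rule sandwich_abs)
      show "K * R g hs * (theta\<^sup>2 / (real m * real g)\<^sup>2) - K * R g hs * (C / real g ^ 3) \<le> K * R g hs * (1 / (nu (g * m + m))\<^sup>2)"
        using mult_left_mono[OF C3[OF c'(2)] KR] by (simp only: right_diff_distrib)
      show "K * R g hs * ((1 + 2 / nu (g * m)) ^ m / (nu (g * m))\<^sup>2) \<le> K * R g hs * (theta\<^sup>2 / (real m * real g)\<^sup>2) + K * R g hs * (C / real g ^ 3)"
        using mult_left_mono[OF C2[OF c'(2)] KR] by (simp only: distrib_left)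
    qed
    moreover have "K * R g hs * (theta\<^sup>2 / (real m * real g)\<^sup>2) = (real m - 1) * theta\<^sup>2 / real m * R g hs / (real g)\<^sup>2"
    proof -
      have "K * R g hs * (theta\<^sup>2 / (real m * real g)\<^sup>2)
        = (real m * ((real m - 1) * theta\<^sup>2 * R g hs)) / (real m * (real m * (real g)\<^sup>2))"
        by (simp add: K_def power2_eq_square mult_ac)
      also have "\<dots> = ((real m - 1) * theta\<^sup>2 * R g hs) / (real m * (real g)\<^sup>2)"
        using m1 by (intro mult_divide_mult_cancel_left) simp
      finally show ?thesis by simp
    qed
    ultimately show ?thesis by (simp add: mult_ac)
  qed
  thus ?thesis using C0 K by (intro exI[of _ "K * C"]) auto
qed

section \<open>Drift of the edge sum\<close>

text \<open>The sum over x only selects the vertex hit by edge i of the block; since x stops at g, a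
  loop at g + 1 contributes 0. In this form \<open>iter_hit_pochhammer\<close> applies term by
  term.\<close>

definition W :: "nat \<Rightarrow> nat \<Rightarrow> nat \<Rightarrow> nat list \<Rightarrow> real" where
  "W p g i gs = (\<Sum>x=1..g. of_bool (gs ! (g * m - 1 + i) = x) * pochhammer (gw gs x) p)"

lemma W_nonneg: "W p g i gs \<ge> 0"
  unfolding W_def by (intro sum_nonneg mult_nonneg_nonneg pochhammer_nonneg' gw_nonneg) auto

lemma W_eq:
  assumes "complete g hs" "length us = m" "valid (hs @ us)" "i < m"
  shows "W p g i (hs @ us) = of_bool (us ! i \<noteq> Suc g) * pochhammer (gw (hs @ us) (us ! i)) p"
proof -
  have c': "valid hs" "g \<ge> 1" "length hs = g * m - 1" using assms by (auto simp: complete_def)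
  have u: "1 \<le> us ! i" "us ! i \<le> Suc g" using valid_block_le[OF c', of us i] assms by auto
  have "(hs @ us) ! (g * m - 1 + i) = us ! i" using nth_append_length_plus[of hs us i] c'(3) by simp
  hence "W p g i (hs @ us) = (\<Sum>x=1..g. if us ! i = x then pochhammer (gw (hs @ us) x) p else 0)"
    unfolding W_def by (intro sum.cong) auto
  also have "\<dots> = of_bool (us ! i \<noteq> Suc g) * pochhammer (gw (hs @ us) (us ! i)) p" using u by simp
  finally show ?thesis .
qed

lemma W_iter:
  assumes "complete g hs" "i < m"
  shows "iter m (W p g i) hs \<le> ((1 + real (Suc p) / nu (g * m)) ^ m * (1 / nu (g * m))) * V (Suc p) g hs" (is ?A)
    and "1 / nu (g * m + m) * V (Suc p) g hs \<le> iter m (W p g i) hs" (is ?B)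
proof -
  have c': "valid hs" "g \<ge> 1" "length hs = g * m - 1" using assms by (auto simp: complete_def)
  have eq: "iter m (W p g i) hs
      = (\<Sum>x=1..g. iter m (\<lambda>gs. of_bool (gs ! (length hs + i) = x) * pochhammer (gw gs x) p) hs)"
    unfolding W_def[abs_def] c'(3) by (rule iter_sum[OF c'(1)])
  have "iter m (W p g i) hs \<le> (\<Sum>x=1..g. (1 + real (Suc p) / nu (g * m)) ^ m * (pochhammer (gw hs x) (Suc p) / nu (g * m)))"
    unfolding eq by (intro sum_mono iter_hit_pochhammer(1)[OF c']) (use assms in auto)
  also have "\<dots> = (\<Sum>x=1..g. ((1 + real (Suc p) / nu (g * m)) ^ m * (1 / nu (g * m))) * pochhammer (gw hs x) (Suc p))"
    by (intro sum.cong) auto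
  also have "\<dots> = ((1 + real (Suc p) / nu (g * m)) ^ m * (1 / nu (g * m))) * V (Suc p) g hs"
    unfolding V_def by (rule sum_distrib_left[symmetric])
  finally show ?A .
  have "1 / nu (g * m + m) * V (Suc p) g hs = (\<Sum>x=1..g. pochhammer (gw hs x) (Suc p) / nu (g * m + m))"
    unfolding V_def by (simp add: sum_divide_distrib)
  also have "\<dots> \<le> iter m (W p g i) hs"
    unfolding eq by (intro sum_mono iter_hit_pochhammer(2)[OF c']) (use assms in auto)
  finally show ?B .
qed

lemma W_upper: "\<exists>C\<ge>0. \<forall>g hs. \<forall>i<m. complete g hs \<longrightarrow> iter m (W p g i) hs \<le> C * V (Suc p) g hs / real g"
proof -
  obtain C where C: "C \<ge> 0" "\<And>g. g \<ge> 1 \<Longrightarrow> (1 + real (Suc p) / nu (g * m)) ^ m * (1 / nu (g * m)) \<le> theta / (real m * real g) + C / (real g)\<^sup>2"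
    using growth_over_nu[of "Suc p"] by blast
  have "iter m (W p g i) hs \<le> (theta + C) * V (Suc p) g hs / real g" if c: "complete g hs" "i < m" for g hs i
  proof -
    have g: "g \<ge> 1" using c by (simp add: complete_def)
    have "theta / (real m * real g) \<le> theta / real g"
      using g m_pos theta_pos by (intro divide_left_mono) auto
    moreover have "C / (real g)\<^sup>2 \<le> C / real g" using g C by (intro divide_left_mono) (auto simp: power2_eq_square)
    ultimately have "theta / (real m * real g) + C / (real g)\<^sup>2 \<le> (theta + C) / real g"
      by (simp add: add_divide_distrib)
    with C(2)[OF g] have "(1 + real (Suc p) / nu (g * m)) ^ m * (1 / nu (g * m)) \<le> (theta + C) / real g" by linarith
    hence "((1 + real (Suc p) / nu (g * m)) ^ m * (1 / nu (g * m))) * V (Suc p) g hs \<le> (theta + C) / real g * V (Suc p) g hs"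
      by (intro mult_right_mono V_nonneg)
    with W_iter(1)[OF c, of p] show ?thesis by simp
  qed
  thus ?thesis using C(1) theta_pos by (intro exI[of _ "theta + C"]) auto
qed

text \<open>The leading coefficient matters here because this term feeds the drift of
  \<open>R\<close>; for higher p the order of magnitude in \<open>W_upper\<close> is enough.\<close>

lemma W_one:
  "\<exists>C\<ge>0. \<forall>g hs. \<forall>i<m. complete g hs \<longrightarrow>
     \<bar>iter m (W 1 g i) hs - theta / (real m * real g) * V 2 g hs\<bar> \<le> C * V 2 g hs / (real g)\<^sup>2"
proof -
  obtain C where C: "C \<ge> 0" "\<And>g. g \<ge> 1 \<Longrightarrow> (1 + real (Suc 1) / nu (g * m)) ^ m * (1 / nu (g * m)) \<le> theta / (real m * real g) + C / (real g)\<^sup>2"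
    using growth_over_nu[of "Suc 1"] by blast
  have "\<bar>iter m (W 1 g i) hs - theta / (real m * real g) * V 2 g hs\<bar> \<le> (C + theta) * V 2 g hs / (real g)\<^sup>2"
    if c: "complete g hs" "i < m" for g hs i
  proof -
    have g: "g \<ge> 1" using c by (simp add: complete_def)
    let ?v = "V (Suc 1) g hs"
    have v: "?v \<ge> 0" by (rule V_nonneg)
    have "iter m (W 1 g i) hs \<le> (theta / (real m * real g) + C / (real g)\<^sup>2) * ?v"
      by (rule order.trans[OF W_iter(1)[OF c] mult_right_mono[OF C(2)[OF g] v]])
    moreover have "(theta / (real m * real g) - theta / (real g)\<^sup>2) * ?v \<le> iter m (W 1 g i) hs"
      by (rule order.trans[OF mult_right_mono[OF inverse_nu_ge[OF g] v] W_iter(2)[OF c]])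
    moreover have "C * ?v / (real g)\<^sup>2 \<ge> 0" "theta * ?v / (real g)\<^sup>2 \<ge> 0" using C v theta_pos by auto
    ultimately have "\<bar>iter m (W 1 g i) hs - theta / (real m * real g) * ?v\<bar> \<le> (C + theta) * ?v / (real g)\<^sup>2"
      by (simp add: abs_le_iff algebra_simps add_divide_distrib)
    thus ?thesis by (simp add: numeral_2_eq_2)
  qed
  thus ?thesis using C(1) theta_pos by (intro exI[of _ "C + theta"]) auto
qed

lemma sum_lessThan_add: "(\<Sum>k<a + n. f k) = (\<Sum>k<a. f k) + (\<Sum>i<n. (f (a + i) :: real))" for a n :: nat
  by (induction n) auto

text \<open>Old edges keep their ends and only the weights move; a new non-loop edge joins g + 1 to
  the vertex it hits.\<close>

lemma R_Suc:
  assumes c: "complete g hs" and us: "length us = m" and v: "valid (hs @ us)"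
  shows "R (Suc g) (hs @ us) =
     (\<Sum>k<g*m-1. of_bool (hs ! k \<noteq> grp m (k + 2)) * (gw (hs @ us) (hs ! k) * gw (hs @ us) (grp m (k + 2))))
     + (\<Sum>i<m. W 1 g i (hs @ us) * gw (hs @ us) (Suc g))"
proof -
  have c': "valid hs" "g \<ge> 1" "length hs = g * m - 1" using c by (auto simp: complete_def)
  have "Suc g * m - 1 = (g * m - 1) + m" using c'(2) m_pos by simp
  hence "R (Suc g) (hs @ us) =
     (\<Sum>k<g*m-1. of_bool ((hs @ us) ! k \<noteq> grp m (k + 2)) * (gw (hs @ us) ((hs @ us) ! k) * gw (hs @ us) (grp m (k + 2))))
   + (\<Sum>i<m. of_bool ((hs @ us) ! (g * m - 1 + i) \<noteq> grp m (g * m - 1 + i + 2))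
       * (gw (hs @ us) ((hs @ us) ! (g * m - 1 + i)) * gw (hs @ us) (grp m (g * m - 1 + i + 2))))"
    unfolding R_def by (simp only: sum_lessThan_add)
  also have "(\<Sum>k<g*m-1. of_bool ((hs @ us) ! k \<noteq> grp m (k + 2)) * (gw (hs @ us) ((hs @ us) ! k) * gw (hs @ us) (grp m (k + 2))))
    = (\<Sum>k<g*m-1. of_bool (hs ! k \<noteq> grp m (k + 2)) * (gw (hs @ us) (hs ! k) * gw (hs @ us) (grp m (k + 2))))"
    by (rule sum.cong) (use c'(3) in \<open>auto simp: nth_append\<close>)
  also have "(\<Sum>i<m. of_bool ((hs @ us) ! (g * m - 1 + i) \<noteq> grp m (g * m - 1 + i + 2))
       * (gw (hs @ us) ((hs @ us) ! (g * m - 1 + i)) * gw (hs @ us) (grp m (g * m - 1 + i + 2))))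
    = (\<Sum>i<m. W 1 g i (hs @ us) * gw (hs @ us) (Suc g))"
  proof (rule sum.cong)
    fix i assume "i \<in> {..<m}"
    hence i: "i < m" by simp
    have "(hs @ us) ! (g * m - 1 + i) = us ! i" using nth_append_length_plus[of hs us i] c'(3) by simp
    moreover have "grp m (g * m - 1 + i + 2) = Suc g"
    proof -
      have "g * m - 1 + i + 2 = g * m + i + 1" using c'(2) m_pos by simp
      thus ?thesis using grp_block[OF i, of g] by (simp only:)
    qed
    ultimately show "of_bool ((hs @ us) ! (g * m - 1 + i) \<noteq> grp m (g * m - 1 + i + 2))
       * (gw (hs @ us) ((hs @ us) ! (g * m - 1 + i)) * gw (hs @ us) (grp m (g * m - 1 + i + 2)))
      = W 1 g i (hs @ us) * gw (hs @ us) (Suc g)"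
      by (simp add: W_eq[OF c us v i])
  qed simp
  finally show ?thesis .
qed

text \<open>Loops and the weight w of the hit vertex are dependent. Truncating w at sqrt g separates
  them: below the level the loops have mean O(1/g), leaving g^(-1/2); above it there are at most m
  loops and w <= w(w+1)/sqrt g, which leads to \<open>V 3\<close>.\<close>

lemma hits_times_weight:
  assumes c: "complete g hs" and us: "length us = m" and v: "valid (hs @ us)" and i: "i < m"
  shows "new_hits g (hs @ us) * W 1 g i (hs @ us)
    \<le> sqrt (real g) * new_hits g (hs @ us) + real m / sqrt (real g) * W 2 g i (hs @ us)"
proof -
  define H where "H = new_hits g (hs @ us)"
  define w where "w = gw (hs @ us) (us ! i)"
  define s where "s = sqrt (real g)"
  have s: "s > 0" using c by (simp add: s_def complete_def)
  have H: "0 \<le> H" "H \<le> real m" unfolding H_def by (rule new_hits_bounds)+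
  have w: "w \<ge> 0" unfolding w_def by (rule gw_nonneg)
  have "H * w \<le> s * H + real m / s * (w * (w + 1))"
  proof (cases "w \<le> s")
    case True
    have "H * w \<le> s * H" using True H by (simp add: mult.commute mult_left_mono)
    moreover have "0 \<le> real m / s * (w * (w + 1))" using w s by simp
    ultimately show ?thesis by linarith
  next
    case False
    have "1 * w \<le> w / s * w" using False s w by (intro mult_right_mono) auto
    hence "w \<le> w * w / s" by simp
    also have "\<dots> \<le> w * (w + 1) / s" using s w by (intro divide_right_mono mult_left_mono) auto
    finally have "w \<le> w * (w + 1) / s" .
    hence "H * w \<le> real m * (w * (w + 1) / s)" using H w by (intro mult_mono) auto
    moreover have "s * H \<ge> 0" using s H by simp
    ultimately show ?thesis by simp
  qed
  moreover have "s * H \<ge> 0" using s H by simp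
  ultimately show ?thesis
    unfolding W_eq[OF c us v i] H_def[symmetric] w_def[symmetric] s_def[symmetric]
    by (cases "us ! i = Suc g") (auto simp: pochhammer_Suc numeral_2_eq_2 mult_ac)
qed

lemma R_old_drift:
  "\<exists>C\<ge>0. \<forall>g hs. complete g hs \<longrightarrow>
     \<bar>iter m (\<lambda>gs. \<Sum>k<g*m-1. of_bool (hs ! k \<noteq> grp m (k + 2)) * (gw gs (hs ! k) * gw gs (grp m (k + 2)))) hs
       - (1 + 2 * theta / real g) * R g hs\<bar> \<le> C * R g hs / (real g)\<^sup>2"
proof -
  obtain C1 where C1: "C1 \<ge> 0" "\<And>g. g \<ge> 1 \<Longrightarrow> (1 + 2 / nu (g * m)) ^ m \<le> 1 + 2 * theta / real g + C1 / (real g)\<^sup>2"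
    using growth_upper[of 2] by auto
  define C where "C = C1 + real m * 2 * theta"
  have "\<bar>iter m (\<lambda>gs. \<Sum>k<g*m-1. of_bool (hs ! k \<noteq> grp m (k + 2)) * (gw gs (hs ! k) * gw gs (grp m (k + 2)))) hs
       - (1 + 2 * theta / real g) * R g hs\<bar> \<le> C * R g hs / (real g)\<^sup>2" (is "\<bar>?I - _\<bar> \<le> _")
    if c: "complete g hs" for g hs
  proof -
    have c': "valid hs" "g \<ge> 1" "length hs = g * m - 1" using c by (auto simp: complete_def)
    have eq: "?I = (\<Sum>k<g*m-1. of_bool (hs ! k \<noteq> grp m (k + 2)) * iter m (\<lambda>gs. gw gs (hs ! k) * gw gs (grp m (k + 2))) hs)"
      by (simp only: iter_sum[OF c'(1)] iter_cmult)
    have "?I \<le> (\<Sum>k<g*m-1. of_bool (hs ! k \<noteq> grp m (k + 2)) * ((1 + 2 / nu (g * m)) ^ m * (gw hs (hs ! k) * gw hs (grp m (k + 2)))))"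
      unfolding eq
    proof (rule sum_mono)
      fix k assume "k \<in> {..<g*m-1}"
      hence "k < length hs" by (simp add: c'(3))
      from valid_block_old[OF c' this]
      show "of_bool (hs ! k \<noteq> grp m (k + 2)) * iter m (\<lambda>gs. gw gs (hs ! k) * gw gs (grp m (k + 2))) hs
        \<le> of_bool (hs ! k \<noteq> grp m (k + 2)) * ((1 + 2 / nu (g * m)) ^ m * (gw hs (hs ! k) * gw hs (grp m (k + 2))))"
        by (cases "hs ! k = grp m (k + 2)") (simp_all add: iter_gw_prod(1)[OF c'])
    qed
    also have "\<dots> = (1 + 2 / nu (g * m)) ^ m * R g hs"
      unfolding R_def sum_distrib_left by (intro sum.cong) (auto simp: mult_ac)
    also have "\<dots> \<le> (1 + 2 * theta / real g + C1 / (real g)\<^sup>2) * R g hs"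
      by (intro mult_right_mono C1 c' R_nonneg)
    finally have up: "?I \<le> (1 + 2 * theta / real g + C1 / (real g)\<^sup>2) * R g hs" .
    have "(1 + 2 * theta / real g - real m * 2 * theta / (real g)\<^sup>2) * R g hs \<le> (1 + 2 / nu (g * m + m)) ^ m * R g hs"
      using growth_lower[OF c'(2), of 2] by (intro mult_right_mono R_nonneg) simp
    also have "\<dots> = (\<Sum>k<g*m-1. of_bool (hs ! k \<noteq> grp m (k + 2)) * ((1 + 2 / nu (g * m + m)) ^ m * (gw hs (hs ! k) * gw hs (grp m (k + 2)))))"
      unfolding R_def sum_distrib_left by (intro sum.cong) (auto simp: mult_ac)
    also have "\<dots> \<le> ?I"
      unfolding eq
    proof (rule sum_mono)
      fix k assume "k \<in> {..<g*m-1}"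
      hence "k < length hs" by (simp add: c'(3))
      from valid_block_old[OF c' this]
      show "of_bool (hs ! k \<noteq> grp m (k + 2)) * iter m (\<lambda>gs. gw gs (hs ! k) * gw gs (grp m (k + 2))) hs
        \<ge> of_bool (hs ! k \<noteq> grp m (k + 2)) * ((1 + 2 / nu (g * m + m)) ^ m * (gw hs (hs ! k) * gw hs (grp m (k + 2))))"
        by (cases "hs ! k = grp m (k + 2)") (simp_all add: iter_gw_prod(2)[OF c'])
    qed
    finally have lo: "(1 + 2 * theta / real g - real m * 2 * theta / (real g)\<^sup>2) * R g hs \<le> ?I" .
    have "C1 * R g hs / (real g)\<^sup>2 \<ge> 0" "real m * 2 * theta * R g hs / (real g)\<^sup>2 \<ge> 0"
      using C1 theta_pos R_nonneg by simp_all
    thus ?thesis using lo up by (simp add: C_def abs_le_iff algebra_simps add_divide_distrib)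
  qed
  moreover have "C \<ge> 0" using C1 theta_pos by (simp add: C_def)
  ultimately show ?thesis by blast
qed

lemma R_new_drift:
  "\<exists>C\<ge>0. \<forall>g hs. complete g hs \<longrightarrow>
     \<bar>iter m (\<lambda>gs. \<Sum>i<m. W 1 g i gs * gw gs (Suc g)) hs - real m * (1 + \<beta>) * theta / real g * V 2 g hs\<bar>
       \<le> C * (V 2 g hs / (real g)\<^sup>2 + 1 / sqrt (real g) + V 3 g hs / (real g * sqrt (real g)))"
proof -
  obtain C1 where C1: "C1 \<ge> 0" "\<And>g hs i. i < m \<Longrightarrow> complete g hs \<Longrightarrow>
     \<bar>iter m (W 1 g i) hs - theta / (real m * real g) * V 2 g hs\<bar> \<le> C1 * V 2 g hs / (real g)\<^sup>2"
    using W_one by blast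
  obtain C2 where C2: "C2 \<ge> 0" "\<And>g hs i. i < m \<Longrightarrow> complete g hs \<Longrightarrow> iter m (W 2 g i) hs \<le> C2 * V (Suc 2) g hs / real g"
    using W_upper[of 2] by blast
  obtain C3 where C3: "C3 \<ge> 0" "\<And>g hs. complete g hs \<Longrightarrow> iter m (new_hits g) hs \<le> C3 / real g"
    using iter_new_hits by blast
  define A where "A = real m * (1 + \<beta>)"
  have A: "A \<ge> 0" using beta_pos by (simp add: A_def)
  define C where "C = real m * (A * C1 + C3 + real m * C2)"
  have "\<bar>iter m (\<lambda>gs. \<Sum>i<m. W 1 g i gs * gw gs (Suc g)) hs - real m * (1 + \<beta>) * theta / real g * V 2 g hs\<bar>
       \<le> C * (V 2 g hs / (real g)\<^sup>2 + 1 / sqrt (real g) + V 3 g hs / (real g * sqrt (real g)))"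
    if c: "complete g hs" for g hs
  proof -
    have c': "valid hs" "g \<ge> 1" "length hs = g * m - 1" using c by (auto simp: complete_def)
    define s where "s = sqrt (real g)"
    have s: "s > 0" "s * s = real g" using c'(2) by (auto simp: s_def)
    define E where "E = V 2 g hs / (real g)\<^sup>2"
    define F where "F = V 3 g hs / (real g * s)"
    have EF: "E \<ge> 0" "F \<ge> 0" "1 / s \<ge> 0" using s V_nonneg by (auto simp: E_def F_def)
    \<comment> \<open>Leading mean weight of the vertex hit by a single edge. Multiplied by m edges
      and by the loop-free new weight \<open>A\<close>, it gives the coefficient of
      \<open>V 2\<close> in the statement.\<close>
    let ?t = "theta / (real m * real g) * V 2 g hs"
    have each: "\<bar>iter m (\<lambda>gs. W 1 g i gs * gw gs (Suc g)) hs - A * ?t\<bar> \<le> (A * C1) * E + C3 * (1 / s) + (real m * C2) * F"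
      if i: "i < m" for i
    proof -
      \<comment> \<open>Loops only increase the weight of the new vertex, so ignoring them gives a
        lower bound.\<close>
      have "A * iter m (W 1 g i) hs = iter m (\<lambda>gs. A * W 1 g i gs) hs" by (rule iter_cmult[symmetric])
      also have "\<dots> \<le> iter m (\<lambda>gs. W 1 g i gs * gw gs (Suc g)) hs"
      proof (rule iter_mono[OF c'(1)])
        fix us :: "nat list" assume us: "length us = m"
        have "A \<le> gw (hs @ us) (Suc g)" unfolding gw_new_eq[OF c us] A_def using new_hits_bounds(1) by simp
        thus "A * W 1 g i (hs @ us) \<le> W 1 g i (hs @ us) * gw (hs @ us) (Suc g)"
          using W_nonneg[of 1 g i "hs @ us"] by (subst mult.commute) (rule mult_left_mono)
      qed
      finally have lo: "A * iter m (W 1 g i) hs \<le> iter m (\<lambda>gs. W 1 g i gs * gw gs (Suc g)) hs" .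
      have "iter m (\<lambda>gs. W 1 g i gs * gw gs (Suc g)) hs
         \<le> iter m (\<lambda>gs. A * W 1 g i gs + (s * new_hits g gs + real m / s * W 2 g i gs)) hs"
      proof (rule iter_mono[OF c'(1)])
        fix us :: "nat list" assume us: "length us = m" "valid (hs @ us)"
        show "W 1 g i (hs @ us) * gw (hs @ us) (Suc g)
          \<le> A * W 1 g i (hs @ us) + (s * new_hits g (hs @ us) + real m / s * W 2 g i (hs @ us))"
          unfolding gw_new_eq[OF c us(1)] A_def[symmetric]
          using hits_times_weight[OF c us i] by (simp add: s_def algebra_simps)
      qed
      also have "\<dots> = A * iter m (W 1 g i) hs + (s * iter m (new_hits g) hs + real m / s * iter m (W 2 g i) hs)"
        by (simp only: iter_add iter_cmult)
      also have "s * iter m (new_hits g) hs \<le> s * (C3 / real g)" using s by (intro mult_left_mono C3 c) auto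
      also have "s * (C3 / real g) = C3 * (1 / s)" using s by (simp add: s(2)[symmetric])
      also have "real m / s * iter m (W 2 g i) hs \<le> real m / s * (C2 * V (Suc 2) g hs / real g)"
        using s by (intro mult_left_mono C2 c i) auto
      also have "\<dots> = (real m * C2) * F" by (simp add: F_def mult_ac)
      finally have up: "iter m (\<lambda>gs. W 1 g i gs * gw gs (Suc g)) hs \<le> A * iter m (W 1 g i) hs + (C3 * (1 / s) + (real m * C2) * F)"
        by simp
      have "\<bar>A * iter m (W 1 g i) hs - A * ?t\<bar> = A * \<bar>iter m (W 1 g i) hs - ?t\<bar>"
        using A by (simp only: right_diff_distrib[symmetric] abs_mult abs_of_nonneg)
      also have "\<dots> \<le> A * (C1 * V 2 g hs / (real g)\<^sup>2)" by (intro mult_left_mono C1 i c A)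
      also have "\<dots> = (A * C1) * E" by (simp add: E_def)
      finally have "\<bar>A * iter m (W 1 g i) hs - A * ?t\<bar> \<le> (A * C1) * E" .
      moreover have "C3 * (1 / s) \<ge> 0" "(real m * C2) * F \<ge> 0"
        using C3 C2 EF by (auto intro!: mult_nonneg_nonneg)
      ultimately show ?thesis using lo up by linarith
    qed
    have "\<bar>iter m (\<lambda>gs. \<Sum>i<m. W 1 g i gs * gw gs (Suc g)) hs - real m * (A * ?t)\<bar>
      = \<bar>\<Sum>i<m. iter m (\<lambda>gs. W 1 g i gs * gw gs (Suc g)) hs - A * ?t\<bar>"
      by (simp add: iter_sum[OF c'(1)] sum_subtractf)
    also have "\<dots> \<le> (\<Sum>i<m. (A * C1) * E + C3 * (1 / s) + (real m * C2) * F)"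
      by (rule order.trans[OF sum_abs]) (intro sum_mono each, simp)
    also have "\<dots> = real m * ((A * C1) * E + C3 * (1 / s) + (real m * C2) * F)" by simp
    also have "\<dots> \<le> real m * ((A * C1 + C3 + real m * C2) * E + (A * C1 + C3 + real m * C2) * (1 / s) + (A * C1 + C3 + real m * C2) * F)"
      using EF A C1 C2 C3 by (intro mult_left_mono add_mono mult_right_mono) auto
    also have "\<dots> = C * (E + 1 / s + F)" by (simp add: C_def distrib_left mult_ac)
    finally have "\<bar>iter m (\<lambda>gs. \<Sum>i<m. W 1 g i gs * gw gs (Suc g)) hs - real m * (A * ?t)\<bar> \<le> C * (E + 1 / s + F)" .
    moreover have "real m * (A * ?t) = real m * (1 + \<beta>) * theta / real g * V 2 g hs"
      using m_pos by (simp add: A_def)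
    ultimately show ?thesis by (simp add: E_def F_def s_def)
  qed
  moreover have "C \<ge> 0" using A C1 C2 C3 by (simp add: C_def)
  ultimately show ?thesis by blast
qed

lemma R_drift:
  "\<exists>C\<ge>0. \<forall>g hs. complete g hs \<longrightarrow>
     \<bar>iter m (R (Suc g)) hs - (1 + 2 * theta / real g) * R g hs - real m * (1 + \<beta>) * theta / real g * V 2 g hs\<bar>
       \<le> C * (R g hs / (real g)\<^sup>2 + V 2 g hs / (real g)\<^sup>2 + 1 / sqrt (real g) + V 3 g hs / (real g * sqrt (real g)))"
proof -
  obtain C1 where C1: "C1 \<ge> 0" "\<And>g hs. complete g hs \<Longrightarrow>
     \<bar>iter m (\<lambda>gs. \<Sum>k<g*m-1. of_bool (hs ! k \<noteq> grp m (k + 2)) * (gw gs (hs ! k) * gw gs (grp m (k + 2)))) hs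
       - (1 + 2 * theta / real g) * R g hs\<bar> \<le> C1 * R g hs / (real g)\<^sup>2"
    using R_old_drift by blast
  obtain C2 where C2: "C2 \<ge> 0" "\<And>g hs. complete g hs \<Longrightarrow>
     \<bar>iter m (\<lambda>gs. \<Sum>i<m. W 1 g i gs * gw gs (Suc g)) hs - real m * (1 + \<beta>) * theta / real g * V 2 g hs\<bar>
       \<le> C2 * (V 2 g hs / (real g)\<^sup>2 + 1 / sqrt (real g) + V 3 g hs / (real g * sqrt (real g)))"
    using R_new_drift by blast
  have "\<bar>iter m (R (Suc g)) hs - (1 + 2 * theta / real g) * R g hs - real m * (1 + \<beta>) * theta / real g * V 2 g hs\<bar>
       \<le> (C1 + C2) * (R g hs / (real g)\<^sup>2 + V 2 g hs / (real g)\<^sup>2 + 1 / sqrt (real g) + V 3 g hs / (real g * sqrt (real g)))"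
    if c: "complete g hs" for g hs
  proof -
    have c': "valid hs" "g \<ge> 1" "length hs = g * m - 1" using c by (auto simp: complete_def)
    let ?O = "iter m (\<lambda>gs. \<Sum>k<g*m-1. of_bool (hs ! k \<noteq> grp m (k + 2)) * (gw gs (hs ! k) * gw gs (grp m (k + 2)))) hs"
    let ?N = "iter m (\<lambda>gs. \<Sum>i<m. W 1 g i gs * gw gs (Suc g)) hs"
    have eq: "iter m (R (Suc g)) hs = ?O + ?N"
      unfolding iter_add[symmetric] by (rule iter_cong[OF c'(1)]) (rule R_Suc[OF c])
    define a where "a = R g hs / (real g)\<^sup>2"
    define b where "b = V 2 g hs / (real g)\<^sup>2 + 1 / sqrt (real g) + V 3 g hs / (real g * sqrt (real g))"
    have ab: "a \<ge> 0" "b \<ge> 0" unfolding a_def b_def using R_nonneg V_nonneg by (auto intro!: add_nonneg_nonneg)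
    have "\<bar>?O - (1 + 2 * theta / real g) * R g hs\<bar> \<le> C1 * a" using C1(2)[OF c] by (simp add: a_def)
    moreover have "\<bar>?N - real m * (1 + \<beta>) * theta / real g * V 2 g hs\<bar> \<le> C2 * b" using C2(2)[OF c] by (simp add: b_def)
    moreover have "C1 * a \<le> (C1 + C2) * a" "C2 * b \<le> (C1 + C2) * b"
      using ab C1(1) C2(1) by (intro mult_right_mono; simp)+
    ultimately have "\<bar>iter m (R (Suc g)) hs - (1 + 2 * theta / real g) * R g hs - real m * (1 + \<beta>) * theta / real g * V 2 g hs\<bar>
       \<le> (C1 + C2) * a + (C1 + C2) * b" unfolding eq by linarith
    also have "\<dots> = (C1 + C2) * (a + b)" by (simp add: distrib_left)
    finally show ?thesis unfolding a_def b_def by (simp only: add.assoc)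
  qed
  thus ?thesis using C1(1) C2(1) by (intro exI[of _ "C1 + C2"]) auto
qed

section \<open>Drift of the even moments of the deviation\<close>

text \<open>Slope of the linear solution of the limiting recursion for \<open>V 2\<close>, that is,
  the fixed point in \<open>lam_eq\<close>.\<close>

definition lam :: real where
  "lam = mu / (1 - 2 * theta)"

definition Y :: "nat \<Rightarrow> nat list \<Rightarrow> real" where
  "Y g gs = V 2 g gs - lam * real g"

lemma lam_eq: "2 * theta * lam + mu = lam"
  using theta_less by (simp add: lam_def field_simps)

lemma mu_nonneg: "mu \<ge> 0"
  unfolding mu_def using beta_pos by (intro pochhammer_nonneg') auto

lemma lam_nonneg: "lam \<ge> 0"
  using mu_nonneg theta_less by (simp add: lam_def)

text \<open>Subtracting lam g cancels the inflow \<open>mu\<close>, so to leading order the drift of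
  the deviation is proportional to the deviation itself.\<close>

lemma Y_increment_mean:
  "\<exists>C\<ge>0. \<forall>g hs. complete g hs \<longrightarrow>
     \<bar>iter m (\<lambda>gs. Y (Suc g) gs - Y g hs) hs - 2 * theta / real g * Y g hs\<bar> \<le> C * (\<bar>Y g hs\<bar> / (real g)\<^sup>2 + 1 / real g)"
proof -
  obtain C where C: "C \<ge> 0" "\<And>g hs. complete g hs \<Longrightarrow>
     \<bar>iter m (V 2 (Suc g)) hs - (1 + 2 * theta / real g) * V 2 g hs - mu\<bar> \<le> C * (V 2 g hs / (real g)\<^sup>2 + 1 / real g)"
    using V2_drift by blast
  have "\<bar>iter m (\<lambda>gs. Y (Suc g) gs - Y g hs) hs - 2 * theta / real g * Y g hs\<bar>
     \<le> (C * (lam + 1)) * (\<bar>Y g hs\<bar> / (real g)\<^sup>2 + 1 / real g)" if c: "complete g hs" for g hs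
  proof -
    have g: "real g > 0" and v: "valid hs" using c by (auto simp: complete_def)
    have "iter m (\<lambda>gs. Y (Suc g) gs - Y g hs) hs = iter m (V 2 (Suc g)) hs - lam * real (Suc g) - Y g hs"
      unfolding Y_def by (simp only: iter_diff iter_const[OF v])
    also have "\<dots> - 2 * theta / real g * Y g hs
      = iter m (V 2 (Suc g)) hs - (1 + 2 * theta / real g) * V 2 g hs - (lam - 2 * theta * lam)"
      using g by (simp add: Y_def field_simps)
    also have "lam - 2 * theta * lam = mu" using lam_eq by linarith
    also have "\<bar>iter m (V 2 (Suc g)) hs - (1 + 2 * theta / real g) * V 2 g hs - mu\<bar> \<le> C * (V 2 g hs / (real g)\<^sup>2 + 1 / real g)"
      by (rule C(2)[OF c])
    also have "\<dots> \<le> C * ((\<bar>Y g hs\<bar> + lam * real g) / (real g)\<^sup>2 + 1 / real g)"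
      using C(1) g by (intro mult_left_mono add_right_mono divide_right_mono) (auto simp: Y_def)
    also have "\<dots> = C * (\<bar>Y g hs\<bar> / (real g)\<^sup>2 + (lam + 1) * (1 / real g))"
      using g by (simp add: power2_eq_square add_divide_distrib)
    also have "\<dots> \<le> C * ((lam + 1) * (\<bar>Y g hs\<bar> / (real g)\<^sup>2) + (lam + 1) * (1 / real g))"
      using lam_nonneg C(1) g by (intro mult_left_mono add_right_mono) (auto simp: mult_le_cancel_right1 divide_right_mono)
    finally show ?thesis by (simp only: distrib_left[symmetric] mult.assoc)
  qed
  thus ?thesis using C(1) lam_nonneg by (intro exI[of _ "C * (lam + 1)"]) auto
qed

lemma Y_increment_bound:
  "\<exists>D\<ge>0. \<forall>g hs us. complete g hs \<longrightarrow> length us = m \<longrightarrow> valid (hs @ us) \<longrightarrow>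
     \<bar>Y (Suc g) (hs @ us) - Y g hs\<bar> \<le> (\<Sum>i<m. 2 * W 1 g i (hs @ us)) + D"
proof -
  define D0 where "D0 = pochhammer ((2 + \<beta>) * real m) 2"
  have "\<bar>Y (Suc g) (hs @ us) - Y g hs\<bar> \<le> (\<Sum>i<m. 2 * W 1 g i (hs @ us)) + (real m + D0 + lam)"
    if c: "complete g hs" and us: "length us = m" "valid (hs @ us)" for g hs us
  proof -
    have c': "valid hs" "g \<ge> 1" "length hs = g * m - 1" using c by (auto simp: complete_def)
    define h where "h x = (\<Sum>i<m. of_bool (us ! i = x) :: real)" for x
    have h0: "h x \<ge> 0" for x unfolding h_def by (intro sum_nonneg) auto
    have gw: "gw (hs @ us) x = gw hs x + h x" if "x \<in> {1..g}" for x
      using gw_block_old[OF c', of x us] that us by (simp add: h_def)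
    \<comment> \<open>If h hits raise w to w + h, then w(w+1) grows by h(2(w+h) + 1 - h). In terms
      of the final weight, each hit can be charged at most twice that weight plus 1.\<close>
    have old: "(\<Sum>x=1..g. pochhammer (gw (hs @ us) x) 2) - V 2 g hs = (\<Sum>x=1..g. h x * (2 * gw (hs @ us) x + 1 - h x))"
      unfolding V_def sum_subtractf[symmetric]
      by (intro sum.cong refl) (simp add: gw pochhammer_Suc numeral_2_eq_2 algebra_simps)
    have nn: "h x * (2 * gw (hs @ us) x + 1 - h x) \<ge> 0" if "x \<in> {1..g}" for x
      using h0[of x] gw_nonneg[of hs x] unfolding gw[OF that] by (intro mult_nonneg_nonneg) auto
    have "(\<Sum>x=1..g. h x * (2 * gw (hs @ us) x + 1 - h x)) \<le> (\<Sum>x=1..g. h x * (2 * gw (hs @ us) x + 1))"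
      using h0 by (intro sum_mono mult_left_mono) auto
    also have "\<dots> = (\<Sum>i<m. \<Sum>x=1..g. of_bool (us ! i = x) * (2 * gw (hs @ us) x + 1))"
      unfolding h_def sum_distrib_right by (rule sum.swap)
    also have "\<dots> \<le> (\<Sum>i<m. 2 * W 1 g i (hs @ us) + 1)"
    proof (rule sum_mono)
      fix i assume "i \<in> {..<m}"
      hence i: "i < m" by simp
      have u: "1 \<le> us ! i" "us ! i \<le> Suc g" using valid_block_le[OF c', of us i] us i by auto
      have "(\<Sum>x=1..g. of_bool (us ! i = x) * (2 * gw (hs @ us) x + 1))
         = (\<Sum>x=1..g. if us ! i = x then 2 * gw (hs @ us) x + 1 else 0)" by (intro sum.cong) auto
      also have "\<dots> \<le> 2 * W 1 g i (hs @ us) + 1"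
        using u by (simp add: W_eq[OF c us i])
      finally show "(\<Sum>x=1..g. of_bool (us ! i = x) * (2 * gw (hs @ us) x + 1)) \<le> 2 * W 1 g i (hs @ us) + 1" .
    qed
    also have "\<dots> = (\<Sum>i<m. 2 * W 1 g i (hs @ us)) + real m" by (simp add: sum.distrib)
    finally have up: "(\<Sum>x=1..g. pochhammer (gw (hs @ us) x) 2) - V 2 g hs \<le> (\<Sum>i<m. 2 * W 1 g i (hs @ us)) + real m"
      unfolding old .
    have lo: "(\<Sum>x=1..g. pochhammer (gw (hs @ us) x) 2) - V 2 g hs \<ge> 0"
      unfolding old by (rule sum_nonneg) (rule nn)
    have new: "0 \<le> pochhammer (gw (hs @ us) (Suc g)) 2" "pochhammer (gw (hs @ us) (Suc g)) 2 \<le> D0"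
      unfolding D0_def
      by (rule pochhammer_nonneg'[OF gw_nonneg])
        (rule pochhammer_mono[OF gw_nonneg gw_block_new_le[OF c' eq_imp_le[OF us(1)]]])
    have "Y (Suc g) (hs @ us) - Y g hs = ((\<Sum>x=1..g. pochhammer (gw (hs @ us) x) 2) - V 2 g hs)
        + pochhammer (gw (hs @ us) (Suc g)) 2 - lam"
      by (simp add: Y_def V_def algebra_simps)
    moreover have "(\<Sum>i<m. 2 * W 1 g i (hs @ us)) \<ge> 0" by (intro sum_nonneg) (simp add: W_nonneg)
    ultimately show ?thesis using up lo new lam_nonneg by linarith
  qed
  moreover have "real m + D0 + lam \<ge> 0"
    using lam_nonneg beta_pos by (auto simp: D0_def intro!: add_nonneg_nonneg pochhammer_nonneg')
  ultimately show ?thesis by blast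
qed

lemma power_le_pochhammer: "w \<ge> 0 \<Longrightarrow> w ^ p \<le> pochhammer (w::real) p"
proof (induction p)
  case (Suc p)
  have "w * w ^ p \<le> (w + real p) * pochhammer w p"
    using Suc by (intro mult_mono) auto
  thus ?case by (simp add: pochhammer_Suc mult.commute)
qed simp

text \<open>The increment is controlled by the weights of the hit vertices; averaging their 2k-th
  powers with \<open>W_upper\<close> adds one more weight factor from the hit probability, hence the
  index 2k + 1.\<close>

lemma Y_increment_moment:
  assumes "k \<ge> 1"
  shows "\<exists>C\<ge>0. \<forall>g hs. complete g hs \<longrightarrow>
     iter m (\<lambda>gs. (Y (Suc g) gs - Y g hs) ^ (2 * k)) hs \<le> C * (V (2 * k + 1) g hs / real g + 1)"
proof -
  obtain D where D: "D \<ge> 0" "\<And>g hs us. complete g hs \<Longrightarrow> length us = m \<Longrightarrow> valid (hs @ us) \<Longrightarrow>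
     \<bar>Y (Suc g) (hs @ us) - Y g hs\<bar> \<le> (\<Sum>i<m. 2 * W 1 g i (hs @ us)) + D" using Y_increment_bound by blast
  obtain C2 where C2: "C2 \<ge> 0" "\<And>g hs i. i < m \<Longrightarrow> complete g hs \<Longrightarrow> iter m (W (2 * k) g i) hs \<le> C2 * V (Suc (2 * k)) g hs / real g"
    using W_upper[of "2 * k"] by blast
  define Q where "Q = real (Suc m) ^ (2 * k)"
  have Q: "Q \<ge> 0" by (simp add: Q_def)
  define C where "C = Q * (4 ^ k * real m * C2) + Q * D ^ (2 * k)"
  have "iter m (\<lambda>gs. (Y (Suc g) gs - Y g hs) ^ (2 * k)) hs \<le> C * (V (2 * k + 1) g hs / real g + 1)"
    if c: "complete g hs" for g hs
  proof -
    have c': "valid hs" "g \<ge> 1" "length hs = g * m - 1" using c by (auto simp: complete_def)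
    have "iter m (\<lambda>gs. (Y (Suc g) gs - Y g hs) ^ (2 * k)) hs
       \<le> iter m (\<lambda>gs. Q * (4 ^ k * (\<Sum>i<m. W (2 * k) g i gs) + D ^ (2 * k))) hs"
    proof (rule iter_mono[OF c'(1)])
      fix us assume us: "length us = m" "valid (hs @ us)"
      \<comment> \<open>The m hits and the constant \<open>D\<close> form m + 1 summands, which is
        where \<open>Q\<close> comes from.\<close>
      define a where "a i = (if i < m then 2 * W 1 g i (hs @ us) else D)" for i
      have a0: "a i \<ge> 0" for i using D W_nonneg by (simp add: a_def)
      have "(Y (Suc g) (hs @ us) - Y g hs) ^ (2 * k) = \<bar>Y (Suc g) (hs @ us) - Y g hs\<bar> ^ (2 * k)"
        by (simp add: power_even_abs)
      also have "\<dots> \<le> (\<Sum>i<Suc m. a i) ^ (2 * k)"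
        using D(2)[OF c us] by (intro power_mono) (auto simp: a_def)
      also have "\<dots> \<le> Q * (\<Sum>i<Suc m. a i ^ (2 * k))"
        unfolding Q_def by (rule power_sum_le) (use a0 in auto)
      also have "(\<Sum>i<Suc m. a i ^ (2 * k)) = (\<Sum>i<m. 4 ^ k * W 1 g i (hs @ us) ^ (2 * k)) + D ^ (2 * k)"
        by (simp add: a_def power_mult_distrib power_mult)
      also have "(\<Sum>i<m. 4 ^ k * W 1 g i (hs @ us) ^ (2 * k)) \<le> (\<Sum>i<m. 4 ^ k * W (2 * k) g i (hs @ us))"
      proof (intro sum_mono mult_left_mono)
        fix i assume "i \<in> {..<m}"
        hence i: "i < m" by simp
        show "W 1 g i (hs @ us) ^ (2 * k) \<le> W (2 * k) g i (hs @ us)"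
          unfolding W_eq[OF c us i] using power_le_pochhammer[OF gw_nonneg, of "hs @ us" "us ! i" "2 * k"] assms
          by (cases "us ! i = Suc g") (auto simp: power_0_left)
      qed auto
      finally show "(Y (Suc g) (hs @ us) - Y g hs) ^ (2 * k)
         \<le> Q * (4 ^ k * (\<Sum>i<m. W (2 * k) g i (hs @ us)) + D ^ (2 * k))"
        using Q by (simp add: sum_distrib_left mult_left_mono)
    qed
    also have "\<dots> = Q * (4 ^ k * (\<Sum>i<m. iter m (W (2 * k) g i) hs) + D ^ (2 * k))"
      by (simp only: iter_cmult iter_add iter_const[OF c'(1)] iter_sum[OF c'(1)])
    also have "\<dots> \<le> Q * (4 ^ k * (\<Sum>i<m. C2 * V (Suc (2 * k)) g hs / real g) + D ^ (2 * k))"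
      using Q C2(2)[OF _ c] by (intro mult_left_mono add_right_mono sum_mono) auto
    also have "\<dots> = Q * (4 ^ k * real m * C2) * (V (2 * k + 1) g hs / real g) + Q * D ^ (2 * k) * 1"
      by (simp add: algebra_simps)
    also have "\<dots> \<le> C * (V (2 * k + 1) g hs / real g) + C * 1"
      using Q C2(1) D(1) V_nonneg[of "2 * k + 1" g hs] by (intro add_mono mult_right_mono) (auto simp: C_def)
    finally show ?thesis by (simp add: distrib_left)
  qed
  moreover have "C \<ge> 0" using Q C2(1) D(1) by (simp add: C_def)
  ultimately show ?thesis by blast
qed

text \<open>Expand around the old deviation. The drift in the linear term gives 4 k theta/g;
  absorbing the quadratic term and the bias of the mean adds 1/(2g) each. The resulting extra 1 is
  independent of k, so it is negligible for the high moments.\<close>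

lemma Y_moment_drift:
  assumes k: "k \<ge> 1"
  shows "\<exists>C\<ge>0. \<forall>g hs. complete g hs \<longrightarrow>
     iter m (\<lambda>gs. Y (Suc g) gs ^ (2 * k)) hs
       \<le> (1 + (4 * real k * theta + 1) / real g + C / (real g)\<^sup>2) * Y g hs ^ (2 * k)
         + C * (real g ^ (k - 1) * (V (2 * k + 1) g hs / real g + 1))"
proof -
  obtain C1 where C1: "C1 \<ge> 0" "\<And>g hs. complete g hs \<Longrightarrow>
     \<bar>iter m (\<lambda>gs. Y (Suc g) gs - Y g hs) hs - 2 * theta / real g * Y g hs\<bar> \<le> C1 * (\<bar>Y g hs\<bar> / (real g)\<^sup>2 + 1 / real g)"
    using Y_increment_mean by blast
  obtain C2 where C2: "C2 \<ge> 0" "\<And>g hs. complete g hs \<Longrightarrow>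
     iter m (\<lambda>gs. (Y (Suc g) gs - Y g hs) ^ (2 * k)) hs \<le> C2 * (V (2 * k + 1) g hs / real g + 1)"
    using Y_increment_moment[OF k] by blast
  \<comment> \<open>Chosen such that 4^k e = 1/2, with 4^k from
    \<open>even_power_add_le\<close>.\<close>
  define e :: real where "e = 1 / (2 * 4 ^ k)"
  have e: "e > 0" by (simp add: e_def)
  \<comment> \<open>\<open>D\<close> and \<open>M\<close> come from applying
    \<open>young_odd\<close> to the bias; \<open>C5\<close> collects the coefficients of z^(2k),
    whose factor t^(k-1) is kept apart as \<open>G\<close>.\<close>
  define D where "D = 2 * real k * C1"
  define M where "M = D * (2 * D) ^ (2 * k - 1)"
  define C5 where "C5 = 4 ^ k * ((1 / e) ^ (k - 1) + 1)"
  have D: "D \<ge> 0" "M \<ge> 0" "C5 \<ge> 0" using C1 e by (auto simp: D_def M_def C5_def)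
  define C where "C = D + M + C5 * C2"
  have "iter m (\<lambda>gs. Y (Suc g) gs ^ (2 * k)) hs
       \<le> (1 + (4 * real k * theta + 1) / real g + C / (real g)\<^sup>2) * Y g hs ^ (2 * k)
         + C * (real g ^ (k - 1) * (V (2 * k + 1) g hs / real g + 1))"
    if c: "complete g hs" for g hs
  proof -
    have c': "valid hs" "g \<ge> 1" "length hs = g * m - 1" using c by (auto simp: complete_def)
    have g: "real g \<ge> 1" using c' by simp
    define y where "y = Y g hs"
    define t where "t = real g"
    define G where "G = t ^ (k - 1)"
    define Z where "Z = V (2 * k + 1) g hs / t + 1"
    have t: "t \<ge> 1" using g by (simp add: t_def)
    have G: "G \<ge> 1" using t by (simp add: G_def)
    have Z: "Z \<ge> 1" using t V_nonneg by (simp add: Z_def)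
    have y2: "y ^ (2 * k) \<ge> 0" by (simp add: power_mult)
    have odd: "y ^ (2 * k - 1) * y = y ^ (2 * k)" "\<bar>y\<bar> ^ (2 * k - 1) * \<bar>y\<bar> = y ^ (2 * k)"
      using power_minus_mult[of "2 * k" y] power_minus_mult[of "2 * k" "\<bar>y\<bar>"] k by (auto simp: power_even_abs)
    have "iter m (\<lambda>gs. Y (Suc g) gs ^ (2 * k)) hs \<le> iter m (\<lambda>gs. (y ^ (2 * k) + y ^ (2 * k) / (2 * t))
        + ((2 * real k * y ^ (2 * k - 1)) * (Y (Suc g) gs - y) + (C5 * G) * (Y (Suc g) gs - y) ^ (2 * k))) hs"
    proof (rule iter_mono[OF c'(1)])
      fix us
      define z where "z = Y (Suc g) (hs @ us) - y"
      have z2: "z ^ (2 * k) \<ge> 0" by (simp add: power_mult)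
      have "Y (Suc g) (hs @ us) ^ (2 * k) = (y + z) ^ (2 * k)" by (simp add: z_def)
      also have "\<dots> \<le> y ^ (2 * k) + 2 * real k * y ^ (2 * k - 1) * z + 4 ^ k * (y ^ (2 * k - 2) * z\<^sup>2 + z ^ (2 * k))"
        by (rule even_power_add_le[OF k])
      also have "4 ^ k * (y ^ (2 * k - 2) * z\<^sup>2 + z ^ (2 * k))
         \<le> 4 ^ k * ((e * y ^ (2 * k) / t + (t / e) ^ (k - 1) * z ^ (2 * k)) + G * z ^ (2 * k))"
        using young_square[OF e _ k, of t y z] t mult_right_mono[OF G z2] by (intro mult_left_mono add_mono) auto
      also have "\<dots> = y ^ (2 * k) / (2 * t) + (C5 * G) * z ^ (2 * k)"
      proof -
        have "4 ^ k * (e * y ^ (2 * k) / t) = y ^ (2 * k) / (2 * t)" by (simp add: e_def)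
        moreover have "(t / e) ^ (k - 1) = G * (1 / e) ^ (k - 1)" by (simp add: G_def power_divide)
        ultimately show ?thesis by (simp add: C5_def algebra_simps)
      qed
      finally show "Y (Suc g) (hs @ us) ^ (2 * k) \<le> (y ^ (2 * k) + y ^ (2 * k) / (2 * t))
        + ((2 * real k * y ^ (2 * k - 1)) * (Y (Suc g) (hs @ us) - y) + (C5 * G) * (Y (Suc g) (hs @ us) - y) ^ (2 * k))"
        unfolding z_def by linarith
    qed
    also have "\<dots> = (y ^ (2 * k) + y ^ (2 * k) / (2 * t))
        + ((2 * real k * y ^ (2 * k - 1)) * iter m (\<lambda>gs. Y (Suc g) gs - y) hs + (C5 * G) * iter m (\<lambda>gs. (Y (Suc g) gs - y) ^ (2 * k)) hs)"
      by (simp only: iter_add iter_cmult iter_const[OF c'(1)])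
    also have "(2 * real k * y ^ (2 * k - 1)) * iter m (\<lambda>gs. Y (Suc g) gs - y) hs
       \<le> 4 * real k * theta * y ^ (2 * k) / t + (D * y ^ (2 * k) / t\<^sup>2 + (y ^ (2 * k) / 2 + M) / t)"
    proof -
      define E where "E = iter m (\<lambda>gs. Y (Suc g) gs - y) hs - 2 * theta / t * y"
      have E: "\<bar>E\<bar> \<le> C1 * (\<bar>y\<bar> / t\<^sup>2 + 1 / t)" using C1(2)[OF c] by (simp add: E_def y_def t_def)
      have "(2 * real k * y ^ (2 * k - 1)) * iter m (\<lambda>gs. Y (Suc g) gs - y) hs
         = (2 * real k * y ^ (2 * k - 1)) * (2 * theta / t * y) + (2 * real k * y ^ (2 * k - 1)) * E"
        by (simp add: E_def algebra_simps)
      also have "(2 * real k * y ^ (2 * k - 1)) * (2 * theta / t * y) = 4 * real k * theta * (y ^ (2 * k - 1) * y) / t"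
        by simp
      also have "\<dots> = 4 * real k * theta * y ^ (2 * k) / t" unfolding odd ..
      also have "(2 * real k * y ^ (2 * k - 1)) * E \<le> \<bar>(2 * real k * y ^ (2 * k - 1)) * E\<bar>" by simp
      also have "\<dots> = 2 * real k * \<bar>y\<bar> ^ (2 * k - 1) * \<bar>E\<bar>" by (simp add: abs_mult power_abs)
      also have "\<dots> \<le> 2 * real k * \<bar>y\<bar> ^ (2 * k - 1) * (C1 * (\<bar>y\<bar> / t\<^sup>2 + 1 / t))" by (intro mult_left_mono E) auto
      also have "\<dots> = D * (\<bar>y\<bar> ^ (2 * k - 1) * \<bar>y\<bar>) / t\<^sup>2 + (D * \<bar>y\<bar> ^ (2 * k - 1)) / t"
        by (simp add: D_def algebra_simps)
      also have "\<dots> = D * y ^ (2 * k) / t\<^sup>2 + (D * \<bar>y\<bar> ^ (2 * k - 1)) / t" unfolding odd ..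
      also have "(D * \<bar>y\<bar> ^ (2 * k - 1)) / t \<le> (y ^ (2 * k) / 2 + M) / t"
        unfolding M_def using t by (intro divide_right_mono young_odd D k) auto
      finally show ?thesis by simp
    qed
    also have "(C5 * G) * iter m (\<lambda>gs. (Y (Suc g) gs - y) ^ (2 * k)) hs \<le> (C5 * G) * (C2 * Z)"
      using C2(2)[OF c] D G by (intro mult_left_mono) (auto simp: y_def Z_def t_def)
    finally have main: "iter m (\<lambda>gs. Y (Suc g) gs ^ (2 * k)) hs \<le> (y ^ (2 * k) + y ^ (2 * k) / (2 * t))
       + ((4 * real k * theta * y ^ (2 * k) / t + (D * y ^ (2 * k) / t\<^sup>2 + (y ^ (2 * k) / 2 + M) / t)) + (C5 * G) * (C2 * Z))"
      by simp
    have "M / t \<le> M * (G * Z)"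
    proof -
      have "1 * 1 \<le> G * Z" using G Z by (intro mult_mono) auto
      hence "1 / t \<le> G * Z" using t by (smt (verit) divide_le_eq_1)
      thus ?thesis using mult_left_mono[of "1 / t" "G * Z" M] D by simp
    qed
    moreover have "D * y ^ (2 * k) / t\<^sup>2 \<le> C * y ^ (2 * k) / t\<^sup>2"
      using D C2 y2 by (intro divide_right_mono mult_right_mono) (auto simp: C_def)
    moreover have "M * (G * Z) + (C5 * C2) * (G * Z) \<le> C * (G * Z)"
      using D G Z by (simp add: C_def algebra_simps)
    moreover have "(1 + (4 * real k * theta + 1) / t + C / t\<^sup>2) * y ^ (2 * k)
       = y ^ (2 * k) + y ^ (2 * k) / (2 * t) + 4 * real k * theta * y ^ (2 * k) / t + (y ^ (2 * k) / 2) / t + C * y ^ (2 * k) / t\<^sup>2"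
      using t by (simp add: field_simps)
    moreover have "(y ^ (2 * k) / 2 + M) / t = (y ^ (2 * k) / 2) / t + M / t" by (simp add: add_divide_distrib)
    moreover have "(C5 * G) * (C2 * Z) = (C5 * C2) * (G * Z)" by simp
    ultimately have "iter m (\<lambda>gs. Y (Suc g) gs ^ (2 * k)) hs
       \<le> (1 + (4 * real k * theta + 1) / t + C / t\<^sup>2) * y ^ (2 * k) + C * (G * Z)"
      using main by linarith
    thus ?thesis by (simp add: G_def Z_def t_def y_def)
  qed
  moreover have "C \<ge> 0" using D C2 by (simp add: C_def)
  ultimately show ?thesis by blast
qed

section \<open>Expectations\<close>

text \<open>The mean over states with g complete merged vertices; the empty list is the tree
  consisting of v_1 alone.\<close>

definition E :: "nat \<Rightarrow> (nat list \<Rightarrow> real) \<Rightarrow> real" where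
  "E g f = iter (g * m - 1) f []"

lemma E_mono:
  assumes "g \<ge> 1" "\<And>hs. complete g hs \<Longrightarrow> f hs \<le> h hs"
  shows "E g f \<le> E g h"
  unfolding E_def by (rule iter_mono) (use assms in \<open>auto simp: complete_def\<close>)

lemma E_add: "E g (\<lambda>hs. f hs + h hs) = E g f + E g h"
  unfolding E_def by (rule iter_add)

lemma E_diff: "E g (\<lambda>hs. f hs - h hs) = E g f - E g h"
  unfolding E_def by (rule iter_diff)

lemma E_cmult: "E g (\<lambda>hs. c * f hs) = c * E g f"
  unfolding E_def by (rule iter_cmult)

lemma E_const: "E g (\<lambda>_. c) = c"
  unfolding E_def by (rule iter_const) simp

lemma E_nonneg:
  assumes "g \<ge> 1" "\<And>hs. complete g hs \<Longrightarrow> f hs \<ge> 0"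
  shows "E g f \<ge> 0"
  using E_mono[OF assms(1), of "\<lambda>_. 0" f] assms(2) by (simp add: E_const)

lemma E_abs_le:
  assumes "g \<ge> 1" "\<And>hs. complete g hs \<Longrightarrow> \<bar>f hs\<bar> \<le> h hs"
  shows "\<bar>E g f\<bar> \<le> E g h"
  unfolding E_def by (rule iter_abs_le) (use assms in \<open>auto simp: complete_def\<close>)

lemma E_Suc:
  assumes "g \<ge> 1"
  shows "E (Suc g) f = E g (iter m f)"
proof -
  have "Suc g * m - 1 = (g * m - 1) + m" using assms m_pos by simp
  thus ?thesis unfolding E_def by (simp only: funpow_add o_apply)
qed

section \<open>Growth of the means\<close>

lemma powr_le_powr: "g \<ge> (1::nat) \<Longrightarrow> a \<le> b \<Longrightarrow> real g powr a \<le> real g powr b"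
  by (rule powr_mono) auto

text \<open>The exponent must beat the homogeneous rate p theta, and b >= 1 lets the constant inflow
  from new vertices fit under C g^(b-1).\<close>

lemma E_V_upper:
  assumes b: "b \<ge> 1" "real p * theta < b"
  shows "\<exists>K\<ge>0. \<forall>g\<ge>1. E g (V p g) \<le> K * real g powr b"
proof -
  obtain C where C: "C \<ge> 0" "\<And>g hs. complete g hs \<Longrightarrow>
     iter m (V p (Suc g)) hs \<le> (1 + real p * theta / real g + C / (real g)\<^sup>2) * V p g hs + C"
    using V_drift_upper by blast
  show ?thesis
  proof (rule recursion_powr_bound[OF b(2) _ C(1)])
    fix g :: nat assume g: "g \<ge> 1"
    have "E (Suc g) (V p (Suc g)) \<le> E g (\<lambda>hs. (1 + real p * theta / real g + C / (real g)\<^sup>2) * V p g hs + C)"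
      unfolding E_Suc[OF g] by (rule E_mono[OF g C(2)])
    also have "\<dots> = (1 + real p * theta / real g + C / (real g)\<^sup>2) * E g (V p g) + C"
      by (simp only: E_add E_cmult E_const)
    finally have 1: "E (Suc g) (V p (Suc g)) \<le> (1 + real p * theta / real g + C / (real g)\<^sup>2) * E g (V p g) + C" .
    have "C \<le> C * real g powr (b - 1)"
      using C(1) b g ge_one_powr_ge_zero[of "real g" "b - 1"] by (simp add: mult_le_cancel_left1)
    with 1 show "E (Suc g) (V p (Suc g)) \<le> (1 + real p * theta / real g + C / (real g)\<^sup>2) * E g (V p g) + C * real g powr (b - 1)"
      by (rule order.trans[OF _ add_left_mono])
  next
    fix g :: nat assume g: "g \<ge> 1"
    show "E g (V p g) \<ge> 0" by (rule E_nonneg[OF g V_nonneg])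
  qed (use b in auto)
qed

lemma E_V2_linear: "\<exists>K\<ge>0. \<forall>g\<ge>1. E g (V 2 g) \<le> K * real g"
  using E_V_upper[of 1 2] theta_less by auto

text \<open>1/2 + theta is the midpoint of 2 theta and 1: above the homogeneous rate, below the
  linear main term. The forcing O(1/g) fits under g^(theta - 1/2).\<close>

lemma E_Y_bound: "\<exists>K\<ge>0. \<forall>g\<ge>1. \<bar>E g (Y g)\<bar> \<le> K * real g powr (1 / 2 + theta)"
proof -
  obtain C where C: "C \<ge> 0" "\<And>g hs. complete g hs \<Longrightarrow>
     \<bar>iter m (\<lambda>gs. Y (Suc g) gs - Y g hs) hs - 2 * theta / real g * Y g hs\<bar> \<le> C * (\<bar>Y g hs\<bar> / (real g)\<^sup>2 + 1 / real g)"
    using Y_increment_mean by blast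
  obtain K where K: "K \<ge> 0" "\<And>g. g \<ge> 1 \<Longrightarrow> E g (V 2 g) \<le> K * real g" using E_V2_linear by blast
  define D where "D = C * (K + lam + 1)"
  have D: "D \<ge> 0" using C K lam_nonneg by (simp add: D_def)
  show ?thesis
  proof (rule recursion_powr_bound[where a = "2 * theta" and C = D])
    fix g :: nat assume g: "g \<ge> 1"
    let ?q = "1 + 2 * theta / real g"
    have "\<bar>E (Suc g) (Y (Suc g)) - ?q * E g (Y g)\<bar> = \<bar>E g (\<lambda>hs. iter m (Y (Suc g)) hs - ?q * Y g hs)\<bar>"
      unfolding E_Suc[OF g] by (simp only: E_diff E_cmult)
    also have "\<dots> \<le> E g (\<lambda>hs. C / (real g)\<^sup>2 * (V 2 g hs + lam * real g) + C / real g)"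
    proof (rule E_abs_le[OF g])
      fix hs assume c: "complete g hs"
      hence v: "valid hs" by (simp add: complete_def)
      have "iter m (\<lambda>gs. Y (Suc g) gs - Y g hs) hs = iter m (Y (Suc g)) hs - Y g hs"
        by (simp only: iter_diff iter_const[OF v])
      hence "\<bar>iter m (Y (Suc g)) hs - ?q * Y g hs\<bar> \<le> C * (\<bar>Y g hs\<bar> / (real g)\<^sup>2 + 1 / real g)"
        using C(2)[OF c] by (simp add: algebra_simps)
      also have "\<dots> \<le> C * ((V 2 g hs + lam * real g) / (real g)\<^sup>2 + 1 / real g)"
      proof -
        have "\<bar>Y g hs\<bar> \<le> V 2 g hs + lam * real g"
          using V_nonneg[of 2 g hs] mult_nonneg_nonneg[OF lam_nonneg, of "real g"] by (simp add: Y_def abs_le_iff)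
        thus ?thesis using C(1) by (intro mult_left_mono add_right_mono divide_right_mono) auto
      qed
      finally show "\<bar>iter m (Y (Suc g)) hs - ?q * Y g hs\<bar> \<le> C / (real g)\<^sup>2 * (V 2 g hs + lam * real g) + C / real g"
        by (simp add: distrib_left add_divide_distrib)
    qed
    also have "\<dots> = C / (real g)\<^sup>2 * (E g (V 2 g) + lam * real g) + C / real g"
      by (simp only: E_add E_cmult E_const)
    also have "\<dots> \<le> C / (real g)\<^sup>2 * (K * real g + lam * real g) + C / real g"
      using C(1) K(2)[OF g] by (intro add_right_mono mult_left_mono) auto
    also have "\<dots> = D * (1 / real g)" using g by (simp add: D_def power2_eq_square field_simps)
    also have "1 / real g = real g powr (-1)" using g by (simp add: powr_minus_divide)
    also have "D * real g powr (-1) \<le> D * real g powr (1 / 2 + theta - 1)"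
      using D g theta_pos by (intro mult_left_mono powr_le_powr) auto
    finally have "\<bar>E (Suc g) (Y (Suc g)) - ?q * E g (Y g)\<bar> \<le> D * real g powr (1 / 2 + theta - 1)" .
    moreover have "?q * \<bar>E g (Y g)\<bar> \<le> (?q + D / (real g)\<^sup>2) * \<bar>E g (Y g)\<bar>"
      using D by (intro mult_right_mono) auto
    moreover have "\<bar>?q * E g (Y g)\<bar> = ?q * \<bar>E g (Y g)\<bar>"
      using theta_pos by (simp add: abs_mult)
    ultimately show "\<bar>E (Suc g) (Y (Suc g))\<bar> \<le> (1 + 2 * theta / real g + D / (real g)\<^sup>2) * \<bar>E g (Y g)\<bar> + D * real g powr (1 / 2 + theta - 1)"
      by linarith
  qed (use theta_pos theta_less D in auto)
qed

text \<open>Slope for \<open>R\<close>, obtained by inserting lam g for \<open>V 2\<close> in its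
  drift; it is the fixed point in \<open>rho_eq\<close>.\<close>

definition rho :: real where
  "rho = real m * (1 + \<beta>) * theta * lam / (1 - 2 * theta)"

text \<open>The exponent 1 + theta is admissible since 3 theta < 1 + theta; after division by
  g^(3/2) the truncation error of \<open>hits_times_weight\<close> is still a negative power of
  g.\<close>

lemma E_V3: "\<exists>K\<ge>0. \<forall>g\<ge>1. E g (V 3 g) / (real g * sqrt (real g)) \<le> K * real g powr (theta - 1 / 2)"
proof -
  obtain K where K: "K \<ge> 0" "\<And>g. g \<ge> 1 \<Longrightarrow> E g (V 3 g) \<le> K * real g powr (1 + theta)"
    using E_V_upper[of "1 + theta" 3] theta_pos theta_less by auto
  have "E g (V 3 g) / (real g * sqrt (real g)) \<le> K * real g powr (theta - 1 / 2)" if g: "g \<ge> 1" for g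
  proof -
    have s: "real g * sqrt (real g) = real g powr (3 / 2)"
      using g powr_add[of "real g" 1 "1 / 2"] by (simp add: powr_half_sqrt)
    have "E g (V 3 g) / (real g * sqrt (real g)) \<le> K * real g powr (1 + theta) / real g powr (3 / 2)"
      unfolding s by (intro divide_right_mono K g) auto
    also have "\<dots> = K * real g powr (theta - 1 / 2)"
      using g powr_diff[of "real g" "1 + theta" "3 / 2"] by simp
    finally show ?thesis .
  qed
  thus ?thesis using K(1) by blast
qed

lemma abs_diff_le_trans: "\<bar>s - t - x\<bar> \<le> p \<Longrightarrow> \<bar>x - y\<bar> \<le> q \<Longrightarrow> \<bar>s - t - y\<bar> \<le> p + q" for s t x y p q :: real
  by linarith

text \<open>\<open>V 2\<close> is replaced by lam g. The error of \<open>E_Y_bound\<close>, divided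
  by g, has the same order g^(theta - 1/2) as the truncation error.\<close>

lemma E_R_drift:
  "\<exists>C\<ge>0. \<forall>g\<ge>1. \<bar>E (Suc g) (R (Suc g)) - (1 + 2 * theta / real g) * E g (R g) - real m * (1 + \<beta>) * theta * lam\<bar>
      \<le> C * (E g (R g) / (real g)\<^sup>2 + real g powr (theta - 1 / 2))"
proof -
  obtain C where C: "C \<ge> 0" "\<And>g hs. complete g hs \<Longrightarrow>
     \<bar>iter m (R (Suc g)) hs - (1 + 2 * theta / real g) * R g hs - real m * (1 + \<beta>) * theta / real g * V 2 g hs\<bar>
       \<le> C * (R g hs / (real g)\<^sup>2 + V 2 g hs / (real g)\<^sup>2 + 1 / sqrt (real g) + V 3 g hs / (real g * sqrt (real g)))"
    using R_drift by blast
  obtain K2 where K2: "K2 \<ge> 0" "\<And>g. g \<ge> 1 \<Longrightarrow> E g (V 2 g) \<le> K2 * real g" using E_V2_linear by blast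
  obtain K3 where K3: "K3 \<ge> 0" "\<And>g. g \<ge> 1 \<Longrightarrow> E g (V 3 g) / (real g * sqrt (real g)) \<le> K3 * real g powr (theta - 1 / 2)"
    using E_V3 by blast
  obtain KY where KY: "KY \<ge> 0" "\<And>g. g \<ge> 1 \<Longrightarrow> \<bar>E g (Y g)\<bar> \<le> KY * real g powr (1 / 2 + theta)"
    using E_Y_bound by blast
  define kap where "kap = real m * (1 + \<beta>) * theta"
  have kap: "kap \<ge> 0" using beta_pos theta_pos by (simp add: kap_def)
  define D where "D = C + C * K2 + C + C * K3 + kap * KY"
  have "\<bar>E (Suc g) (R (Suc g)) - (1 + 2 * theta / real g) * E g (R g) - kap * lam\<bar>
      \<le> D * (E g (R g) / (real g)\<^sup>2 + real g powr (theta - 1 / 2))" if g: "g \<ge> 1" for g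
  proof -
    define P where "P = real g powr (theta - 1 / 2)"
    have P: "P \<ge> 0" by (simp add: P_def)
    define a where "a = E g (R g) / (real g)\<^sup>2"
    have a: "a \<ge> 0" unfolding a_def using E_nonneg[OF g R_nonneg] by simp
    let ?q = "1 + 2 * theta / real g"
    have "\<bar>E (Suc g) (R (Suc g)) - ?q * E g (R g) - kap / real g * E g (V 2 g)\<bar>
       = \<bar>E g (\<lambda>hs. iter m (R (Suc g)) hs - ?q * R g hs - kap / real g * V 2 g hs)\<bar>"
      unfolding E_Suc[OF g] by (simp only: E_diff E_cmult)
    also have "\<dots> \<le> E g (\<lambda>hs. C * (1 / (real g)\<^sup>2 * R g hs + 1 / (real g)\<^sup>2 * V 2 g hs + 1 / sqrt (real g) + 1 / (real g * sqrt (real g)) * V 3 g hs))"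
      by (rule E_abs_le[OF g]) (use C(2) in \<open>simp add: kap_def\<close>)
    also have "\<dots> = C * (1 / (real g)\<^sup>2 * E g (R g) + 1 / (real g)\<^sup>2 * E g (V 2 g) + 1 / sqrt (real g) + 1 / (real g * sqrt (real g)) * E g (V 3 g))"
      by (simp only: E_add E_cmult E_const)
    also have "\<dots> \<le> C * (a + K2 * P + P + K3 * P)"
    proof (intro mult_left_mono add_mono C(1))
      show "1 / (real g)\<^sup>2 * E g (R g) \<le> a" by (simp add: a_def)
      have "1 / (real g)\<^sup>2 * E g (V 2 g) \<le> 1 / (real g)\<^sup>2 * (K2 * real g)"
        by (intro mult_left_mono K2 g) auto
      also have "\<dots> = K2 * real g powr (-1)" using g by (simp add: power2_eq_square powr_minus_divide)
      also have "\<dots> \<le> K2 * P" unfolding P_def using K2 g theta_pos by (intro mult_left_mono powr_le_powr) auto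
      finally show "1 / (real g)\<^sup>2 * E g (V 2 g) \<le> K2 * P" .
      have "1 / sqrt (real g) = real g powr (-(1 / 2))" using g by (simp add: powr_minus_divide powr_half_sqrt)
      also have "\<dots> \<le> P" unfolding P_def using g theta_pos by (intro powr_le_powr) auto
      finally show "1 / sqrt (real g) \<le> P" .
      show "1 / (real g * sqrt (real g)) * E g (V 3 g) \<le> K3 * P" using K3(2)[OF g] by (simp add: P_def)
    qed
    finally have 1: "\<bar>E (Suc g) (R (Suc g)) - ?q * E g (R g) - kap / real g * E g (V 2 g)\<bar> \<le> C * (a + K2 * P + P + K3 * P)" .
    have "E g (Y g) = E g (V 2 g) - lam * real g" unfolding Y_def by (simp only: E_diff E_const)
    hence "E g (V 2 g) = E g (Y g) + lam * real g" by simp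
    hence "kap / real g * E g (V 2 g) - kap * lam = kap / real g * E g (Y g)"
      using g by (simp only: distrib_left) simp
    hence "\<bar>kap / real g * E g (V 2 g) - kap * lam\<bar> = kap / real g * \<bar>E g (Y g)\<bar>" using kap by (simp add: abs_mult)
    also have "\<dots> \<le> kap / real g * (KY * real g powr (1 / 2 + theta))"
      using kap by (intro mult_left_mono KY g) auto
    also have "\<dots> = (kap * KY) * (real g powr (1 / 2 + theta) / real g powr 1)" using g by simp
    also have "real g powr (1 / 2 + theta) / real g powr 1 = P"
      unfolding P_def powr_diff[symmetric] by (simp add: algebra_simps)
    finally have 2: "\<bar>kap / real g * E g (V 2 g) - kap * lam\<bar> \<le> (kap * KY) * P" .
    have "\<bar>E (Suc g) (R (Suc g)) - ?q * E g (R g) - kap * lam\<bar> \<le> C * (a + K2 * P + P + K3 * P) + (kap * KY) * P"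
      by (rule abs_diff_le_trans[OF 1 2])
    also have "\<dots> = C * a + (C * K2 + C + C * K3 + kap * KY) * P" by (simp add: algebra_simps)
    also have "\<dots> \<le> D * a + D * P"
      using a P C(1) K2(1) K3(1) KY(1) kap by (intro add_mono mult_right_mono) (auto simp: D_def)
    finally show ?thesis by (simp add: a_def P_def distrib_left)
  qed
  moreover have "D \<ge> 0" using C K2 K3 KY kap by (simp add: D_def)
  ultimately show ?thesis unfolding kap_def by blast
qed

text \<open>A preliminary bound: it turns the error R/g^2 of the drift into O(1/g), from which
  \<open>E_R_asymp\<close> gets the slope.\<close>

lemma E_R_linear: "\<exists>K\<ge>0. \<forall>g\<ge>1. E g (R g) \<le> K * real g"
proof -
  obtain C where C: "C \<ge> 0" "\<And>g. g \<ge> 1 \<Longrightarrow> \<bar>E (Suc g) (R (Suc g)) - (1 + 2 * theta / real g) * E g (R g) - real m * (1 + \<beta>) * theta * lam\<bar>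
      \<le> C * (E g (R g) / (real g)\<^sup>2 + real g powr (theta - 1 / 2))"
    using E_R_drift by blast
  define D where "D = C + real m * (1 + \<beta>) * theta * lam"
  have kl: "real m * (1 + \<beta>) * theta * lam \<ge> 0" using beta_pos theta_pos lam_nonneg by simp
  hence D: "D \<ge> 0" using C by (simp add: D_def)
  have "\<exists>K\<ge>0. \<forall>g\<ge>1. E g (R g) \<le> K * real g powr 1"
  proof (rule recursion_powr_bound[where a = "2 * theta" and C = D])
    fix g :: nat assume g: "g \<ge> 1"
    have "real g powr (theta - 1 / 2) \<le> real g powr 0" using g theta_less by (intro powr_le_powr) auto
    hence "C * (E g (R g) / (real g)\<^sup>2 + real g powr (theta - 1 / 2)) \<le> C * (E g (R g) / (real g)\<^sup>2 + 1)"
      using g C(1) by (intro mult_left_mono add_left_mono) auto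
    hence "E (Suc g) (R (Suc g)) \<le> (1 + 2 * theta / real g) * E g (R g) + C * (E g (R g) / (real g)\<^sup>2) + D"
      using C(2)[OF g] by (simp add: D_def distrib_left)
    also have "C * (E g (R g) / (real g)\<^sup>2) \<le> D * (E g (R g) / (real g)\<^sup>2)"
      using kl E_nonneg[OF g R_nonneg] by (intro mult_right_mono) (auto simp: D_def)
    finally show "E (Suc g) (R (Suc g)) \<le> (1 + 2 * theta / real g + D / (real g)\<^sup>2) * E g (R g) + D * real g powr (1 - 1)"
      using g by (simp add: algebra_simps)
  next
    fix g :: nat assume "g \<ge> 1"
    thus "E g (R g) \<ge> 0" by (rule E_nonneg) (rule R_nonneg)
  qed (use theta_less D in auto)
  thus ?thesis by simp
qed

lemma rho_eq: "2 * theta * rho + real m * (1 + \<beta>) * theta * lam = rho"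
  using theta_less by (simp add: rho_def field_simps)

lemma E_R_asymp: "\<exists>K\<ge>0. \<forall>g\<ge>1. \<bar>E g (R g) - rho * real g\<bar> \<le> K * real g powr (1 / 2 + theta)"
proof -
  obtain C where C: "C \<ge> 0" "\<And>g. g \<ge> 1 \<Longrightarrow> \<bar>E (Suc g) (R (Suc g)) - (1 + 2 * theta / real g) * E g (R g) - real m * (1 + \<beta>) * theta * lam\<bar>
      \<le> C * (E g (R g) / (real g)\<^sup>2 + real g powr (theta - 1 / 2))"
    using E_R_drift by blast
  obtain K where K: "K \<ge> 0" "\<And>g. g \<ge> 1 \<Longrightarrow> E g (R g) \<le> K * real g" using E_R_linear by blast
  define D where "D = C * (K + 1)"
  have D: "D \<ge> 0" using C K by (simp add: D_def)
  show ?thesis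
  proof (rule recursion_powr_bound[where a = "2 * theta" and C = D])
    fix g :: nat assume g: "g \<ge> 1"
    let ?q = "1 + 2 * theta / real g"
    define P where "P = real g powr (theta - 1 / 2)"
    define r where "r = E g (R g) - rho * real g"
    have "E g (R g) / (real g)\<^sup>2 \<le> K * real g / (real g)\<^sup>2" by (intro divide_right_mono K g) auto
    also have "\<dots> = K * real g powr (-1)" using g by (simp add: power2_eq_square powr_minus_divide)
    also have "\<dots> \<le> K * P" unfolding P_def using K g theta_pos by (intro mult_left_mono powr_le_powr) auto
    finally have "C * (E g (R g) / (real g)\<^sup>2 + P) \<le> C * (K * P + P)" using C(1) by (intro mult_left_mono) auto
    hence 1: "\<bar>E (Suc g) (R (Suc g)) - ?q * E g (R g) - real m * (1 + \<beta>) * theta * lam\<bar> \<le> D * P"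
      using C(2)[OF g] by (simp add: D_def P_def algebra_simps)
    have "?q * (rho * real g) + real m * (1 + \<beta>) * theta * lam = rho * real (Suc g)"
      using g rho_eq by (simp add: algebra_simps)
    hence 2: "E (Suc g) (R (Suc g)) - rho * real (Suc g) = (E (Suc g) (R (Suc g)) - ?q * E g (R g) - real m * (1 + \<beta>) * theta * lam) + ?q * r"
      by (simp add: r_def right_diff_distrib)
    have "\<bar>?q * r\<bar> = ?q * \<bar>r\<bar>" using theta_pos by (simp add: abs_mult)
    moreover have "?q * \<bar>r\<bar> \<le> (?q + D / (real g)\<^sup>2) * \<bar>r\<bar>" using D by (intro mult_right_mono) auto
    moreover have P: "real g powr (1 / 2 + theta - 1) = P" by (simp add: P_def algebra_simps)
    ultimately show "\<bar>E (Suc g) (R (Suc g)) - rho * real (Suc g)\<bar> \<le> (1 + 2 * theta / real g + D / (real g)\<^sup>2) * \<bar>E g (R g) - rho * real g\<bar> + D * real g powr (1 / 2 + theta - 1)"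
      using 1 2 unfolding r_def[symmetric] P by linarith
  qed (use theta_pos theta_less D in auto)
qed

text \<open>The mean increment is a multiple of rho/g up to O(g^(theta - 3/2)). The error is
  summable since theta < 1/2, so only the harmonic sum diverges.\<close>

lemma E_tri_asymp:
  "\<exists>K\<ge>0. \<forall>g\<ge>1. \<bar>E g (\<lambda>hs. real (tri g hs)) - (real m - 1) * theta\<^sup>2 / real m * rho * ln (real g)\<bar> \<le> K"
proof -
  obtain C where C: "C \<ge> 0" "\<And>g hs. complete g hs \<Longrightarrow>
     \<bar>iter m (\<lambda>gs. real (tri (Suc g) gs)) hs - real (tri g hs) - (real m - 1) * theta\<^sup>2 / real m * R g hs / (real g)\<^sup>2\<bar>
       \<le> C * R g hs / real g ^ 3" using tri_drift by blast
  obtain K where K: "K \<ge> 0" "\<And>g. g \<ge> 1 \<Longrightarrow> E g (R g) \<le> K * real g" using E_R_linear by blast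
  obtain K' where K': "K' \<ge> 0" "\<And>g. g \<ge> 1 \<Longrightarrow> \<bar>E g (R g) - rho * real g\<bar> \<le> K' * real g powr (1 / 2 + theta)"
    using E_R_asymp by blast
  define kap where "kap = (real m - 1) * theta\<^sup>2 / real m"
  have kap: "kap \<ge> 0" using m_pos by (simp add: kap_def)
  define D where "D = C * K + kap * K'"
  show ?thesis
  proof (rule recursion_ln_bound[where b = "1 / 2 + theta" and C = D])
    fix g :: nat assume g: "g \<ge> 1"
    define P where "P = real g powr (1 / 2 + theta - 2)"
    have "\<bar>E (Suc g) (\<lambda>hs. real (tri (Suc g) hs)) - E g (\<lambda>hs. real (tri g hs)) - kap / (real g)\<^sup>2 * E g (R g)\<bar>
       = \<bar>E g (\<lambda>hs. iter m (\<lambda>gs. real (tri (Suc g) gs)) hs - real (tri g hs) - kap / (real g)\<^sup>2 * R g hs)\<bar>"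
      unfolding E_Suc[OF g] by (simp only: E_diff E_cmult)
    also have "\<dots> \<le> E g (\<lambda>hs. C / real g ^ 3 * R g hs)"
      by (rule E_abs_le[OF g]) (use C(2) in \<open>simp add: kap_def\<close>)
    also have "\<dots> = C / real g ^ 3 * E g (R g)" by (rule E_cmult)
    also have "\<dots> \<le> C / real g ^ 3 * (K * real g)" using C(1) by (intro mult_left_mono K g) auto
    also have "\<dots> = (C * K) * real g powr (-2)"
      using g by (simp add: powr_minus_divide power3_eq_cube power2_eq_square)
    also have "\<dots> \<le> (C * K) * P"
      unfolding P_def using C(1) K(1) g theta_pos by (intro mult_left_mono powr_le_powr) auto
    finally have 1: "\<bar>E (Suc g) (\<lambda>hs. real (tri (Suc g) hs)) - E g (\<lambda>hs. real (tri g hs)) - kap / (real g)\<^sup>2 * E g (R g)\<bar> \<le> (C * K) * P" .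
    have "kap / (real g)\<^sup>2 * E g (R g) - kap * rho / real g = kap / (real g)\<^sup>2 * (E g (R g) - rho * real g)"
      using g by (simp add: power2_eq_square field_simps)
    hence "\<bar>kap / (real g)\<^sup>2 * E g (R g) - kap * rho / real g\<bar> = kap / (real g)\<^sup>2 * \<bar>E g (R g) - rho * real g\<bar>"
      using kap by (simp add: abs_mult)
    also have "\<dots> \<le> kap / (real g)\<^sup>2 * (K' * real g powr (1 / 2 + theta))"
      using kap by (intro mult_left_mono K' g) auto
    also have "\<dots> = (kap * K') * (real g powr (1 / 2 + theta) / real g powr 2)" using g by simp
    also have "real g powr (1 / 2 + theta) / real g powr 2 = P" unfolding P_def powr_diff[symmetric] ..
    finally have 2: "\<bar>kap / (real g)\<^sup>2 * E g (R g) - kap * rho / real g\<bar> \<le> (kap * K') * P" .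
    show "\<bar>E (Suc g) (\<lambda>hs. real (tri (Suc g) hs)) - E g (\<lambda>hs. real (tri g hs)) - (real m - 1) * theta\<^sup>2 / real m * rho / real g\<bar>
       \<le> D * real g powr (1 / 2 + theta - 2)"
      using abs_diff_le_trans[OF 1 2] unfolding kap_def P_def D_def distrib_right .
  qed (use theta_less C K K' kap in \<open>auto simp: D_def\<close>)
qed

text \<open>The bound is the 2k-th power of g^(1/2 + theta) times g, and the extra g is negligible
  for large k. It beats the homogeneous rate 4 k theta + 1 because 2 theta < 1.\<close>

lemma E_Y_moment:
  assumes k: "k \<ge> 1"
  shows "\<exists>K\<ge>0. \<forall>g\<ge>1. E g (\<lambda>hs. Y g hs ^ (2 * k)) \<le> K * real g powr (real k + 2 * real k * theta + 1)"
proof -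
  obtain C where C: "C \<ge> 0" "\<And>g hs. complete g hs \<Longrightarrow>
     iter m (\<lambda>gs. Y (Suc g) gs ^ (2 * k)) hs
       \<le> (1 + (4 * real k * theta + 1) / real g + C / (real g)\<^sup>2) * Y g hs ^ (2 * k)
         + C * (real g ^ (k - 1) * (V (2 * k + 1) g hs / real g + 1))"
    using Y_moment_drift[OF k] by blast
  define a where "a = real (2 * k + 1) * theta"
  have a: "a \<ge> 0" using theta_pos by (simp add: a_def)
  obtain K where K: "K \<ge> 0" "\<And>g. g \<ge> 1 \<Longrightarrow> E g (V (2 * k + 1) g) \<le> K * real g powr (a + 1)"
    using E_V_upper[of "a + 1" "2 * k + 1"] a unfolding a_def by auto
  define D where "D = C * (K + 1)"
  have D: "D \<ge> C" "D \<ge> 0" using C K by (auto simp: D_def mult_le_cancel_left1)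
  show ?thesis
  proof (rule recursion_powr_bound[where a = "4 * real k * theta + 1" and C = D])
    fix g :: nat assume g: "g \<ge> 1"
    let ?q = "1 + (4 * real k * theta + 1) / real g"
    have y: "Y g hs ^ (2 * k) \<ge> 0" for hs by (simp add: power_mult)
    have Ey: "E g (\<lambda>hs. Y g hs ^ (2 * k)) \<ge> 0" by (rule E_nonneg[OF g y])
    have "E (Suc g) (\<lambda>hs. Y (Suc g) hs ^ (2 * k))
       \<le> E g (\<lambda>hs. (?q + C / (real g)\<^sup>2) * Y g hs ^ (2 * k) + C * (real g ^ (k - 1) * (1 / real g * V (2 * k + 1) g hs + 1)))"
      unfolding E_Suc[OF g] by (rule E_mono[OF g]) (use C(2) in simp)
    also have "\<dots> = (?q + C / (real g)\<^sup>2) * E g (\<lambda>hs. Y g hs ^ (2 * k)) + C * (real g ^ (k - 1) * (1 / real g * E g (V (2 * k + 1) g) + 1))"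
      by (simp only: E_add E_cmult E_const)
    also have "C * (real g ^ (k - 1) * (1 / real g * E g (V (2 * k + 1) g) + 1)) \<le> D * real g powr (real k + 2 * real k * theta + 1 - 1)"
    proof -
      have "1 / real g * E g (V (2 * k + 1) g) \<le> 1 / real g * (K * real g powr (a + 1))"
        by (intro mult_left_mono K g) auto
      also have "\<dots> = K * real g powr a" using g by (simp add: powr_add)
      finally have "1 / real g * E g (V (2 * k + 1) g) + 1 \<le> K * real g powr a + 1 * real g powr a"
        using ge_one_powr_ge_zero[of "real g" a] g a by simp
      hence "C * (real g ^ (k - 1) * (1 / real g * E g (V (2 * k + 1) g) + 1)) \<le> C * (real g ^ (k - 1) * ((K + 1) * real g powr a))"
        using C(1) by (intro mult_left_mono) (auto simp: distrib_right)
      also have "\<dots> = D * (real g powr (real (k - 1)) * real g powr a)"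
        using g by (simp add: D_def powr_realpow)
      also have "\<dots> = D * real g powr (real (k - 1) + a)" by (simp add: powr_add)
      also have "\<dots> \<le> D * real g powr (real k + 2 * real k * theta + 1 - 1)"
        using D g k theta_less by (intro mult_left_mono powr_le_powr) (auto simp: a_def of_nat_diff algebra_simps)
      finally show ?thesis .
    qed
    also have "(?q + C / (real g)\<^sup>2) * E g (\<lambda>hs. Y g hs ^ (2 * k)) \<le> (?q + D / (real g)\<^sup>2) * E g (\<lambda>hs. Y g hs ^ (2 * k))"
      using D by (intro mult_right_mono add_left_mono divide_right_mono Ey) auto
    finally show "E (Suc g) (\<lambda>hs. Y (Suc g) hs ^ (2 * k)) \<le> (1 + (4 * real k * theta + 1) / real g + D / (real g)\<^sup>2) * E g (\<lambda>hs. Y g hs ^ (2 * k))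
        + D * real g powr (real k + 2 * real k * theta + 1 - 1)" by simp
  next
    fix g :: nat assume g: "g \<ge> 1"
    show "E g (\<lambda>hs. Y g hs ^ (2 * k)) \<ge> 0" by (rule E_nonneg[OF g]) (simp add: power_mult)
  next
    have "real k * (2 * theta) < real k * 1" using theta_less k by (intro mult_strict_left_mono) auto
    thus "4 * real k * theta + 1 < real k + 2 * real k * theta + 1" by linarith
    show "0 \<le> real k + 2 * real k * theta + 1" using theta_pos by simp
  qed (use D in auto)
qed

section \<open>The clustering coefficient\<close>

definition dg :: "nat \<Rightarrow> nat list \<Rightarrow> nat \<Rightarrow> nat" where
  "dg n gs j = card {k\<in>{..<n*m-1}. grp m (k + 2) = j} + card {k\<in>{..<n*m-1}. gs ! k = j}"

definition D :: "nat \<Rightarrow> nat list \<Rightarrow> real" where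
  "D n gs = (\<Sum>j=1..n. real (dg n gs j choose 2))"

definition Cl :: "nat \<Rightarrow> nat list \<Rightarrow> real" where
  "Cl n gs = (if D n gs = 0 then 0 else 3 * real (tri n gs) / D n gs)"

text \<open>Edge e_k sits at list position k - 2, so edges 2..N occupy the first N - 1
  positions.\<close>

lemma card_shift2: fixes N :: nat shows "card {k\<in>{2..N}. P k} = card {k\<in>{..<N-1}. P (k + 2)}"
proof (rule bij_betw_same_card[of "\<lambda>k. k - 2"])
  have [simp]: "Suc (Suc (x - 2)) = x" if "2 \<le> x" for x using that by simp
  show "bij_betw (\<lambda>k. k - 2) {k\<in>{2..N}. P k} {k\<in>{..<N-1}. P (k + 2)}"
    by (rule bij_betwI[of _ _ _ "\<lambda>k. k + 2"]) (auto simp: numeral_2_eq_2[symmetric] le_add_diff_inverse2)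
qed

lemma clustering_eq:
  assumes n: "n \<ge> 1" and len: "length hs = n * m - 1"
  shows "clustering m n hs = Cl n (map (grp m) hs)"
proof -
  let ?g = "map (grp m) hs"
  have ep: "endpts m hs k = ends ?g k" if "k \<in> {2..n*m}" for k
  proof -
    have "k - 2 < length hs" using that len by auto
    thus ?thesis by (simp add: endpts_def ends_def)
  qed
  have "triangles m n hs = tri n ?g"
  proof -
    have "{S. S \<subseteq> {2..n * m} \<and> card S = 3 \<and> (\<exists>x y z. x \<noteq> y \<and> y \<noteq> z \<and> x \<noteq> z \<and>
        endpts m hs ` S = {{x,y},{y,z},{x,z}})} = tri_set n ?g"
    proof (unfold tri_set_def is_tri_def, rule Collect_cong, rule conj_cong[OF refl], rule conj_cong[OF refl])
      fix S assume "S \<subseteq> {2..n * m}"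
      hence "endpts m hs ` S = ends ?g ` S" using ep by (intro image_cong refl) auto
      thus "(\<exists>x y z. x \<noteq> y \<and> y \<noteq> z \<and> x \<noteq> z \<and> endpts m hs ` S = {{x,y},{y,z},{x,z}})
        = (\<exists>x y z. x \<noteq> y \<and> y \<noteq> z \<and> x \<noteq> z \<and> ends ?g ` S = {{x,y},{y,z},{x,z}})" by (simp only:)
    qed
    thus ?thesis unfolding triangles_def by simp
  qed
  moreover have "deg m n hs j = dg n ?g j" for j
  proof -
    have "{k\<in>{..<n*m-1}. grp m (hs ! (k + 2 - 2)) = j} = {k\<in>{..<n*m-1}. ?g ! k = j}" using len by auto
    thus ?thesis unfolding deg_def dg_def by (simp only: card_shift2)
  qed
  ultimately show ?thesis unfolding clustering_def Cl_def D_def Let_def by (simp only:)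
qed

lemma exp_clustering_eq:
  assumes n: "n \<ge> 1"
  shows "exp_clustering \<beta> m n = E n (Cl n)"
proof -
  define N where "N = n * m - 1"
  have N: "n * m = Suc N" using n m_pos by (simp add: N_def)
  have "exp_clustering \<beta> m n = measure_pmf.expectation (tree_pmf \<beta> (Suc N)) (\<lambda>hs. Cl n (map (grp m) hs))"
    unfolding exp_clustering_def N
    by (rule integral_cong_AE)
      (use set_tree_pmf clustering_eq[OF n] in \<open>auto simp: AE_measure_pmf_iff N_def\<close>)
  also have "\<dots> = E n (Cl n)" unfolding expectation_tree E_def N_def ..
  finally show ?thesis .
qed

section \<open>The denominator in terms of weights\<close>

lemma card_group:
  assumes "1 \<le> j" "j \<le> n"
  shows "of_bool (j = 1) + card {k\<in>{..<n*m-1}. grp m (k + 2) = j} = m"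
proof -
  have "{k\<in>{1..n*m}. grp m k = j} = {(j - 1) * m + 1..j * m}"
  proof (intro Set.equalityI subsetI)
    fix k assume "k \<in> {k\<in>{1..n*m}. grp m k = j}"
    hence k: "1 \<le> k" "grp m k = j" by auto
    have "k \<le> j * m" using grp_le_iff[of m k j] k m_pos by simp
    moreover have "\<not> grp m k \<le> j - 1" using k assms by linarith
    hence "\<not> k \<le> (j - 1) * m" using grp_le_iff[of m k "j - 1"] k m_pos by blast
    ultimately show "k \<in> {(j - 1) * m + 1..j * m}" by simp
  next
    fix k assume k: "k \<in> {(j - 1) * m + 1..j * m}"
    have "grp m k \<le> j" "\<not> grp m k \<le> j - 1" using grp_le_iff[of m k] k m_pos by auto
    moreover have "k \<le> n * m" using k mult_le_mono1[OF assms(2), of m] by (meson atLeastAtMost_iff order.trans)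
    ultimately show "k \<in> {k\<in>{1..n*m}. grp m k = j}" using k by auto
  qed
  hence "card {k\<in>{1..n*m}. grp m k = j} = j * m - (j - 1) * m" by simp
  also have "\<dots> = m" using assms by (simp flip: diff_mult_distrib)
  finally have c: "card {k\<in>{1..n*m}. grp m k = j} = m" .
  \<comment> \<open>v_1 is split off: it lies in group 1 but is the tail of no edge, whence the
    summand \<open>of_bool (j = 1)\<close>.\<close>
  have "1 \<le> n * m" using assms m_pos by simp
  hence "{1..n*m} = insert 1 {2..n*m}" by auto
  hence "{k\<in>{1..n*m}. grp m k = j} = (if j = 1 then insert 1 else id) {k\<in>{2..n*m}. grp m k = j}"
    by auto
  moreover have "card (insert 1 {k\<in>{2..n*m}. grp m k = j}) = Suc (card {k\<in>{2..n*m}. grp m k = j})"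
    by (rule card_insert_disjoint) auto
  ultimately have "card {k\<in>{1..n*m}. grp m k = j} = of_bool (j = 1) + card {k\<in>{2..n*m}. grp m k = j}"
    by (cases "j = 1") (simp_all only: simp_thms if_True if_False id_apply of_bool_eq add_0 plus_1_eq_Suc)
  thus ?thesis using c by (simp only: card_shift2)
qed

text \<open>Each of the m tree vertices of a complete group carries one beta on top of its
  half-edges.\<close>

lemma gw_eq_dg:
  assumes "complete n gs" "1 \<le> j" "j \<le> n"
  shows "gw gs j = \<beta> * real m + real (dg n gs j)"
proof -
  have len: "length gs = n * m - 1" using assms by (simp add: complete_def)
  define a where "a = card {k\<in>{..<n*m-1}. grp m (k + 2) = j}"
  define b where "b = card {k\<in>{..<n*m-1}. gs ! k = j}"
  have "(\<Sum>k<length gs. of_bool (gs ! k = j)) = real b"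
    unfolding b_def len by (simp add: Int_def)
  moreover have "(\<Sum>k<length gs. of_bool (grp m (k + 2) = j)) = real a"
    unfolding a_def len by (simp add: Int_def)
  ultimately have "gw gs j = \<beta> * of_bool (j = 1) + (real b + (1 + \<beta>) * real a)"
    unfolding gw_def sum.distrib sum_distrib_left[symmetric] by (simp only:)
  moreover have "real m = of_bool (j = 1) + real a"
    using card_group[OF assms(2,3)] unfolding a_def[symmetric] by (metis of_nat_add of_nat_of_bool)
  moreover have "dg n gs j = a + b" unfolding dg_def a_def b_def ..
  ultimately show ?thesis by (simp add: algebra_simps)
qed

lemma gw_complete_total:
  assumes "complete n gs"
  shows "(\<Sum>j=1..n. gw gs j) = (2 + \<beta>) * real n * real m - 2"
proof -
  have c: "valid gs" "n \<ge> 1" "Suc (length gs) = n * m" using assms m_pos by (auto simp: complete_def)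
  have "grp m (n * m) = n"
  proof (rule antisym)
    show "grp m (n * m) \<le> n" using c m_pos by (subst grp_le_iff) auto
    show "n \<le> grp m (n * m)" using c m_pos grp_le_iff[of m "n * m" "n - 1"] by (auto simp: not_le)
  qed
  thus ?thesis using gw_total[OF c(1)] by (simp add: c(3) nu_def)
qed

definition C2 :: real where
  "C2 = (2 + 5 * \<beta>) / (2 * \<beta>) * (real m)^2 + (2 - \<beta>) / (2 * \<beta>) * real m"

text \<open>The coefficient 2 - beta may be negative, but m^2 >= m lets the quadratic term
  compensate it, leaving at least (4 + 4 beta) m in the numerator.\<close>

lemma C2_pos: "C2 > 0"
proof -
  have m1: "real m \<ge> 1" using m_pos by simp
  have "real m * 1 \<le> real m * real m" using m1 by (intro mult_left_mono) auto
  hence "(2 + 5 * \<beta>) * (real m * 1) \<le> (2 + 5 * \<beta>) * (real m * real m)"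
    by (rule mult_left_mono) (use beta_pos in simp)
  hence "(2 + 5 * \<beta>) * real m + (2 - \<beta>) * real m \<le> (2 + 5 * \<beta>) * (real m)^2 + (2 - \<beta>) * real m"
    by (simp add: power2_eq_square)
  moreover have "(2 + 5 * \<beta>) * real m + (2 - \<beta>) * real m = (4 + 4 * \<beta>) * real m" by (simp add: algebra_simps)
  moreover have "(4 + 4 * \<beta>) * real m > 0" using m1 beta_pos by simp
  ultimately have "(2 + 5 * \<beta>) * (real m)^2 + (2 - \<beta>) * real m > 0" by linarith
  moreover have "C2 = ((2 + 5 * \<beta>) * (real m)^2 + (2 - \<beta>) * real m) / (2 * \<beta>)"
    using beta_pos by (simp add: C2_def field_simps)
  ultimately show ?thesis using beta_pos by simp
qed

lemma one_minus_theta: "1 - 2 * theta = \<beta> / (2 + \<beta>)"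
  using beta_pos by (simp add: theta_def field_simps)

lemma mu_eq: "mu = real m * (1 + \<beta>) * (real m * (1 + \<beta>) + 1)"
  by (simp add: mu_def pochhammer_Suc numeral_2_eq_2)

text \<open>Matches the slope found from the drift with c_2. The correction terms are those that
  arise in \<open>D_eq\<close> from passing between w(w+1) and d(d-1) with w = d + beta m.\<close>

lemma lam_eq_C2: "lam = 2 * C2 + (2 * \<beta> * real m + 2) * (2 + \<beta>) * real m - \<beta> * real m * (\<beta> * real m + 1)"
proof -
  have "\<beta> * lam = mu * (2 + \<beta>)" using beta_pos by (simp add: lam_def one_minus_theta)
  moreover have "\<beta> * (2 * C2) = (2 + 5 * \<beta>) * (real m)^2 + (2 - \<beta>) * real m"
    using beta_pos by (simp add: C2_def field_simps)
  moreover have "mu * (2 + \<beta>) = (2 + 5 * \<beta>) * (real m)^2 + (2 - \<beta>) * real m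
     + \<beta> * ((2 * \<beta> * real m + 2) * (2 + \<beta>) * real m - \<beta> * real m * (\<beta> * real m + 1))"
    by (simp add: mu_eq power2_eq_square algebra_simps)
  ultimately have "\<beta> * lam = \<beta> * (2 * C2 + ((2 * \<beta> * real m + 2) * (2 + \<beta>) * real m - \<beta> * real m * (\<beta> * real m + 1)))"
    by (simp only: distrib_left)
  hence "lam = 2 * C2 + ((2 * \<beta> * real m + 2) * (2 + \<beta>) * real m - \<beta> * real m * (\<beta> * real m + 1))"
    using beta_pos by (simp only: mult_cancel_left) simp
  thus ?thesis by simp
qed

text \<open>d(d-1) is a quadratic in the weight w = d + beta m, and the total weight is
  deterministic, so all randomness of the denominator sits in \<open>Y\<close>.\<close>

lemma D_eq:
  assumes c: "complete n gs"
  shows "D n gs = C2 * real n + Y n gs / 2 + (2 * \<beta> * real m + 2)"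
proof -
  have "2 * real (dg n gs j choose 2)
      = pochhammer (gw gs j) 2 - (2 * \<beta> * real m + 2) * gw gs j + \<beta> * real m * (\<beta> * real m + 1)"
    if "j \<in> {1..n}" for j
  proof -
    have choose2: "real (d choose 2) = real d * (real d - 1) / 2" for d
      by (cases d) (auto simp: choose_two real_of_nat_div field_simps)
    have "2 * real (dg n gs j choose 2) = real (dg n gs j) * (real (dg n gs j) - 1)"
      unfolding choose2 by simp
    thus ?thesis using gw_eq_dg[OF c, of j] that
      by (simp add: pochhammer_Suc numeral_2_eq_2 algebra_simps)
  qed
  hence "2 * D n gs = (\<Sum>j=1..n. pochhammer (gw gs j) 2 - (2 * \<beta> * real m + 2) * gw gs j + \<beta> * real m * (\<beta> * real m + 1))"
    unfolding D_def sum_distrib_left by (intro sum.cong) auto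
  also have "\<dots> = V 2 n gs - (2 * \<beta> * real m + 2) * ((2 + \<beta>) * real n * real m - 2) + real n * (\<beta> * real m * (\<beta> * real m + 1))"
    unfolding sum.distrib sum_subtractf sum_distrib_left[symmetric] gw_complete_total[OF c] V_def
    by (simp add: algebra_simps)
  also have "\<dots> = 2 * (C2 * real n + (2 * \<beta> * real m + 2)) + Y n gs"
    by (simp add: Y_def lam_eq_C2 algebra_simps)
  finally show ?thesis by simp
qed

text \<open>(d choose 2) >= d - 1, and the degrees sum to 2(nm - 1). The bound holds for every
  state, which permits division by the denominator inside the mean.\<close>

lemma D_lower:
  assumes c: "complete n gs"
  shows "D n gs \<ge> real n - 2"
proof -
  have "real d - 1 \<le> real (d choose 2)" for d
  proof -
    have "d \<le> (d choose 2) + 1" by (induction d) (auto simp: numeral_2_eq_2)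
    thus ?thesis by linarith
  qed
  hence "(\<Sum>j=1..n. real (dg n gs j) - 1) \<le> D n gs" unfolding D_def by (intro sum_mono)
  moreover have "(\<Sum>j=1..n. real (dg n gs j) - 1) = (\<Sum>j=1..n. gw gs j - \<beta> * real m - 1)"
    by (intro sum.cong) (auto simp: gw_eq_dg[OF c])
  moreover have "\<dots> = 2 * (real n * real m) - 2 - real n"
    using gw_complete_total[OF c] by (simp add: sum_subtractf algebra_simps)
  moreover have "real n * 1 \<le> real n * real m" using m_pos by (intro mult_left_mono) auto
  ultimately show ?thesis by linarith
qed

section \<open>Replacing the random denominator by its linear order\<close>

lemma tri_le: "real (tri n gs) \<le> (real n * real m) ^ 3"
proof -
  have "tri_set n gs \<subseteq> {S. S \<subseteq> {2..n*m} \<and> card S = 3}"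
  proof
    fix S assume "S \<in> tri_set n gs"
    hence "S \<subseteq> {2..n*m} \<and> card S = 3" unfolding mem_tri_set is_tri_def by (elim conjE) (rule conjI)
    thus "S \<in> {S. S \<subseteq> {2..n*m} \<and> card S = 3}" by (rule CollectI)
  qed
  moreover have "finite {S. S \<subseteq> {2..n*m} \<and> card S = 3}"
    by (rule finite_subset[of _ "Pow {2..n*m}"]) (simp_all add: Collect_mono_iff Pow_def)
  ultimately have "tri n gs \<le> card {S. S \<subseteq> {2..n*m} \<and> card S = 3}" by (intro card_mono)
  also have "\<dots> = (n * m - 1) choose 3" by (subst n_subsets) auto
  also have "\<dots> \<le> (n * m) ^ 3"
  proof (cases "3 \<le> n * m - 1")
    case True
    have "(n * m - 1) choose 3 \<le> (n * m - 1) ^ 3" by (rule binomial_le_pow[OF True])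
    also have "\<dots> \<le> (n * m) ^ 3" by (rule power_mono) auto
    finally show ?thesis .
  qed (simp add: binomial_eq_0)
  finally have "real (tri n gs) \<le> real ((n * m) ^ 3)" by (rule of_nat_mono)
  thus ?thesis by simp
qed

text \<open>1/d - 1/e = (e - d)/(d e). For n >= 4 the denominator is at least n - 2 >= n/2; this 2
  and the 3 of the clustering coefficient give the 6.\<close>

lemma Cl_approx:
  assumes c: "complete n gs" and n: "n \<ge> 4"
  shows "\<bar>Cl n gs - 3 / (C2 * real n) * real (tri n gs)\<bar>
    \<le> (6 * (2 * \<beta> * real m + 2) / C2) / (real n)\<^sup>2 * (real (tri n gs) * \<bar>Y n gs\<bar> + real (tri n gs))"
proof -
  define s where "s = 2 * \<beta> * real m + 2"
  have s: "s \<ge> 1" using beta_pos by (simp add: s_def)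
  define d where "d = D n gs"
  define T where "T = real (tri n gs)"
  have T: "T \<ge> 0" by (simp add: T_def)
  define e where "e = C2 * real n"
  have e: "e > 0" using C2_pos n by (simp add: e_def)
  have d: "d \<ge> real n / 2" using D_lower[OF c] n by (simp add: d_def)
  hence d0: "d > 0" using n by linarith
  have "Cl n gs - 3 / e * T = 3 * T / (d * e) * (e - d)"
    using d0 e by (simp add: Cl_def d_def[symmetric] T_def[symmetric] field_simps)
  hence "\<bar>Cl n gs - 3 / e * T\<bar> = 3 * T / (d * e) * \<bar>e - d\<bar>"
    using T d0 e by (simp add: abs_mult)
  also have "\<dots> \<le> 3 * T / (real n / 2 * e) * (s * (\<bar>Y n gs\<bar> + 1))"
  proof (intro mult_mono divide_left_mono)
    show "\<bar>e - d\<bar> \<le> s * (\<bar>Y n gs\<bar> + 1)"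
    proof -
      have "\<bar>e - d\<bar> \<le> \<bar>Y n gs\<bar> / 2 + s" using D_eq[OF c] s unfolding d_def e_def s_def by linarith
      also have "\<bar>Y n gs\<bar> / 2 \<le> s * \<bar>Y n gs\<bar>" using s mult_right_mono[of "1/2" s "\<bar>Y n gs\<bar>"] by simp
      finally show ?thesis by (simp add: distrib_left)
    qed
  qed (use T d d0 e n in \<open>auto intro!: mult_right_mono mult_pos_pos\<close>)
  also have "\<dots> = (6 * s / C2) / (real n)\<^sup>2 * (T * \<bar>Y n gs\<bar> + T)"
    using C2_pos n by (simp add: e_def power2_eq_square field_simps)
  finally show ?thesis unfolding e_def T_def s_def .
qed

text \<open>Below the level B replace |y| by B; above it replace T by A and insert (|y|/B)^(2k-1) >=
  1. The product of dependent quantities is thus reduced to the mean of T and a moment of y.\<close>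

lemma truncated_product:
  fixes T y B A :: real
  assumes "0 \<le> T" "T \<le> A" "B > 0" "k \<ge> 1"
  shows "T * \<bar>y\<bar> \<le> B * T + A / B ^ (2 * k - 1) * y ^ (2 * k)"
proof (cases "\<bar>y\<bar> \<le> B")
  case True
  have "T * \<bar>y\<bar> \<le> B * T" using mult_left_mono[OF True assms(1)] by (simp add: mult.commute)
  moreover have "A / B ^ (2 * k - 1) * y ^ (2 * k) \<ge> 0" using assms by (simp add: power_mult)
  ultimately show ?thesis by linarith
next
  case False
  have pow: "y ^ (2 * k) = \<bar>y\<bar> ^ (2 * k - 1) * \<bar>y\<bar>"
    using power_minus_mult[of "2 * k" "\<bar>y\<bar>"] assms by (simp add: power_even_abs)
  have "B ^ (2 * k - 1) \<le> \<bar>y\<bar> ^ (2 * k - 1)" using False assms by (intro power_mono) auto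
  hence "1 * \<bar>y\<bar> \<le> \<bar>y\<bar> ^ (2 * k - 1) / B ^ (2 * k - 1) * \<bar>y\<bar>"
    using assms by (intro mult_right_mono) auto
  hence "T * \<bar>y\<bar> \<le> A * (\<bar>y\<bar> ^ (2 * k - 1) / B ^ (2 * k - 1) * \<bar>y\<bar>)"
    using assms by (intro mult_mono) auto
  also have "\<dots> = A / B ^ (2 * k - 1) * y ^ (2 * k)" unfolding pow by simp
  finally show ?thesis using assms by (simp add: add_increasing)
qed

text \<open>The deviation |Y| exceeds n^(1-d) so rarely that its high moments beat the trivial
  bound (nm)^3 for the number of triangles.\<close>

lemma E_tri_Y: "\<exists>K\<ge>0. \<forall>n\<ge>1. E n (\<lambda>gs. real (tri n gs) * \<bar>Y n gs\<bar> + real (tri n gs)) \<le> K * real n"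
proof -
  \<comment> \<open>(1 - d) - (1/2 + theta) = d: the level n^(1-d) exceeds the order n^(1/2 + theta)
    suggested by the moments of \<open>Y\<close> by the factor n^d.\<close>
  define d where "d = (1 - 2 * theta) / 4"
  have d: "d > 0" "d < 1" using theta_less theta_pos by (auto simp: d_def)
  \<comment> \<open>The exponent of the moment term comes out as 5 - k(1 - 2 theta)/2 - d, which is
    at most 1 once k(1 - 2 theta) >= 8.\<close>
  obtain k0 :: nat where k0: "real k0 \<ge> 8 / (1 - 2 * theta)" using real_arch_simple by blast
  define k where "k = Suc k0"
  have k1: "k \<ge> 1" by (simp add: k_def)
  have "real k \<ge> 8 / (1 - 2 * theta)" using k0 by (simp add: k_def)
  hence k8: "real k * (1 - 2 * theta) \<ge> 8" using theta_less by (simp add: field_simps)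
  obtain KT where KT: "KT \<ge> 0" "\<And>n. n \<ge> 1 \<Longrightarrow> \<bar>E n (\<lambda>hs. real (tri n hs)) - (real m - 1) * theta\<^sup>2 / real m * rho * ln (real n)\<bar> \<le> KT"
    using E_tri_asymp by blast
  obtain KY where KY: "KY \<ge> 0" "\<And>n. n \<ge> 1 \<Longrightarrow> E n (\<lambda>hs. Y n hs ^ (2 * k)) \<le> KY * real n powr (real k + 2 * real k * theta + 1)"
    using E_Y_moment[OF k1] by blast
  define L where "L = \<bar>(real m - 1) * theta\<^sup>2 / real m * rho\<bar>"
  define M where "M = L / d + KT"
  have M: "M \<ge> 0" using d KT by (simp add: M_def L_def)
  have ET: "E n (\<lambda>hs. real (tri n hs)) \<le> M * real n powr d" if n: "n \<ge> 1" for n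
  proof -
    have "ln (real n) \<ge> 0" using n by simp
    hence "(real m - 1) * theta\<^sup>2 / real m * rho * ln (real n) \<le> L * ln (real n)"
      unfolding L_def by (rule mult_right_mono[OF abs_ge_self])
    also have "\<dots> \<le> L * (real n powr d / d)"
      using d n by (intro mult_left_mono ln_powr_bound) (auto simp: L_def)
    finally have "E n (\<lambda>hs. real (tri n hs)) \<le> L / d * real n powr d + KT" using KT(2)[OF n] by (simp add: abs_le_iff)
    also have "KT \<le> KT * real n powr d"
      using KT(1) d n ge_one_powr_ge_zero[of "real n" d] by (simp add: mult_le_cancel_left1)
    finally show ?thesis by (simp add: M_def distrib_right)
  qed
  define K where "K = M + real m ^ 3 * KY + M"
  have "E n (\<lambda>gs. real (tri n gs) * \<bar>Y n gs\<bar> + real (tri n gs)) \<le> K * real n" if n: "n \<ge> 1" for n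
  proof -
    define B where "B = real n powr (1 - d)"
    define A where "A = (real n * real m) ^ 3"
    have B: "B > 0" using n by (simp add: B_def)
    have A: "A \<ge> 0" by (simp add: A_def)
    have "E n (\<lambda>gs. real (tri n gs) * \<bar>Y n gs\<bar> + real (tri n gs))
       \<le> E n (\<lambda>gs. (B * real (tri n gs) + A / B ^ (2 * k - 1) * Y n gs ^ (2 * k)) + real (tri n gs))"
      by (rule E_mono[OF n]) (use truncated_product[OF _ tri_le B k1] in \<open>auto simp: A_def\<close>)
    also have "\<dots> = (B * E n (\<lambda>gs. real (tri n gs)) + A / B ^ (2 * k - 1) * E n (\<lambda>gs. Y n gs ^ (2 * k))) + E n (\<lambda>gs. real (tri n gs))"
      by (simp only: E_add E_cmult)
    also have "B * E n (\<lambda>gs. real (tri n gs)) \<le> B * (M * real n powr d)" using B by (intro mult_left_mono ET n) auto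
    also have "\<dots> = M * real n" using n by (simp add: B_def flip: powr_add)
    also have "E n (\<lambda>gs. real (tri n gs)) \<le> M * real n"
    proof -
      have "real n powr d \<le> real n powr 1" using n d by (intro powr_le_powr) auto
      hence "M * real n powr d \<le> M * real n" using M n by (intro mult_left_mono) auto
      thus ?thesis using ET[OF n] by linarith
    qed
    also have "A / B ^ (2 * k - 1) * E n (\<lambda>gs. Y n gs ^ (2 * k)) \<le> real m ^ 3 * KY * real n"
    proof -
      have "A / B ^ (2 * k - 1) * E n (\<lambda>gs. Y n gs ^ (2 * k)) \<le> A / B ^ (2 * k - 1) * (KY * real n powr (real k + 2 * real k * theta + 1))"
        using A B by (intro mult_left_mono KY n) auto
      also have "\<dots> = real m ^ 3 * KY * (real n powr 3 / real n powr ((1 - d) * real (2 * k - 1)) * real n powr (real k + 2 * real k * theta + 1))"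
      proof -
        have Bp: "B ^ (2 * k - 1) = real n powr ((1 - d) * real (2 * k - 1))"
          using B by (simp add: B_def powr_powr flip: powr_realpow)
        have Ap: "A = real m ^ 3 * real n powr 3" using n by (simp add: A_def power_mult_distrib)
        show ?thesis unfolding Ap Bp by simp
      qed
      also have "real n powr 3 / real n powr ((1 - d) * real (2 * k - 1)) * real n powr (real k + 2 * real k * theta + 1)
        = real n powr (3 - (1 - d) * real (2 * k - 1) + (real k + 2 * real k * theta + 1))"
        by (simp only: powr_diff powr_add)
      also have "\<dots> \<le> real n powr 1"
      proof (rule powr_le_powr[OF n])
        have "real (2 * k - 1) = 2 * real k - 1" using k1 by (simp add: of_nat_diff)
        hence "3 - (1 - d) * real (2 * k - 1) + (real k + 2 * real k * theta + 1)
          = 5 - real k * (1 - 2 * theta) + 2 * (real k * d) - d" by (simp add: algebra_simps)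
        also have "2 * (real k * d) = real k * (1 - 2 * theta) / 2" by (simp add: d_def)
        finally show "3 - (1 - d) * real (2 * k - 1) + (real k + 2 * real k * theta + 1) \<le> 1"
          using k8 d by linarith
      qed
      finally show ?thesis using KY by (simp add: mult_left_mono)
    qed
    finally show ?thesis by (simp add: K_def distrib_right)
  qed
  moreover have "K \<ge> 0" using M KY by (simp add: K_def)
  ultimately show ?thesis by blast
qed

definition C1 :: real where
  "C1 = real m * (real m - 1) * (1 + \<beta>)^2 / \<beta>^2 + real m * (real m - 1)^2 * (1 + \<beta>)^3 / (\<beta>^2 * (2 + \<beta>))"

text \<open>Everything reduces to (m-1)(1+beta) mu/(beta^2 (2+beta)); writing the factor m(1+beta) +
  1 of \<open>mu\<close> as (2+beta) + (m-1)(1+beta) separates the two terms of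
  \<open>C1\<close>.\<close>

lemma C1_eq: "(real m - 1) * theta\<^sup>2 / real m * rho = C1"
proof -
  have b: "\<beta> \<noteq> 0" "2 + \<beta> \<noteq> 0" "real m \<noteq> 0" using beta_pos m_pos by auto
  have "rho = real m * (1 + \<beta>) * theta * (mu * ((2 + \<beta>) / \<beta>)) * ((2 + \<beta>) / \<beta>)"
    using b by (simp add: rho_def lam_def one_minus_theta)
  also have "theta = 1 / (2 + \<beta>)" by (rule theta_def)
  finally have "(real m - 1) * theta\<^sup>2 / real m * rho = (real m - 1) * (1 + \<beta>) * mu / (\<beta>\<^sup>2 * (2 + \<beta>))"
    using b by (simp add: theta_def power2_eq_square divide_simps)
  also have "(real m - 1) * (1 + \<beta>) * mu
      = real m * (real m - 1) * (1 + \<beta>)^2 * (2 + \<beta>) + real m * (real m - 1)^2 * (1 + \<beta>)^3"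
    by (simp add: mu_eq algebra_simps power2_eq_square power3_eq_cube)
  also have "\<dots> / (\<beta>\<^sup>2 * (2 + \<beta>)) = C1" using b by (simp add: C1_def add_divide_distrib)
  finally show ?thesis .
qed

text \<open>Two errors of order 1/n: that of replacing the denominator by c_2 n under the mean, and
  the O(1) error of the mean number of triangles divided by c_2 n.\<close>

lemma exp_clustering_asymp:
  "(\<lambda>n::nat. exp_clustering \<beta> m n - 3 * C1 * ln (real n) / (C2 * real n)) \<in> O(\<lambda>n. 1 / real n)"
proof -
  obtain KT where KT: "KT \<ge> 0" "\<And>n. n \<ge> 1 \<Longrightarrow> \<bar>E n (\<lambda>hs. real (tri n hs)) - C1 * ln (real n)\<bar> \<le> KT"
    using E_tri_asymp unfolding C1_eq by blast
  obtain K where K: "K \<ge> 0" "\<And>n. n \<ge> 1 \<Longrightarrow> E n (\<lambda>gs. real (tri n gs) * \<bar>Y n gs\<bar> + real (tri n gs)) \<le> K * real n"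
    using E_tri_Y by blast
  define q where "q = 6 * (2 * \<beta> * real m + 2) / C2"
  have q: "q \<ge> 0" using C2_pos beta_pos by (simp add: q_def)
  have "\<bar>exp_clustering \<beta> m n - 3 * C1 * ln (real n) / (C2 * real n)\<bar> \<le> (q * K + 3 * KT / C2) * (1 / real n)"
    if n: "n \<ge> 4" for n
  proof -
    have n1: "n \<ge> 1" using n by simp
    let ?T = "E n (\<lambda>gs. real (tri n gs))"
    have "\<bar>E n (Cl n) - 3 / (C2 * real n) * ?T\<bar> = \<bar>E n (\<lambda>gs. Cl n gs - 3 / (C2 * real n) * real (tri n gs))\<bar>"
      by (simp only: E_diff E_cmult)
    also have "\<dots> \<le> E n (\<lambda>gs. q / (real n)\<^sup>2 * (real (tri n gs) * \<bar>Y n gs\<bar> + real (tri n gs)))"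
      unfolding q_def by (rule E_abs_le[OF n1 Cl_approx[OF _ n]])
    also have "\<dots> = q / (real n)\<^sup>2 * E n (\<lambda>gs. real (tri n gs) * \<bar>Y n gs\<bar> + real (tri n gs))" by (rule E_cmult)
    also have "\<dots> \<le> q / (real n)\<^sup>2 * (K * real n)" using q by (intro mult_left_mono K n1) auto
    also have "\<dots> = q * K * (1 / real n)" using n by (simp add: power2_eq_square)
    finally have 1: "\<bar>E n (Cl n) - 3 / (C2 * real n) * ?T\<bar> \<le> q * K * (1 / real n)" .
    define w where "w = 3 / (C2 * real n)"
    have w: "w \<ge> 0" using C2_pos by (simp add: w_def)
    have "w * ?T - 3 * C1 * ln (real n) / (C2 * real n) = w * (?T - C1 * ln (real n))"
      by (simp add: w_def right_diff_distrib)
    hence "\<bar>w * ?T - 3 * C1 * ln (real n) / (C2 * real n)\<bar> = w * \<bar>?T - C1 * ln (real n)\<bar>"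
      using w by (simp only: abs_mult abs_of_nonneg)
    also have "\<dots> \<le> w * KT" by (intro mult_left_mono KT n1 w)
    also have "\<dots> = 3 * KT / C2 * (1 / real n)" by (simp add: w_def)
    finally have 2: "\<bar>3 / (C2 * real n) * ?T - 3 * C1 * ln (real n) / (C2 * real n)\<bar> \<le> 3 * KT / C2 * (1 / real n)"
      unfolding w_def .
    show ?thesis unfolding exp_clustering_eq[OF n1] distrib_right using 1 2 by linarith
  qed
  thus ?thesis
    by (intro bigoI[of _ "q * K + 3 * KT / C2"] eventually_sequentiallyI[of 4]) auto
qed

end

theorem theorem10:
  fixes \<beta> :: real and m :: nat
  assumes "\<beta> > 0" and "m > 0"
  defines "c1 \<equiv> real m * (real m - 1) * (1 + \<beta>)^2 / \<beta>^2
              + real m * (real m - 1)^2 * (1 + \<beta>)^3 / (\<beta>^2 * (2 + \<beta>))"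
      and "c2 \<equiv> (2 + 5 * \<beta>) / (2 * \<beta>) * (real m)^2 + (2 - \<beta>) / (2 * \<beta>) * real m"
  shows "(\<lambda>n::nat. exp_clustering \<beta> m n - 3 * c1 * ln (real n) / (c2 * real n))
           \<in> O(\<lambda>n. 1 / real n)"
proof -
  interpret merged_tree \<beta> m using assms(1,2) by unfold_locales
  show ?thesis using exp_clustering_asymp unfolding C1_def C2_def c1_def c2_def .
qed

end
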